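(* For every $k \ge 2$, every eigenvalue $\lambda \in [-3,3]$ of the adjacency operator of $T_k$ gives rise to an eigenvalue $\mu = \lambda^2 - 3 \in [-3,6]$ of the adjacency operator of $X_k$. In particular, there exists a constant $C$ with $0 < C < 6$, independent of $k$, such that for all $k \ge 2$: (i) the graphs $X_k$ form a family of $6$-regular expanders, and the adjacency spectrum of $X_k$ is contained in $[-3,C] \cup \{6\}$; (ii) the bipartite graphs $T_k$ form a family of $3$-regular expanders, and the adjacency spectrum of $T_k$ is contained in $[-\sqrt{C+3},\sqrt{C+3}] \cup \{\pm 3\}$.
   Context: Let $\widetilde G = \langle x_0,\dots,x_6 \mid x_i x_{i+1} x_{i+3}\ (i=0,\dots,6)\rangle$ with indices taken modulo $7$, and let $G \le \widetilde G$ be the index-two subgroup generated by $x_0, x_1$; it contains $x_3 = x_1^{-1}x_0^{-1}$. Put $S = \{x_0^{\pm1}, x_1^{\pm1}, x_3^{\pm1}\}$. The group $G$ has a fixed faithful representation (constructed by Peyerimhoff and Vdovina, building on Cartwright–Mantero–Steger–Zappa) by infinite upper triangular block Toeplitz matrices: the diagonal blocks are the $3\times 3$ identity matrix over $\mathbb F_2$, and for each $j \ge 1$ the $j$-th upper block diagonal is the $3$-periodic sequence $a_{j1},a_{j2},a_{j3},a_{j1},a_{j2},\dots$ of matrices in $M(3,\mathbb F_2)$, only finitely many upper diagonals being nonzero. For $k \ge 1$ let $G^k$ be the (normal) subgroup of elements of $G$ whose matrices have vanishing first $k$ upper block diagonals, and let $G_k = G/G^k$ (a finite $2$-group); the images of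 $x_0,x_1,x_3$ in $G_k$ are denoted by the same letters. $X_k$ is the Cayley graph $\mathrm{Cay}(G_k,S)$ ($6$-regular). $T_k$ is obtained from $X_k$ by the $(\Delta-Y)$-transformation applied to all triangles of $X_k$: for every triangle $\{h, hx_0, hx_0x_1\}$ ($h \in G_k$; note $hx_0x_1 = hx_3^{-1}$) one adds a new vertex adjacent to its three vertices and deletes the three edges of the triangle. $T_k$ is a bipartite $3$-regular graph whose vertex set contains $G_k = V(X_k)$ and has $2|G_k|$ elements. A family of $d$-regular graphs is an expander family if the second largest adjacency eigenvalue is bounded away from $d$ uniformly. *)

theory Defs
  imports
    "HOL-Analysis.Cartesian_Space"
    "HOL-Algebra.Generated_Groups"
    "HOL-Algebra.Coset"
    "HOL-Library.Multiset"
    "HOL-Library.Function_Algebras"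
    "HOL-Library.Z2"
begin

section \<open>Groups given by generators and relators\<close>

text \<open>A letter \<open>(a, True)\<close> is the generator \<open>a\<close>, and \<open>(a, False)\<close> is its formal inverse.\<close>

type_synonym 'a word = "('a \<times> bool) list"

inductive word_eq :: "'a set \<Rightarrow> 'a word set \<Rightarrow> 'a word \<Rightarrow> 'a word \<Rightarrow> bool"
  for X :: "'a set" and R :: "'a word set" where
  refl: "u \<in> lists (X \<times> UNIV) \<Longrightarrow> word_eq X R u u"
| sym: "word_eq X R u v \<Longrightarrow> word_eq X R v u"
| trans: "word_eq X R u v \<Longrightarrow> word_eq X R v w \<Longrightarrow> word_eq X R u w"
| cancel: "u \<in> lists (X \<times> UNIV) \<Longrightarrow> v \<in> lists (X \<times> UNIV) \<Longrightarrow> a \<in> X \<Longrightarrow>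
    word_eq X R (u @ [(a, b), (a, \<not> b)] @ v) (u @ v)"
| relator: "u \<in> lists (X \<times> UNIV) \<Longrightarrow> v \<in> lists (X \<times> UNIV) \<Longrightarrow> r \<in> R \<Longrightarrow> r \<in> lists (X \<times> UNIV) \<Longrightarrow>
    word_eq X R (u @ r @ v) (u @ v)"

definition word_class :: "'a set \<Rightarrow> 'a word set \<Rightarrow> 'a word \<Rightarrow> 'a word set" where
  "word_class X R w = {v. word_eq X R w v}"

definition presented_group :: "'a set \<Rightarrow> 'a word set \<Rightarrow> 'a word set monoid" where
  "presented_group X R =
    \<lparr>carrier = word_class X R ` lists (X \<times> UNIV),
     monoid.mult = (\<lambda>A B. \<Union>u\<in>A. \<Union>v\<in>B. word_class X R (u @ v)),
     one = word_class X R []\<rparr>"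


section \<open>The groups \<open>\<langle>x\<^sub>0,\<dots>,x\<^sub>6\<rangle>\<close> and \<open>\<langle>x\<^sub>0,x\<^sub>1\<rangle>\<close>\<close>

definition relators :: "nat word set" where
  "relators = {[(i, True), ((i + 1) mod 7, True), ((i + 3) mod 7, True)] | i. i < 7}"

definition G_tilde :: "nat word set monoid" where
  "G_tilde = presented_group {..<7} relators"

definition gen :: "nat \<Rightarrow> nat word set" where
  "gen i = word_class {..<7} relators [(i, True)]"

definition G_group :: "nat word set monoid" where
  "G_group = G_tilde\<lparr>carrier := generate G_tilde {gen 0, gen 1}\<rparr>"


section \<open>The representation by infinite block Toeplitz matrices\<close>

type_synonym block = "bit ^ 3 ^ 3"

type_synonym block_matrix = "nat \<Rightarrow> nat \<Rightarrow> block"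

definition block_toeplitz :: "block_matrix monoid" where
  "block_toeplitz =
    \<lparr>carrier = {A. (\<forall>i j. j < i \<longrightarrow> A i j = 0) \<and> (\<forall>i. A i i = mat 1) \<and>
                   (\<forall>i j. A (i + 3) (j + 3) = A i j) \<and>
                   (\<exists>N. \<forall>i j. i + N < j \<longrightarrow> A i j = 0)},
     monoid.mult = (\<lambda>A B i j. \<Sum>l = i..j. A i l ** B l j),
     one = (\<lambda>i j. if i = j then mat 1 else 0)\<rparr>"

text \<open>
  \<^bold>\<open>Origin of the matrices.\<close> Let \<open>\<xi> \<in> F\<^sub>8\<close> be a root of \<open>t^3 + t + 1\<close>, let \<open>\<sigma>\<close> be an indeterminate
  with \<open>\<sigma> b = b^2 \<sigma>\<close> for \<open>b \<in> F\<^sub>8\<close>, and let \<open>Z = \<sigma>^3\<close>, which is central. In the twisted polynomial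
  ring \<open>F\<^sub>8[\<sigma>]\<close> put \<open>g\<^sub>i = 1 + \<xi>^i \<sigma>\<close>. Then \<open>g\<^sub>i g\<^sub>i\<^sub>+\<^sub>1 g\<^sub>i\<^sub>+\<^sub>3 = 1 + Z\<close>, so that \<open>x\<^sub>i \<mapsto> g\<^sub>i\<close> defines a
  homomorphism to the multiplicative group of the division algebra \<open>F\<^sub>8(\<sigma>)\<close> modulo its centre; this
  is the group of Cartwright, Mantero, Steger and Zappa for the projective plane of order 2.
  Let it act from the right on row vectors by \<open>y \<mapsto> g\<inverse> y g\<close>. With \<open>s = Z / (1 + Z)\<close> this action
  preserves the \<open>F\<^sub>2[s]\<close>-module spanned by \<open>F\<^sub>8\<close>, \<open>F\<^sub>8 \<sigma> / (1 + Z)\<close> and \<open>F\<^sub>8 \<sigma>^2 / (1 + Z)\<close>. Let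
  \<open>e\<^sub>0 = 1\<close>, \<open>e\<^sub>1 = \<sigma> / (1 + Z)\<close>, \<open>e\<^sub>2 = \<sigma>^2 / (1 + Z)\<close> and \<open>e\<^sub>j\<^sub>+\<^sub>3 = s e\<^sub>j\<close>. As \<open>F\<^sub>8 e\<^sub>j\<close> is a copy of
  \<open>F\<^sub>2^3\<close>, the action is given by an infinite matrix of \<open>3 \<times> 3\<close> blocks, which commutes with the
  shift by \<open>s\<close> (3-periodicity) and is unitriangular. With \<open>u = \<xi>^i\<close>, conjugation by \<open>g\<^sub>i\<close> is

  \<open>b e\<^sub>0 \<mapsto> b e\<^sub>0 + u(b + b^2) e\<^sub>1 + u^3(b^2 + b^4) e\<^sub>2 + (b + b^4) e\<^sub>3\<close>

  \<open>b e\<^sub>1 \<mapsto> b e\<^sub>1 + (u^2 b + u b^2)(e\<^sub>2 + e\<^sub>5) + (u^5 b^2 + u^3 b^4)(e\<^sub>3 + e\<^sub>6) + (b + u^4 b^4) e\<^sub>4\<close>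

  \<open>b e\<^sub>2 \<mapsto> b e\<^sub>2 + (u^4 b + u b^2)(e\<^sub>3 + e\<^sub>6) + (u^2 b^2 + u^3 b^4) e\<^sub>4 + (b + u^5 b^4) e\<^sub>5\<close>

  Vanishing of the first \<open>k\<close> upper block diagonals means that an element acts trivially on
  \<open>\<sigma>^j D / \<sigma>\<^bsup>j+k+1\<^esup> D\<close> for all \<open>j\<close>, where \<open>D\<close> is the valuation ring at \<open>\<sigma> = 0\<close>; it does not
  depend on the choice of the bases of the pieces.
\<close>

text \<open>Multiplication by \<open>\<xi>\<close> and squaring on \<open>F\<^sub>8\<close>, acting on row vectors in the basis \<open>1, \<xi>, \<xi>^2\<close>.\<close>

definition xi_mat :: block where
  "xi_mat = vector [vector [0, 1, 0], vector [0, 0, 1], vector [1, 1, 0]]"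

definition frob_mat :: block where
  "frob_mat = vector [vector [1, 0, 0], vector [0, 0, 1], vector [0, 1, 1]]"

definition xi_pow :: "nat \<Rightarrow> block" where
  "xi_pow n = ((**) xi_mat ^^ n) (mat 1)"

text \<open>Row \<open>r\<close> of the following list contains the blocks in the positions \<open>(r, r), \<dots>, (r, r + 5)\<close>
  of the matrix of \<open>x\<^sub>i\<close>.\<close>

definition gen_blocks :: "nat \<Rightarrow> block list list" where
  "gen_blocks i =
    (let u = (\<lambda>n. xi_pow (n * i)); F = frob_mat; F2 = frob_mat ** frob_mat in
     [[mat 1, u 1 + F ** u 1, F ** u 3 + F2 ** u 3, mat 1 + F2, 0, 0],
      [mat 1, u 2 + F ** u 1, F ** u 5 + F2 ** u 3, mat 1 + F2 ** u 4,
         u 2 + F ** u 1, F ** u 5 + F2 ** u 3],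
      [mat 1, u 4 + F ** u 1, F ** u 2 + F2 ** u 3, mat 1 + F2 ** u 5,
         u 4 + F ** u 1, 0]])"

definition gen_matrix :: "nat \<Rightarrow> block_matrix" where
  "gen_matrix i = (\<lambda>r c. if r \<le> c \<and> c \<le> r + 5 then gen_blocks i ! (r mod 3) ! (c - r) else 0)"

fun letter_matrix :: "nat \<times> bool \<Rightarrow> block_matrix" where
  "letter_matrix (i, True) = gen_matrix i"
| "letter_matrix (i, False) = inv\<^bsub>block_toeplitz\<^esub> gen_matrix i"

definition word_matrix :: "nat word \<Rightarrow> block_matrix" where
  "word_matrix w = foldr (\<lambda>l A. letter_matrix l \<otimes>\<^bsub>block_toeplitz\<^esub> A) w \<one>\<^bsub>block_toeplitz\<^esub>"

text \<open>The matrices of the generators satisfy the relators, so all words in a class have the same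
  matrix.\<close>

definition rep :: "nat word set \<Rightarrow> block_matrix" where
  "rep g = the_elem (word_matrix ` g)"

definition G_up :: "nat \<Rightarrow> nat word set set" where
  "G_up k = {g \<in> carrier G_group. \<forall>d \<in> {1..k}. \<forall>i. rep g i (i + d) = 0}"

definition G_quot :: "nat \<Rightarrow> nat word set set monoid" where
  "G_quot k = G_group Mod G_up k"

definition x_quot :: "nat \<Rightarrow> nat \<Rightarrow> nat word set set" where
  "x_quot k i = G_up k #>\<^bsub>G_group\<^esub> gen i"

definition S_quot :: "nat \<Rightarrow> nat word set set set" where
  "S_quot k = (\<Union>i \<in> {0, 1, 3}. {x_quot k i, inv\<^bsub>G_quot k\<^esub> (x_quot k i)})"


section \<open>Graphs\<close>

type_synonym 'v graph = "'v set \<times> 'v set set"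

abbreviation verts :: "'v graph \<Rightarrow> 'v set" where "verts \<equiv> fst"

abbreviation edges :: "'v graph \<Rightarrow> 'v set set" where "edges \<equiv> snd"

definition nbrs :: "'v graph \<Rightarrow> 'v \<Rightarrow> 'v set" where
  "nbrs \<Gamma> v = {w \<in> verts \<Gamma>. {v, w} \<in> edges \<Gamma>}"

definition finite_simple :: "'v graph \<Rightarrow> bool" where
  "finite_simple \<Gamma> \<longleftrightarrow> finite (verts \<Gamma>) \<and> (\<forall>e \<in> edges \<Gamma>. e \<subseteq> verts \<Gamma> \<and> card e = 2)"

definition regular :: "nat \<Rightarrow> 'v graph \<Rightarrow> bool" where
  "regular d \<Gamma> \<longleftrightarrow> (\<forall>v \<in> verts \<Gamma>. card (nbrs \<Gamma> v) = d)"

definition bipartite :: "'v graph \<Rightarrow> bool" where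
  "bipartite \<Gamma> \<longleftrightarrow> (\<exists>A B. verts \<Gamma> = A \<union> B \<and> A \<inter> B = {} \<and>
     (\<forall>e \<in> edges \<Gamma>. \<exists>a \<in> A. \<exists>b \<in> B. e = {a, b}))"

definition Cay :: "('a, 'b) monoid_scheme \<Rightarrow> 'a set \<Rightarrow> 'a graph" where
  "Cay H T = (carrier H, {{h, h \<otimes>\<^bsub>H\<^esub> s} | h s. h \<in> carrier H \<and> s \<in> T})"

definition triangles :: "'v graph \<Rightarrow> 'v set set" where
  "triangles \<Gamma> = {t. t \<subseteq> verts \<Gamma> \<and> card t = 3 \<and> (\<forall>v \<in> t. \<forall>w \<in> t. v \<noteq> w \<longrightarrow> {v, w} \<in> edges \<Gamma>)}"

text \<open>The \<open>(\<Delta>-Y)\<close>-transformation of all triangles: \<open>Inl v\<close> is the old vertex \<open>v\<close>, and \<open>Inr t\<close> is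
  the new vertex in the triangle \<open>t\<close>.\<close>

definition delta_Y :: "'v graph \<Rightarrow> ('v + 'v set) graph" where
  "delta_Y \<Gamma> =
    (Inl ` verts \<Gamma> \<union> Inr ` triangles \<Gamma>,
     {Inl ` e | e. e \<in> edges \<Gamma> \<and> \<not> (\<exists>t \<in> triangles \<Gamma>. e \<subseteq> t)} \<union>
     {{Inl v, Inr t} | v t. t \<in> triangles \<Gamma> \<and> v \<in> t})"


section \<open>Adjacency spectrum\<close>

text \<open>Functions on the vertex set are represented by functions which vanish outside of it.\<close>

definition functions_on :: "'v graph \<Rightarrow> ('v \<Rightarrow> real) set" where
  "functions_on \<Gamma> = {f. \<forall>v. v \<notin> verts \<Gamma> \<longrightarrow> f v = 0}"

definition adj_op :: "'v graph \<Rightarrow> ('v \<Rightarrow> real) \<Rightarrow> 'v \<Rightarrow> real" where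
  "adj_op \<Gamma> f v = (if v \<in> verts \<Gamma> then \<Sum>w \<in> nbrs \<Gamma> v. f w else 0)"

definition eigenspace :: "'v graph \<Rightarrow> real \<Rightarrow> ('v \<Rightarrow> real) set" where
  "eigenspace \<Gamma> \<mu> = {f \<in> functions_on \<Gamma>. adj_op \<Gamma> f = (\<lambda>v. \<mu> * f v)}"

definition adj_spectrum :: "'v graph \<Rightarrow> real set" where
  "adj_spectrum \<Gamma> = {\<mu>. \<exists>f \<in> eigenspace \<Gamma> \<mu>. f \<noteq> (\<lambda>_. 0)}"

definition eigen_mult :: "'v graph \<Rightarrow> real \<Rightarrow> nat" where
  "eigen_mult \<Gamma> \<mu> = vector_space.dim (\<lambda>(c :: real) (f :: 'v \<Rightarrow> real) v. c * f v) (eigenspace \<Gamma> \<mu>)"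

text \<open>The eigenvalues in decreasing order, repeated according to their multiplicities. In
  particular the second largest eigenvalue of a \<open>d\<close>-regular graph is \<open>d\<close> if the graph is not
  connected.\<close>

definition eigenvalue_list :: "'v graph \<Rightarrow> real list" where
  "eigenvalue_list \<Gamma> =
    rev (sorted_list_of_multiset (\<Sum>\<mu> \<in> adj_spectrum \<Gamma>. replicate_mset (eigen_mult \<Gamma> \<mu>) \<mu>))"

definition second_eigenvalue :: "'v graph \<Rightarrow> real" where
  "second_eigenvalue \<Gamma> = eigenvalue_list \<Gamma> ! 1"

definition expander_family :: "nat \<Rightarrow> 'i set \<Rightarrow> ('i \<Rightarrow> 'v graph) \<Rightarrow> bool" where
  "expander_family d I \<Gamma> \<longleftrightarrow>
     (\<forall>k \<in> I. finite_simple (\<Gamma> k) \<and> regular d (\<Gamma> k)) \<and>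
     (\<exists>\<epsilon>>0. \<forall>k \<in> I. second_eigenvalue (\<Gamma> k) \<le> real d - \<epsilon>)"


section \<open>The graphs \<open>X\<^sub>k\<close> and \<open>T\<^sub>k\<close>\<close>

definition X_graph :: "nat \<Rightarrow> nat word set set graph" where
  "X_graph k = Cay (G_quot k) (S_quot k)"

text \<open>For \<open>k \<ge> 2\<close> the triangles of \<open>X\<^sub>k\<close> are exactly the sets \<open>{h, h x\<^sub>0, h x\<^sub>0 x\<^sub>1}\<close>, one for each
  \<open>h \<in> G\<^sub>k\<close>.\<close>

definition T_graph :: "nat \<Rightarrow> (nat word set set + nat word set set set) graph" where
  "T_graph k = delta_Y (X_graph k)"

end

theory Submission
  imports Defs "HOL-Analysis.Convex" "HOL-Library.Indicator_Function"
begin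

text \<open>Let the generators \<open>x\<^sub>0,\<dots>,x\<^sub>6\<close> act on a finite set \<open>\<Omega>\<close>, such as the vertex set of a finite quotient
  of the building. The link of a point is the incidence graph of the Fano plane, whose eigenvalues
  other than \<open>3, -3\<close> are at most \<open>\<surd>2 < 3/2\<close> in absolute value. Summing the resulting inequality over all
  links (Garland's method) gives \<open>\<Delta>\<^sup>2 \<ge> 14/11 \<Delta>\<close> for the Laplacian \<open>\<Delta>\<close> of the seven generators, hence a
  spectral gap which does not depend on \<open>\<Omega>\<close>. It passes to the generators \<open>x\<^sub>0, x\<^sub>1, x\<^sub>3\<close> of the subgroup
  \<open>G\<close> of index two, since the seven generators act on functions induced from \<open>G\<close> through fixed words
  in \<open>x\<^sub>0\<close> and \<open>x\<^sub>1\<close>. The spectra of \<open>X\<^sub>k\<close> and \<open>T\<^sub>k\<close> are related by the square incidence matrix \<open>N\<close> between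
  vertices and triangles, for which \<open>A + 3 = N N\<^sup>T\<close>, where \<open>A\<close> is the adjacency matrix of \<open>X\<^sub>k\<close>.\<close>

section \<open>Adjacency spectra\<close>

text \<open>A bound s for the nontrivial singular values of the Fano plane gives the factor 14 (3 -
  2 s) / (3 - s) in Garland's inequality, whence the threshold 3/2; the choice s = 10/7 gives 14/11.
  The gap is then derived without an eigenbasis: \<Delta> g = f is solved for f of mean zero, and
  Cauchy-Schwarz is applied to the Dirichlet form. The obstacle is that the seven generators live in
  the larger group, while G^k is known to be normal in G alone, so they do not act on G_k. They act
  on the right cosets of G^k in the larger group. Pairs (h, e) of an element of G_k and a Boolean
  are coordinates for these cosets, and functions on G_k are pulled back along the first coordinate.
  The matrices make the quotients finite, their first two diagonals exclude unwanted coincidences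
  between products of at most three generators, and the first diagonal supplies a sign character. As
  the second eigenvalue is entry 1 of a list with multiplicities, the top eigenvalue has to be
  proved simple and another eigenvalue has to be exhibited: -2 for X_k and -3 for T_k.\<close>

lemma sum_fun_apply: "(\<Sum>i\<in>I. F i) x = (\<Sum>i\<in>I. F i x)"
  by (induction I rule: infinite_finite_induct) auto

interpretation fun_vs: vector_space "\<lambda>(c::real) (f::'v \<Rightarrow> real) v. c * f v"
  by standard (auto simp: fun_eq_iff algebra_simps)

lemma supported_in_span:
  fixes f :: "'v \<Rightarrow> real"
  assumes "finite V" and "\<And>v. v \<notin> V \<Longrightarrow> f v = 0"
  shows "f \<in> fun_vs.span ((\<lambda>v. indicator {v}) ` V)"
proof -
  have "f = (\<Sum>v\<in>V. (\<lambda>w. f v * indicator {v} w))"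
  proof
    fix w
    have "(\<Sum>v\<in>V. f v * indicator {v} w) = (\<Sum>v\<in>V. if w = v then f v else 0)"
      by (intro sum.cong) (auto simp: indicator_def)
    also have "\<dots> = f w"
      using assms by simp
    finally show "f w = (\<Sum>v\<in>V. (\<lambda>w. f v * indicator {v} w)) w"
      by (simp add: sum_fun_apply)
  qed
  also have "\<dots> \<in> fun_vs.span ((\<lambda>v. indicator {v}) ` V)"
    by (intro fun_vs.span_sum fun_vs.span_scale fun_vs.span_base imageI)
  finally show ?thesis .
qed

lemma supported_independent_finite:
  fixes B :: "('v \<Rightarrow> real) set"
  assumes "finite V" and "\<And>f v. f \<in> B \<Longrightarrow> v \<notin> V \<Longrightarrow> f v = 0" and "fun_vs.independent B"
  shows "finite B"
  using fun_vs.independent_span_bound[of "(\<lambda>v. indicator {v}) ` V" B] assms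
    supported_in_span[OF assms(1)] by blast

text \<open>The space of all functions may have infinite dimension, but support in the finite set
  \<open>V\<close> bounds independent sets. A vector of \<open>W\<close> outside the image would
  extend the image of a basis of \<open>W\<close> to an independent set that is too large. Applied
  below to the Laplacian and to the incidence operator \<open>up\<close>.\<close>

lemma supported_inj_imp_surj:
  fixes T :: "('v \<Rightarrow> real) \<Rightarrow> 'v \<Rightarrow> real"
  assumes "finite V" and supp: "\<And>f v. f \<in> W \<Longrightarrow> v \<notin> V \<Longrightarrow> f v = 0"
    and W: "fun_vs.subspace W"
    and T: "Vector_Spaces.linear (\<lambda>(c::real) f v. c * f v) (\<lambda>(c::real) f v. c * f v) T"
    and TW: "T ` W \<subseteq> W" and inj: "\<And>f. f \<in> W \<Longrightarrow> T f = 0 \<Longrightarrow> f = 0"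
  shows "W \<subseteq> T ` W"
proof -
  interpret T: Vector_Spaces.linear "\<lambda>(c::real) f v. c * f v" "\<lambda>(c::real) f v. c * f v" T by (rule T)
  obtain B where B: "B \<subseteq> W" "fun_vs.independent B" "W \<subseteq> fun_vs.span B"
    using fun_vs.maximal_independent_subset[of W] .
  have spanB: "fun_vs.span B = W"
    using B W by (metis fun_vs.span_minimal subset_antisym)
  have finB: "finite B"
    by (rule supported_independent_finite[OF assms(1)]) (use B supp in auto)
  have injB: "inj_on T (fun_vs.span B)"
    unfolding spanB
  proof (rule inj_onI)
    fix f g assume fg: "f \<in> W" "g \<in> W" "T f = T g"
    then have "T (f - g) = 0" by (simp add: T.diff)
    with inj[OF fun_vs.subspace_diff[OF W fg(1,2)]] have "f - g = 0" by blast
    then show "f = g" by simp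
  qed
  have indT: "fun_vs.independent (T ` B)"
    using T.independent_injective_image[OF B(2) injB] .
  have cardT: "card (T ` B) = card B"
    by (rule card_image) (use injB fun_vs.span_superset inj_on_subset in blast)
  have "fun_vs.span (T ` B) = T ` W"
    using T.span_image[of B] spanB by simp
  moreover have "w \<in> fun_vs.span (T ` B)" if w: "w \<in> W" for w
  proof (rule ccontr)
    assume n: "w \<notin> fun_vs.span (T ` B)"
    have "fun_vs.independent (insert w (T ` B))"
      using n indT by (rule fun_vs.independent_insertI)
    moreover have "insert w (T ` B) \<subseteq> fun_vs.span B"
      using TW w spanB B(1) by auto
    ultimately have "card (insert w (T ` B)) \<le> card B"
      using fun_vs.independent_span_bound[OF finB] by blast
    moreover have "w \<notin> T ` B" using n fun_vs.span_base by blast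
    ultimately show False using finB cardT by simp
  qed
  ultimately show ?thesis by blast
qed

section \<open>Symmetry of the adjacency operator, multiplicities and the second eigenvalue\<close>

lemma adj_op_symmetric:
  assumes "finite (verts \<Gamma>)"
  shows "(\<Sum>v\<in>verts \<Gamma>. adj_op \<Gamma> f v * g v) = (\<Sum>v\<in>verts \<Gamma>. f v * adj_op \<Gamma> g v)"
proof -
  have "(\<Sum>v\<in>verts \<Gamma>. adj_op \<Gamma> f v * g v) = (\<Sum>v\<in>verts \<Gamma>. \<Sum>w\<in>{w \<in> verts \<Gamma>. {v, w} \<in> edges \<Gamma>}. f w * g v)"
    by (intro sum.cong) (auto simp: adj_op_def nbrs_def sum_distrib_right)
  also have "\<dots> = (\<Sum>w\<in>verts \<Gamma>. \<Sum>v\<in>{v \<in> verts \<Gamma>. {v, w} \<in> edges \<Gamma>}. f w * g v)"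
    using assms by (rule sum.swap_restrict[OF _ assms])
  also have "\<dots> = (\<Sum>v\<in>verts \<Gamma>. f v * adj_op \<Gamma> g v)"
    by (intro sum.cong) (auto simp: adj_op_def nbrs_def sum_distrib_left insert_commute)
  finally show ?thesis .
qed

lemma eigenfunctions_orthogonal:
  assumes "finite (verts \<Gamma>)" and "f \<in> eigenspace \<Gamma> \<mu>" and "g \<in> eigenspace \<Gamma> \<nu>" and "\<mu> \<noteq> \<nu>"
  shows "(\<Sum>v\<in>verts \<Gamma>. f v * g v) = 0"
proof -
  have "adj_op \<Gamma> f = (\<lambda>v. \<mu> * f v)" "adj_op \<Gamma> g = (\<lambda>v. \<nu> * g v)"
    using assms by (auto simp: eigenspace_def)
  then have "\<mu> * (\<Sum>v\<in>verts \<Gamma>. f v * g v) = \<nu> * (\<Sum>v\<in>verts \<Gamma>. f v * g v)"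
    using adj_op_symmetric[OF assms(1), of f g] by (simp add: sum_distrib_left algebra_simps)
  with assms(4) show ?thesis by simp
qed

lemma eigenfunction_norm_pos:
  assumes "finite (verts \<Gamma>)" and "f \<in> functions_on \<Gamma>" and "f \<noteq> (\<lambda>_. 0)"
  shows "0 < (\<Sum>v\<in>verts \<Gamma>. (f v)\<^sup>2)"
proof -
  obtain v where "f v \<noteq> 0" using assms(3) by auto
  with assms show ?thesis
    by (intro sum_pos2[of _ v]) (auto simp: functions_on_def)
qed

text \<open>Eigenfunctions of distinct eigenvalues are orthogonal, hence independent, and all of
  them are supported on a finite set. Finiteness gives the sum in \<open>eigenvalue_list\<close> its
  intended value, since a sum over an infinite set is 0.\<close>

lemma finite_adj_spectrum:
  assumes fin: "finite (verts \<Gamma>)"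
  shows "finite (adj_spectrum \<Gamma>)"
proof -
  have "\<forall>\<mu>\<in>adj_spectrum \<Gamma>. \<exists>f. f \<in> eigenspace \<Gamma> \<mu> \<and> f \<noteq> (\<lambda>_. 0)"
    by (auto simp: adj_spectrum_def)
  then obtain F where F: "\<And>\<mu>. \<mu> \<in> adj_spectrum \<Gamma> \<Longrightarrow> F \<mu> \<in> eigenspace \<Gamma> \<mu> \<and> F \<mu> \<noteq> (\<lambda>_. 0)"
    by (metis bchoice)
  have pos: "0 < (\<Sum>v\<in>verts \<Gamma>. (F \<mu> v)\<^sup>2)" if "\<mu> \<in> adj_spectrum \<Gamma>" for \<mu>
    using eigenfunction_norm_pos[OF fin] F[OF that] by (auto simp: eigenspace_def)
  have inj: "inj_on F (adj_spectrum \<Gamma>)"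
  proof (rule inj_onI, rule ccontr)
    fix \<mu> \<nu> assume *: "\<mu> \<in> adj_spectrum \<Gamma>" "\<nu> \<in> adj_spectrum \<Gamma>" "F \<mu> = F \<nu>" "\<mu> \<noteq> \<nu>"
    then have "(\<Sum>v\<in>verts \<Gamma>. F \<mu> v * F \<nu> v) = 0"
      using F[OF *(1)] F[OF *(2)] *(4) by (intro eigenfunctions_orthogonal[OF fin, of _ \<mu> _ \<nu>]) simp_all
    with pos[OF *(1)] *(3) show False by (simp add: power2_eq_square)
  qed
  have "fun_vs.independent (F ` adj_spectrum \<Gamma>)"
    unfolding fun_vs.independent_explicit_finite_subsets
  proof (intro allI impI ballI)
    fix S u f0
    assume S: "S \<subseteq> F ` adj_spectrum \<Gamma>" "finite S" "(\<Sum>f\<in>S. (\<lambda>v. u f * f v)) = 0" and f0: "f0 \<in> S"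
    obtain \<mu> where \<mu>: "\<mu> \<in> adj_spectrum \<Gamma>" "f0 = F \<mu>" using S f0 by auto
    \<comment> \<open>Pairing the vanishing combination with \<open>f0\<close> isolates the
      coefficient of \<open>f0\<close>.\<close>
    have "0 = (\<Sum>w\<in>verts \<Gamma>. (\<Sum>f\<in>S. u f * f w) * f0 w)"
      using S(3) by (simp add: fun_eq_iff sum_fun_apply)
    also have "\<dots> = (\<Sum>f\<in>S. u f * (\<Sum>w\<in>verts \<Gamma>. f w * f0 w))"
      unfolding sum_distrib_left sum_distrib_right mult.assoc by (rule sum.swap)
    also have "\<dots> = (\<Sum>f\<in>S. if f = f0 then u f * (\<Sum>w\<in>verts \<Gamma>. (f0 w)\<^sup>2) else 0)"
    proof (rule sum.cong[OF HOL.refl])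
      fix f assume "f \<in> S"
      then obtain \<nu> where \<nu>: "\<nu> \<in> adj_spectrum \<Gamma>" "f = F \<nu>" using S by auto
      show "u f * (\<Sum>w\<in>verts \<Gamma>. f w * f0 w) = (if f = f0 then u f * (\<Sum>w\<in>verts \<Gamma>. (f0 w)\<^sup>2) else 0)"
      proof (cases "f = f0")
        case False
        then have "\<nu> \<noteq> \<mu>" using \<mu> \<nu> by auto
        then have "(\<Sum>w\<in>verts \<Gamma>. f w * f0 w) = 0"
          using F \<mu> \<nu> by (intro eigenfunctions_orthogonal[OF fin, of _ \<nu> _ \<mu>]) simp_all
        then show ?thesis using False by simp
      qed (simp add: power2_eq_square)
    qed
    also have "\<dots> = u f0 * (\<Sum>w\<in>verts \<Gamma>. (f0 w)\<^sup>2)"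
      using S(2) f0 by simp
    finally show "u f0 = 0" using pos[OF \<mu>(1)] \<mu>(2) by auto
  qed
  then have "finite (F ` adj_spectrum \<Gamma>)"
    by (rule supported_independent_finite[OF fin, rotated]) (use F in \<open>auto simp: eigenspace_def functions_on_def\<close>)
  with inj show ?thesis by (simp add: finite_image_iff)
qed

lemma eigen_mult_pos:
  assumes "finite (verts \<Gamma>)" and "\<mu> \<in> adj_spectrum \<Gamma>"
  shows "0 < eigen_mult \<Gamma> \<mu>"
proof -
  obtain B where B: "B \<subseteq> eigenspace \<Gamma> \<mu>" "fun_vs.independent B" "eigenspace \<Gamma> \<mu> \<subseteq> fun_vs.span B"
    "card B = fun_vs.dim (eigenspace \<Gamma> \<mu>)"
    using fun_vs.basis_exists[of "eigenspace \<Gamma> \<mu>"] .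
  \<comment> \<open>An infinite basis would have \<open>card\<close> 0 and so make the dimension
    vanish.\<close>
  have "finite B"
    by (rule supported_independent_finite[OF assms(1)]) (use B in \<open>auto simp: eigenspace_def functions_on_def\<close>)
  moreover have "B \<noteq> {}"
    using B(3) assms(2) by (auto simp: adj_spectrum_def zero_fun_def)
  ultimately show ?thesis using B(4) by (auto simp: eigen_mult_def card_gt_0_iff)
qed

lemma eigen_mult_le_1:
  fixes \<Gamma> :: "'v graph"
  assumes "\<And>f v w. f \<in> eigenspace \<Gamma> \<mu> \<Longrightarrow> v \<in> verts \<Gamma> \<Longrightarrow> w \<in> verts \<Gamma> \<Longrightarrow> f v = f w"
  shows "eigen_mult \<Gamma> \<mu> \<le> 1"
proof -
  have "f \<in> fun_vs.span {indicator (verts \<Gamma>)}" if f: "f \<in> eigenspace \<Gamma> \<mu>" for f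
  proof -
    obtain c where "f = (\<lambda>v. c * indicator (verts \<Gamma>) v)"
    proof (cases "verts \<Gamma> = {}")
      case True
      then show ?thesis using f that[of 0] by (auto simp: eigenspace_def functions_on_def fun_eq_iff)
    next
      case False
      then obtain w where "w \<in> verts \<Gamma>" by auto
      have "f v = f w * indicator (verts \<Gamma>) v" for v
        using assms[OF f, of v w] f \<open>w \<in> verts \<Gamma>\<close>
        by (cases "v \<in> verts \<Gamma>") (auto simp: eigenspace_def functions_on_def)
      then show ?thesis by (intro that) auto
    qed
    then show ?thesis using fun_vs.span_scale[OF fun_vs.span_base] by blast
  qed
  then have "fun_vs.dim (eigenspace \<Gamma> \<mu>) \<le> card {indicator (verts \<Gamma>) :: 'v \<Rightarrow> real}"
    by (intro fun_vs.dim_le_card) auto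
  then show ?thesis by (simp add: eigen_mult_def)
qed

text \<open>Entry 1 of the decreasing list can exceed \<open>C\<close> only if entries 0 and 1 are
  both \<open>d\<close>, against the simplicity of \<open>d\<close> that \<open>const\<close>
  provides. The second eigenvalue \<open>\<mu>\<close> ensures that entry 1 exists, so that
  \<open>! 1\<close> is meaningful.\<close>

lemma second_eigenvalue_le:
  fixes \<Gamma> :: "'v graph"
  assumes fin: "finite (verts \<Gamma>)"
    and spec: "\<And>\<mu>. \<mu> \<in> adj_spectrum \<Gamma> \<Longrightarrow> \<mu> \<le> C \<or> \<mu> = d"
    and d: "d \<in> adj_spectrum \<Gamma>" and \<mu>: "\<mu> \<in> adj_spectrum \<Gamma>" "\<mu> \<noteq> d"
    and const: "\<And>f v w. f \<in> eigenspace \<Gamma> d \<Longrightarrow> v \<in> verts \<Gamma> \<Longrightarrow> w \<in> verts \<Gamma> \<Longrightarrow> f v = f w"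
  shows "second_eigenvalue \<Gamma> \<le> C"
proof (rule ccontr)
  define M where "M = (\<Sum>\<mu> \<in> adj_spectrum \<Gamma>. replicate_mset (eigen_mult \<Gamma> \<mu>) \<mu>)"
  define L where "L = eigenvalue_list \<Gamma>"
  have finS: "finite (adj_spectrum \<Gamma>)" by (rule finite_adj_spectrum[OF fin])
  have count: "count M x = (if x \<in> adj_spectrum \<Gamma> then eigen_mult \<Gamma> x else 0)" for x
    using finS by (simp add: M_def count_sum)
  have L: "L = rev (sorted_list_of_multiset M)"
    by (simp add: L_def M_def eigenvalue_list_def)
  then have msetL: "mset L = M" by simp
  have setL: "set L \<subseteq> adj_spectrum \<Gamma>"
    using count by (metis msetL count_mset_0_iff subsetI)
  have "count M d \<le> 1"
    using eigen_mult_le_1[of \<Gamma> d, OF const] count d by simp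
  have "2 \<le> count M d + count M \<mu>"
    using count d \<mu> eigen_mult_pos[OF fin d] eigen_mult_pos[OF fin \<mu>(1)] by simp
  also have "\<dots> \<le> size M"
  proof -
    have "replicate_mset (count M d) d + replicate_mset (count M \<mu>) \<mu> \<subseteq># M"
      using \<mu>(2) by (auto simp: subseteq_mset_def)
    then show ?thesis by (metis size_mset_mono size_union size_replicate_mset)
  qed
  finally have len: "2 \<le> length L" using msetL by (metis size_mset)
  have sorted: "sorted (rev L)" by (simp add: L)
  assume "\<not> second_eigenvalue \<Gamma> \<le> C"
  then have gt: "C < L ! 1" by (simp add: second_eigenvalue_def L_def)
  have le: "L ! 1 \<le> L ! 0"
    using sorted_rev_nth_mono[OF sorted, of 0 1] len by simp
  have "L ! 0 \<in> adj_spectrum \<Gamma>" "L ! 1 \<in> adj_spectrum \<Gamma>"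
  proof -
    have "0 < length L" "1 < length L" using len by linarith+
    then show "L ! 0 \<in> adj_spectrum \<Gamma>" "L ! 1 \<in> adj_spectrum \<Gamma>"
      using setL nth_mem by blast+
  qed
  from spec[OF this(1)] spec[OF this(2)] gt le have "L ! 0 = d" "L ! 1 = d"
    by linarith+
  moreover obtain x y L' where "L = x # y # L'"
    using len by (metis Suc_le_length_iff numeral_2_eq_2)
  ultimately have "2 \<le> count (mset L) d" by simp
  with \<open>count M d \<le> 1\<close> msetL show False by simp
qed

section \<open>Garland's method for the relators of the Fano plane\<close>

lemma sum_lessThan_7: "(\<Sum>j<7. f j) = f 0 + f 1 + f 2 + f 3 + f 4 + f 5 + f (6 :: nat)"
  for f :: "nat \<Rightarrow> real"
  by (simp add: lessThan_nat_numeral add_ac)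

text \<open>The incidence matrix of the Fano plane, with \<open>j\<close> incident to \<open>j + 1, j + 2, j + 4\<close>, has the
  singular values \<open>3\<close> and \<open>\<surd>2\<close>. The rational bound \<open>10/7\<close> for \<open>\<surd>2\<close> is good enough, as it is
  less than \<open>3/2\<close>.\<close>

lemma fano_link_inequality:
  fixes a b :: "nat \<Rightarrow> real"
  shows "2 * (\<Sum>j<7. b j * (a ((j + 1) mod 7) + a ((j + 2) mod 7) + a ((j + 4) mod 7)))
     \<le> 10/7 * ((\<Sum>j<7. (a j)\<^sup>2) + (\<Sum>j<7. (b j)\<^sup>2)) + 11/98 * ((\<Sum>j<7. a j) + (\<Sum>j<7. b j))\<^sup>2"
proof -
  define n where "n j = a ((j + 1) mod 7) + a ((j + 2) mod 7) + a ((j + 4) mod 7)" for j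
  define \<alpha> \<beta> where "\<alpha> = (\<Sum>j<7. a j)" and "\<beta> = (\<Sum>j<7. b j)"
  have n1: "(\<Sum>j<7. n j) = 3 * \<alpha>"
    by (simp add: \<alpha>_def n_def sum_lessThan_7 numeral_2_eq_2)
  \<comment> \<open>As {1, 2, 4} is a difference set modulo 7, each product of two different values
    of \<open>a\<close> occurs in exactly one of the squares. In matrix form this is 2 I + J for the
    Gram matrix.\<close>
  have n2: "(\<Sum>j<7. (n j)\<^sup>2) = 2 * (\<Sum>j<7. (a j)\<^sup>2) + \<alpha>\<^sup>2"
    by (simp add: \<alpha>_def n_def sum_lessThan_7 numeral_2_eq_2) (simp add: power2_eq_square algebra_simps)
  \<comment> \<open>The mean of \<open>10/7 * b j - n j\<close>; subtracting it leaves the mean-free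
    part in the square.\<close>
  define c where "c = 10/7 * \<beta>/7 - 3 * \<alpha>/7"
  have "(\<Sum>j<7. (10/7 * b j - n j - c)\<^sup>2)
    = (\<Sum>j<7. (10/7)\<^sup>2 * (b j)\<^sup>2 + (n j)\<^sup>2 + c\<^sup>2 - 2 * 10/7 * (b j * n j) - 2 * 10/7 * c * b j + 2 * c * n j)"
    by (intro sum.cong) (simp_all add: power2_eq_square field_simps)
  also have "\<dots> = (10/7)\<^sup>2 * (\<Sum>j<7. (b j)\<^sup>2) + (\<Sum>j<7. (n j)\<^sup>2) + 7 * c\<^sup>2 - 2 * 10/7 * (\<Sum>j<7. b j * n j)
      - 2 * 10/7 * c * \<beta> + 2 * c * (\<Sum>j<7. n j)"
    unfolding \<beta>_def by (simp add: sum.distrib sum_subtractf sum_distrib_left)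
  finally have 1: "0 \<le> (10/7)\<^sup>2 * (\<Sum>j<7. (b j)\<^sup>2) + 2 * (\<Sum>j<7. (a j)\<^sup>2) + \<alpha>\<^sup>2 + 7 * c\<^sup>2
      - 2 * 10/7 * (\<Sum>j<7. b j * n j) - 2 * 10/7 * c * \<beta> + 6 * c * \<alpha>"
    using sum_nonneg[of "{..<7::nat}" "\<lambda>j. (10/7 * b j - n j - c)\<^sup>2"] by (simp add: n1 n2)
  have "(\<Sum>j<7. (a j - \<alpha>/7)\<^sup>2) = (\<Sum>j<7. (a j)\<^sup>2 - 2 * \<alpha>/7 * a j + \<alpha>\<^sup>2/49)"
    by (intro sum.cong) (simp_all add: power2_eq_square field_simps)
  also have "\<dots> = (\<Sum>j<7. (a j)\<^sup>2) - 2 * \<alpha>/7 * \<alpha> + \<alpha>\<^sup>2/7"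
    by (simp add: sum.distrib sum_subtractf sum_distrib_left \<alpha>_def)
  finally have 2: "0 \<le> (\<Sum>j<7. (a j)\<^sup>2) - \<alpha>\<^sup>2/7"
    using sum_nonneg[of "{..<7::nat}" "\<lambda>j. (a j - \<alpha>/7)\<^sup>2"] by (simp add: power2_eq_square)
  have 3: "0 \<le> (\<alpha> - \<beta>)\<^sup>2" by simp
  \<comment> \<open>The coefficient 11/98 = (3 - 10/7) / 14 makes equal constants an equality case.
    The slack is 1/35 = 10/7 - 7/5 on the mean-free part of \<open>a\<close>, and 31/98 on the
    difference of the two sums.\<close>
  have "10/7 * ((\<Sum>j<7. (a j)\<^sup>2) + (\<Sum>j<7. (b j)\<^sup>2)) + 11/98 * (\<alpha> + \<beta>)\<^sup>2 - 2 * (\<Sum>j<7. b j * n j)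
    = 7/10 * ((10/7)\<^sup>2 * (\<Sum>j<7. (b j)\<^sup>2) + 2 * (\<Sum>j<7. (a j)\<^sup>2) + \<alpha>\<^sup>2 + 7 * c\<^sup>2
      - 2 * 10/7 * (\<Sum>j<7. b j * n j) - 2 * 10/7 * c * \<beta> + 6 * c * \<alpha>)
      + 1/35 * ((\<Sum>j<7. (a j)\<^sup>2) - \<alpha>\<^sup>2/7) + 31/98 * (\<alpha> - \<beta>)\<^sup>2"
    by (simp add: c_def power2_eq_square field_simps)
  also have "\<dots> \<ge> 0"
    by (intro add_nonneg_nonneg mult_nonneg_nonneg 1 2 3) simp_all
  finally show ?thesis by (simp add: \<alpha>_def \<beta>_def n_def)
qed

text \<open>A right action: the word x_i x_{i+1} x_{i+3} applies \<open>X i\<close> first.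
  Transitivity is stated in the form in which it is used, as constancy of invariant
  functions.\<close>

locale fano_action =
  fixes \<Omega> :: "'w set" and X :: "nat \<Rightarrow> 'w \<Rightarrow> 'w"
  assumes finite_\<Omega>: "finite \<Omega>"
    and maps: "i < 7 \<Longrightarrow> \<omega> \<in> \<Omega> \<Longrightarrow> X i \<omega> \<in> \<Omega>"
    and relation: "i < 7 \<Longrightarrow> \<omega> \<in> \<Omega> \<Longrightarrow> X ((i + 3) mod 7) (X ((i + 1) mod 7) (X i \<omega>)) = \<omega>"
    and invariant_const: "(\<And>i \<omega>. i < 7 \<Longrightarrow> \<omega> \<in> \<Omega> \<Longrightarrow> (f :: 'w \<Rightarrow> real) (X i \<omega>) = f \<omega>) \<Longrightarrow>
       \<omega> \<in> \<Omega> \<Longrightarrow> \<omega>' \<in> \<Omega> \<Longrightarrow> f \<omega> = f \<omega>'"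
begin

text \<open>The action of the inverse of x_i, read off from the relator.\<close>

definition Y :: "nat \<Rightarrow> 'w \<Rightarrow> 'w" where
  "Y i \<omega> = X ((i + 3) mod 7) (X ((i + 1) mod 7) \<omega>)"

definition A :: "('w \<Rightarrow> real) \<Rightarrow> 'w \<Rightarrow> real" where
  "A f \<omega> = (\<Sum>i<7. f (X i \<omega>)) + (\<Sum>i<7. f (Y i \<omega>))"

definition ip :: "('w \<Rightarrow> real) \<Rightarrow> ('w \<Rightarrow> real) \<Rightarrow> real" where
  "ip f g = (\<Sum>\<omega>\<in>\<Omega>. f \<omega> * g \<omega>)"

lemma Y_maps: "i < 7 \<Longrightarrow> \<omega> \<in> \<Omega> \<Longrightarrow> Y i \<omega> \<in> \<Omega>"
  by (simp add: Y_def maps)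

lemma Y_X: "i < 7 \<Longrightarrow> \<omega> \<in> \<Omega> \<Longrightarrow> Y i (X i \<omega>) = \<omega>"
  using relation by (simp only: Y_def)

lemma bij_X:
  assumes "i < 7" shows "bij_betw (X i) \<Omega> \<Omega>"
proof -
  have "inj_on (X i) \<Omega>"
    by (metis inj_onI Y_X assms)
  moreover have "X i ` \<Omega> = \<Omega>"
    using maps assms calculation finite_\<Omega> by (intro endo_inj_surj) auto
  ultimately show ?thesis by (simp add: bij_betw_def)
qed

lemma X_Y:
  assumes "i < 7" "\<omega> \<in> \<Omega>" shows "X i (Y i \<omega>) = \<omega>"
proof -
  obtain \<eta> where "\<eta> \<in> \<Omega>" "\<omega> = X i \<eta>"
    using bij_X assms by (metis bij_betw_imp_surj_on imageE)
  then show ?thesis using Y_X assms by simp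
qed

lemma sum_X: "i < 7 \<Longrightarrow> (\<Sum>\<omega>\<in>\<Omega>. h (X i \<omega>)) = (\<Sum>\<omega>\<in>\<Omega>. h \<omega> :: real)"
  using sum.reindex_bij_betw[OF bij_X] .

lemma sum_Y: "i < 7 \<Longrightarrow> (\<Sum>\<omega>\<in>\<Omega>. h (Y i \<omega>)) = (\<Sum>\<omega>\<in>\<Omega>. h \<omega> :: real)"
  using sum_X[of i "\<lambda>\<omega>. h (Y i \<omega>)"] by (simp add: Y_X)

lemma ip_X: "i < 7 \<Longrightarrow> ip f (\<lambda>\<omega>. g (X i \<omega>)) = ip (\<lambda>\<omega>. f (Y i \<omega>)) g"
  using sum_X[of i "\<lambda>\<omega>. f (Y i \<omega>) * g \<omega>"] by (simp add: ip_def Y_X)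

lemma ip_commute: "ip f g = ip g f"
  by (simp add: ip_def mult.commute)

text \<open>Rotations of one relator: two consecutive letters multiply to the inverse of the
  third.\<close>

lemma X_X:
  assumes "i < 7" "\<omega> \<in> \<Omega>"
  shows "X ((i + 1) mod 7) (X i \<omega>) = Y ((i + 3) mod 7) \<omega>"
    and "X ((i + 3) mod 7) (X ((i + 1) mod 7) \<omega>) = Y i \<omega>"
    and "X i (X ((i + 3) mod 7) \<omega>) = Y ((i + 1) mod 7) \<omega>"
proof -
  show 1: "X ((i + 1) mod 7) (X i \<omega>) = Y ((i + 3) mod 7) \<omega>"
    using Y_X[of "(i + 3) mod 7" "X ((i + 1) mod 7) (X i \<omega>)"] relation[of i \<omega>] assms maps by simp
  show 2: "X ((i + 3) mod 7) (X ((i + 1) mod 7) \<omega>) = Y i \<omega>" by (simp add: Y_def)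
  define \<eta> where "\<eta> = Y ((i + 1) mod 7) \<omega>"
  have \<eta>: "\<eta> \<in> \<Omega>" "X ((i + 1) mod 7) \<eta> = \<omega>"
    using assms Y_maps X_Y by (simp_all add: \<eta>_def)
  then have "X i (X ((i + 3) mod 7) \<omega>) = \<eta>"
    using X_Y[of i \<eta>] assms(1) by (simp only: Y_def)
  then show "X i (X ((i + 3) mod 7) \<omega>) = Y ((i + 1) mod 7) \<omega>"
    by (simp only: \<eta>_def)
qed

text \<open>The link of \<open>\<omega>\<close> has the vertices \<open>X i \<omega>\<close> and
  \<open>Y j \<omega>\<close>, joined when x_j x_i starts a rotated relator, that is, when i - j is
  1, 2 or 4 modulo 7. Shifting \<open>\<omega>\<close> by \<open>X j\<close> turns a link edge into
  the inverse of the third letter of its relator, and each inverse generator arises from three link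
  edges.\<close>

lemma sum_links:
  "(\<Sum>\<omega>\<in>\<Omega>. \<Sum>j<7. f (Y j \<omega>) * (f (X ((j + 1) mod 7) \<omega>) + f (X ((j + 2) mod 7) \<omega>) + f (X ((j + 4) mod 7) \<omega>)))
    = 3 * (\<Sum>k<7. ip f (\<lambda>\<omega>. f (Y k \<omega>)))"
proof -
  have step: "(\<Sum>\<omega>\<in>\<Omega>. f (Y j \<omega>) * f (X i \<omega>)) = ip f (\<lambda>\<omega>. f (Y k \<omega>))"
    if "j < 7" "\<And>\<omega>. \<omega> \<in> \<Omega> \<Longrightarrow> X i (X j \<omega>) = Y k \<omega>" for i j k
  proof -
    have "(\<Sum>\<omega>\<in>\<Omega>. f (Y j \<omega>) * f (X i \<omega>)) = (\<Sum>\<omega>\<in>\<Omega>. f (Y j (X j \<omega>)) * f (X i (X j \<omega>)))"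
      using sum_X[OF that(1), of "\<lambda>\<omega>. f (Y j \<omega>) * f (X i \<omega>)"] by simp
    then show ?thesis using that by (simp add: ip_def Y_X)
  qed
  have 1: "(\<Sum>\<omega>\<in>\<Omega>. f (Y j \<omega>) * f (X ((j + 1) mod 7) \<omega>)) = ip f (\<lambda>\<omega>. f (Y ((j + 3) mod 7) \<omega>))" if "j < 7" for j
    using that by (intro step X_X(1))
  have 2: "(\<Sum>\<omega>\<in>\<Omega>. f (Y j \<omega>) * f (X ((j + 2) mod 7) \<omega>)) = ip f (\<lambda>\<omega>. f (Y ((j + 6) mod 7) \<omega>))" if "j < 7" for j
  proof (rule step[OF that])
    fix \<omega> assume "\<omega> \<in> \<Omega>"
    moreover have "(((j + 6) mod 7) + 3) mod 7 = (j + 2) mod 7" "(((j + 6) mod 7) + 1) mod 7 = j"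
      using that by presburger+
    ultimately show "X ((j + 2) mod 7) (X j \<omega>) = Y ((j + 6) mod 7) \<omega>"
      using X_X(2)[of "(j + 6) mod 7" \<omega>] by simp
  qed
  have 3: "(\<Sum>\<omega>\<in>\<Omega>. f (Y j \<omega>) * f (X ((j + 4) mod 7) \<omega>)) = ip f (\<lambda>\<omega>. f (Y ((j + 5) mod 7) \<omega>))" if "j < 7" for j
  proof (rule step[OF that])
    fix \<omega> assume "\<omega> \<in> \<Omega>"
    moreover have "(((j + 4) mod 7) + 3) mod 7 = j" "(((j + 4) mod 7) + 1) mod 7 = (j + 5) mod 7"
      using that by presburger+
    ultimately show "X ((j + 4) mod 7) (X j \<omega>) = Y ((j + 5) mod 7) \<omega>"
      using X_X(3)[of "(j + 4) mod 7" \<omega>] by simp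
  qed
  have "(\<Sum>\<omega>\<in>\<Omega>. \<Sum>j<7. f (Y j \<omega>) * (f (X ((j + 1) mod 7) \<omega>) + f (X ((j + 2) mod 7) \<omega>) + f (X ((j + 4) mod 7) \<omega>)))
      = (\<Sum>j<7. (\<Sum>\<omega>\<in>\<Omega>. f (Y j \<omega>) * f (X ((j + 1) mod 7) \<omega>)) + (\<Sum>\<omega>\<in>\<Omega>. f (Y j \<omega>) * f (X ((j + 2) mod 7) \<omega>))
          + (\<Sum>\<omega>\<in>\<Omega>. f (Y j \<omega>) * f (X ((j + 4) mod 7) \<omega>)))"
    by (subst sum.swap) (simp only: distrib_left sum.distrib)
  also have "\<dots> = (\<Sum>j<7. ip f (\<lambda>\<omega>. f (Y ((j + 3) mod 7) \<omega>)) + ip f (\<lambda>\<omega>. f (Y ((j + 6) mod 7) \<omega>))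
          + ip f (\<lambda>\<omega>. f (Y ((j + 5) mod 7) \<omega>)))"
    by (intro sum.cong) (simp_all only: 1 2 3 lessThan_iff)
  also have "\<dots> = 3 * (\<Sum>k<7. ip f (\<lambda>\<omega>. f (Y k \<omega>)))"
    by (simp add: sum_lessThan_7 numeral_2_eq_2)
  finally show ?thesis .
qed

definition \<Delta> :: "('w \<Rightarrow> real) \<Rightarrow> 'w \<Rightarrow> real" where
  "\<Delta> f \<omega> = (if \<omega> \<in> \<Omega> then 14 * f \<omega> - A f \<omega> else 0)"

lemma ip_A: "ip f (A f) = 2 * (\<Sum>k<7. ip f (\<lambda>\<omega>. f (Y k \<omega>)))"
proof -
  have "ip f (A f) = (\<Sum>k<7. ip f (\<lambda>\<omega>. f (X k \<omega>))) + (\<Sum>k<7. ip f (\<lambda>\<omega>. f (Y k \<omega>)))"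
    unfolding ip_def A_def by (simp add: sum_distrib_left distrib_left sum.distrib sum.swap[of _ \<Omega>])
  moreover have "(\<Sum>k<7. ip f (\<lambda>\<omega>. f (X k \<omega>))) = (\<Sum>k<7. ip f (\<lambda>\<omega>. f (Y k \<omega>)))"
    by (intro sum.cong HOL.refl) (simp add: ip_X ip_commute)
  ultimately show ?thesis by simp
qed

lemma ip_\<Delta>: "ip f (\<Delta> f) = 14 * ip f f - ip f (A f)"
  by (simp add: ip_def \<Delta>_def algebra_simps sum_subtractf sum_distrib_left)

lemma ip_\<Delta>_\<Delta>: "ip (\<Delta> f) (\<Delta> f) = 196 * ip f f - 28 * ip f (A f) + ip (A f) (A f)"
proof -
  have "ip (\<Delta> f) (\<Delta> f) = (\<Sum>\<omega>\<in>\<Omega>. 196 * (f \<omega> * f \<omega>) - 28 * (f \<omega> * A f \<omega>) + A f \<omega> * A f \<omega>)"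
    unfolding ip_def by (intro sum.cong) (auto simp: \<Delta>_def algebra_simps)
  then show ?thesis by (simp add: ip_def sum.distrib sum_subtractf sum_distrib_left)
qed

lemma ip_self: "ip f f = (\<Sum>\<omega>\<in>\<Omega>. (f \<omega>)\<^sup>2)"
  by (simp add: ip_def power2_eq_square)

text \<open>Garland's step: \<open>fano_link_inequality\<close> is taken at every point with
  \<open>f (X j \<omega>)\<close> and \<open>f (Y j \<omega>)\<close> as the two functions. Their
  total is \<open>A f \<omega>\<close>, so the correction term sums to a multiple of the squared
  norm of \<open>A f\<close>, which is the new information about the square of the
  Laplacian.\<close>

lemma \<Delta>_squared: "14/11 * ip f (\<Delta> f) \<le> ip (\<Delta> f) (\<Delta> f)"
proof -
  have sqX: "(\<Sum>\<omega>\<in>\<Omega>. \<Sum>j<7. (f (X j \<omega>))\<^sup>2) = 7 * ip f f"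
    by (subst sum.swap) (simp add: sum_X[of _ "\<lambda>\<omega>. (f \<omega>)\<^sup>2"] ip_self)
  have sqY: "(\<Sum>\<omega>\<in>\<Omega>. \<Sum>j<7. (f (Y j \<omega>))\<^sup>2) = 7 * ip f f"
    by (subst sum.swap) (simp add: sum_Y[of _ "\<lambda>\<omega>. (f \<omega>)\<^sup>2"] ip_self)
  have "(\<Sum>\<omega>\<in>\<Omega>. 2 * (\<Sum>j<7. f (Y j \<omega>) * (f (X ((j + 1) mod 7) \<omega>) + f (X ((j + 2) mod 7) \<omega>) + f (X ((j + 4) mod 7) \<omega>))))
    \<le> (\<Sum>\<omega>\<in>\<Omega>. 10/7 * ((\<Sum>j<7. (f (X j \<omega>))\<^sup>2) + (\<Sum>j<7. (f (Y j \<omega>))\<^sup>2)) + 11/98 * (A f \<omega>)\<^sup>2)"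
    unfolding A_def by (intro sum_mono fano_link_inequality)
  also have "\<dots> = 20 * ip f f + 11/98 * ip (A f) (A f)"
    unfolding sum.distrib sum_distrib_left[symmetric] sqX sqY by (simp add: ip_def power2_eq_square)
  finally have "3 * ip f (A f) \<le> 20 * ip f f + 11/98 * ip (A f) (A f)"
    unfolding sum_distrib_left[symmetric] sum_links ip_A by simp
  \<comment> \<open>Solving for \<open>ip (A f) (A f)\<close> leaves 196 - 98 * 20/11 = 196/11 in
    front of \<open>ip f f\<close> and 98 * 3/11 - 28 = -14/11 in front of
    \<open>ip f (A f)\<close>.\<close>
  then show ?thesis unfolding ip_\<Delta>_\<Delta> ip_\<Delta> by simp
qed

text \<open>The polarised form allows Cauchy-Schwarz between two different functions.\<close>

lemma dirichlet: "(\<Sum>\<omega>\<in>\<Omega>. \<Sum>i<7. (f (X i \<omega>) - f \<omega>) * (g (X i \<omega>) - g \<omega>)) = ip f (\<Delta> g)"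
proof -
  have "(\<Sum>\<omega>\<in>\<Omega>. (f (X i \<omega>) - f \<omega>) * (g (X i \<omega>) - g \<omega>))
      = 2 * ip f g - ip f (\<lambda>\<omega>. g (X i \<omega>)) - ip f (\<lambda>\<omega>. g (Y i \<omega>))" if i: "i < 7" for i
  proof -
    have "(\<Sum>\<omega>\<in>\<Omega>. (f (X i \<omega>) - f \<omega>) * (g (X i \<omega>) - g \<omega>))
      = (\<Sum>\<omega>\<in>\<Omega>. f (X i \<omega>) * g (X i \<omega>)) + ip f g - ip f (\<lambda>\<omega>. g (X i \<omega>)) - ip g (\<lambda>\<omega>. f (X i \<omega>))"
      by (simp add: ip_def algebra_simps sum.distrib sum_subtractf)
    moreover have "(\<Sum>\<omega>\<in>\<Omega>. f (X i \<omega>) * g (X i \<omega>)) = ip f g"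
      unfolding ip_def by (rule sum_X[OF i])
    moreover have "ip g (\<lambda>\<omega>. f (X i \<omega>)) = ip f (\<lambda>\<omega>. g (Y i \<omega>))"
      using ip_X[OF i] ip_commute by metis
    ultimately show ?thesis by simp
  qed
  then have "(\<Sum>\<omega>\<in>\<Omega>. \<Sum>i<7. (f (X i \<omega>) - f \<omega>) * (g (X i \<omega>) - g \<omega>))
      = (\<Sum>i<7. 2 * ip f g - ip f (\<lambda>\<omega>. g (X i \<omega>)) - ip f (\<lambda>\<omega>. g (Y i \<omega>)))"
    by (subst sum.swap) (intro sum.cong, simp_all)
  also have "\<dots> = 14 * ip f g - (\<Sum>i<7. ip f (\<lambda>\<omega>. g (X i \<omega>))) - (\<Sum>i<7. ip f (\<lambda>\<omega>. g (Y i \<omega>)))"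
    by (simp add: sum_subtractf)
  also have "\<dots> = (\<Sum>\<omega>\<in>\<Omega>. f \<omega> * (14 * g \<omega> - A g \<omega>))"
    unfolding ip_def A_def
    by (simp add: sum_distrib_left right_diff_distrib distrib_left sum.distrib sum_subtractf
        sum.swap[of _ \<Omega>] mult.left_commute)
  also have "\<dots> = ip f (\<Delta> g)"
    unfolding ip_def \<Delta>_def by (intro sum.cong) auto
  finally show ?thesis .
qed

lemma \<Delta>_linear: "Vector_Spaces.linear (\<lambda>(c::real) f v. c * f v) (\<lambda>(c::real) f v. c * f v) \<Delta>"
proof (intro Vector_Spaces.linear.intro fun_vs.vector_space_axioms module_hom.intro
    fun_vs.module_axioms module_hom_axioms.intro)
  show "\<Delta> (f + g) = \<Delta> f + \<Delta> g" for f g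
    by (auto simp: \<Delta>_def A_def fun_eq_iff sum.distrib)
  show "\<Delta> (\<lambda>v. c * f v) = (\<lambda>v. c * \<Delta> f v)" for c f
    by (auto simp: \<Delta>_def A_def fun_eq_iff sum_distrib_left right_diff_distrib distrib_left)
qed

text \<open>A function in the kernel has Dirichlet form 0, so it is invariant and constant, and mean
  zero forces it to vanish. Injectivity on the mean-zero functions gives surjectivity there.\<close>

lemma \<Delta>_surj:
  assumes "\<And>\<omega>. \<omega> \<notin> \<Omega> \<Longrightarrow> f \<omega> = 0" and "(\<Sum>\<omega>\<in>\<Omega>. f \<omega>) = 0"
  shows "\<exists>g. \<Delta> g = f"
proof -
  define W where "W = {f :: 'w \<Rightarrow> real. (\<forall>\<omega>. \<omega> \<notin> \<Omega> \<longrightarrow> f \<omega> = 0) \<and> (\<Sum>\<omega>\<in>\<Omega>. f \<omega>) = 0}"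
  have "W \<subseteq> \<Delta> ` W"
  proof (rule supported_inj_imp_surj[OF finite_\<Omega> _ _ \<Delta>_linear])
    show "fun_vs.subspace W"
      by (rule fun_vs.subspaceI) (auto simp: W_def sum.distrib simp flip: sum_distrib_left)
    show "\<Delta> ` W \<subseteq> W"
    proof safe
      fix f assume "f \<in> W"
      have "ip (\<lambda>_. 1) (\<Delta> f) = 0"
        unfolding dirichlet[symmetric] by simp
      then show "\<Delta> f \<in> W" by (simp add: W_def ip_def \<Delta>_def)
    qed
    fix f assume f: "f \<in> W" "\<Delta> f = 0"
    then have "ip f (\<Delta> f) = 0" by (simp add: ip_def)
    then have "(\<Sum>\<omega>\<in>\<Omega>. \<Sum>i<7. (f (X i \<omega>) - f \<omega>) * (f (X i \<omega>) - f \<omega>)) = 0"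
      by (simp add: dirichlet)
    then have "\<forall>\<omega>\<in>\<Omega>. \<forall>i<7. f (X i \<omega>) = f \<omega>"
      using finite_\<Omega> by (simp add: sum_nonneg_eq_0_iff sum_nonneg)
    then have const: "f \<omega> = f \<omega>'" if "\<omega> \<in> \<Omega>" "\<omega>' \<in> \<Omega>" for \<omega> \<omega>'
      using invariant_const[of f] that by blast
    have "f \<omega> = 0" for \<omega>
    proof (cases "\<omega> \<in> \<Omega>")
      case True
      have "0 = (\<Sum>\<eta>\<in>\<Omega>. f \<eta>)" using f(1) by (simp add: W_def)
      also have "\<dots> = (\<Sum>\<eta>\<in>\<Omega>. f \<omega>)" using True by (intro sum.cong const) auto
      also have "\<dots> = card \<Omega> * f \<omega>" by simp
      finally show ?thesis using True finite_\<Omega> by auto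
    qed (use f(1) in \<open>auto simp: W_def\<close>)
    then show "f = 0" by (simp add: fun_eq_iff)
  qed (auto simp: W_def)
  moreover have "f \<in> W" using assms by (simp add: W_def)
  ultimately show ?thesis by blast
qed

text \<open>Duality in place of diagonalisation: if \<open>\<Delta> g\<close> is \<open>f\<close> on
  \<open>\<Omega>\<close> and \<open>N\<close> is its squared norm, then \<open>E g f = N\<close>
  and \<open>E g g \<le> 11/14 * N\<close>, so Cauchy-Schwarz bounds \<open>E f f\<close> from
  below.\<close>

theorem spectral_gap:
  fixes f :: "'w \<Rightarrow> real"
  assumes "(\<Sum>\<omega>\<in>\<Omega>. f \<omega>) = 0"
  shows "14/11 * (\<Sum>\<omega>\<in>\<Omega>. (f \<omega>)\<^sup>2) \<le> (\<Sum>\<omega>\<in>\<Omega>. \<Sum>i<7. (f (X i \<omega>) - f \<omega>)\<^sup>2)"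
proof -
  define h where "h \<omega> = (if \<omega> \<in> \<Omega> then f \<omega> else 0)" for \<omega>
  obtain g where g: "\<Delta> g = h"
    using \<Delta>_surj[of h] assms by (auto simp: h_def)
  define N where "N = (\<Sum>\<omega>\<in>\<Omega>. (f \<omega>)\<^sup>2)"
  define E where "E u v = (\<Sum>\<omega>\<in>\<Omega>. \<Sum>i<7. (u (X i \<omega>) - u \<omega>) * (v (X i \<omega>) - v \<omega>))" for u v :: "'w \<Rightarrow> real"
  have E: "E u v = (\<Sum>p\<in>\<Omega> \<times> {..<7}. (u (X (snd p) (fst p)) - u (fst p)) * (v (X (snd p) (fst p)) - v (fst p)))" for u v
    unfolding E_def by (simp add: sum.cartesian_product case_prod_beta)
  have E_\<Delta>: "E u v = ip u (\<Delta> v)" for u v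
    unfolding E_def by (rule dirichlet)
  have commute: "E u v = E v u" for u v
    by (simp add: E_def mult.commute)
  have N: "ip f h = N" "ip h h = N"
    by (simp_all add: ip_def h_def N_def power2_eq_square)
  have "E g f = N"
    using commute[of g f] E_\<Delta>[of f g] g N by simp
  moreover have "(E g f)\<^sup>2 \<le> E g g * E f f"
    unfolding E using Cauchy_Schwarz_ineq_sum[of "\<lambda>p. g (X (snd p) (fst p)) - g (fst p)"
        "\<lambda>p. f (X (snd p) (fst p)) - f (fst p)" "\<Omega> \<times> {..<7}"] by (simp add: power2_eq_square)
  moreover have "E g g \<le> 11/14 * N"
    using \<Delta>_squared[of g] g N E_\<Delta>[of g g] by simp
  moreover have E0: "0 \<le> E f f"
    unfolding E_def by (intro sum_nonneg) simp
  ultimately have "N\<^sup>2 \<le> 11/14 * N * E f f"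
    by (metis mult_right_mono order_trans)
  moreover have "0 \<le> N" unfolding N_def by (intro sum_nonneg) simp
  ultimately have "14/11 * N \<le> E f f"
    using E0 by (cases "N = 0") (auto simp: power2_eq_square)
  then show ?thesis by (simp add: N_def E_def power2_eq_square)
qed

end

section \<open>The presented group and its subgroup of index two\<close>

lemma word_eq_in_lists:
  "word_eq X R u v \<Longrightarrow> u \<in> lists (X \<times> UNIV) \<and> v \<in> lists (X \<times> UNIV)"
  by (induction rule: word_eq.induct) auto

lemma word_eq_context:
  assumes "word_eq X R u v" and p: "p \<in> lists (X \<times> UNIV)" and s: "s \<in> lists (X \<times> UNIV)"
  shows "word_eq X R (p @ u @ s) (p @ v @ s)"
  using assms(1)
proof induction
  case (refl u)
  then show ?case using p s by (intro word_eq.refl) auto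
next
  case (cancel u v a b)
  then show ?case using p s word_eq.cancel[of "p @ u" X "v @ s" a R b] by simp
next
  case (relator u v r)
  then show ?case using p s word_eq.relator[of "p @ u" X "v @ s" r R] by simp
qed (blast intro: word_eq.sym word_eq.trans)+

lemma word_eq_append:
  assumes "word_eq X R u u'" and "word_eq X R v v'"
  shows "word_eq X R (u @ v) (u' @ v')"
  using word_eq_context[OF assms(1), of "[]" v] word_eq_context[OF assms(2), of u' "[]"]
    word_eq_in_lists[OF assms(1)] word_eq_in_lists[OF assms(2)] by (auto intro: word_eq.trans)

lemma word_class_eq_iff:
  assumes "u \<in> lists (X \<times> UNIV)"
  shows "word_class X R u = word_class X R v \<longleftrightarrow> word_eq X R u v"
  unfolding word_class_def using assms
  by (auto intro: word_eq.refl word_eq.sym word_eq.trans)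

lemma presented_group_mult:
  assumes "u \<in> lists (X \<times> UNIV)" and "v \<in> lists (X \<times> UNIV)"
  shows "word_class X R u \<otimes>\<^bsub>presented_group X R\<^esub> word_class X R v = word_class X R (u @ v)"
proof -
  have "word_class X R (u' @ v') = word_class X R (u @ v)"
    if "u' \<in> word_class X R u" "v' \<in> word_class X R v" for u' v'
    using that assms by (subst word_class_eq_iff)
      (auto simp: word_class_def intro: word_eq_append word_eq.sym dest: word_eq_in_lists)
  then have "(\<Union>u'\<in>word_class X R u. \<Union>v'\<in>word_class X R v. word_class X R (u' @ v'))
      = (\<Union>u'\<in>word_class X R u. \<Union>v'\<in>word_class X R v. word_class X R (u @ v))"
    by (intro SUP_cong HOL.refl)
  moreover have "word_class X R u \<noteq> {}" "word_class X R v \<noteq> {}"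
    using assms by (auto simp: word_class_def intro: word_eq.refl)
  ultimately show ?thesis by (simp add: presented_group_def)
qed

lemma word_class_in_carrier:
  "u \<in> lists (X \<times> UNIV) \<Longrightarrow> word_class X R u \<in> carrier (presented_group X R)"
  by (simp add: presented_group_def)

lemma presented_group_carrierE:
  assumes "g \<in> carrier (presented_group X R)"
  obtains u where "u \<in> lists (X \<times> UNIV)" "g = word_class X R u"
  using assms by (auto simp: presented_group_def)

lemma presented_group_one: "\<one>\<^bsub>presented_group X R\<^esub> = word_class X R []"
  by (simp add: presented_group_def)

definition inv_word :: "'a word \<Rightarrow> 'a word" where
  "inv_word u = rev (map (\<lambda>(a, b). (a, \<not> b)) u)"

lemma inv_word_in_lists: "u \<in> lists (X \<times> UNIV) \<Longrightarrow> inv_word u \<in> lists (X \<times> UNIV)"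
  by (auto simp: inv_word_def)

lemma word_eq_inv_word:
  assumes "u \<in> lists (X \<times> UNIV)"
  shows "word_eq X R (inv_word u @ u) []"
  using assms
proof (induction u)
  case (Cons l u)
  obtain a b where l: "l = (a, b)" by (cases l)
  have "word_eq X R (inv_word u @ [(a, \<not> b), (a, \<not> \<not> b)] @ u) (inv_word u @ u)"
    using Cons l by (intro word_eq.cancel inv_word_in_lists) auto
  then have "word_eq X R (inv_word (l # u) @ (l # u)) (inv_word u @ u)"
    by (simp add: inv_word_def l)
  with Cons show ?case by (auto intro: word_eq.trans)
qed (auto simp: inv_word_def intro: word_eq.refl)

lemma group_presented_group: "group (presented_group X R)"
proof (rule groupI)
  fix x y z
  assume "x \<in> carrier (presented_group X R)" "y \<in> carrier (presented_group X R)"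
    "z \<in> carrier (presented_group X R)"
  then obtain u v w where "u \<in> lists (X \<times> UNIV)" "v \<in> lists (X \<times> UNIV)" "w \<in> lists (X \<times> UNIV)"
    "x = word_class X R u" "y = word_class X R v" "z = word_class X R w"
    by (metis presented_group_carrierE)
  then show "x \<otimes>\<^bsub>presented_group X R\<^esub> y \<otimes>\<^bsub>presented_group X R\<^esub> z
      = x \<otimes>\<^bsub>presented_group X R\<^esub> (y \<otimes>\<^bsub>presented_group X R\<^esub> z)"
    by (simp add: presented_group_mult)
next
  fix x y assume "x \<in> carrier (presented_group X R)" "y \<in> carrier (presented_group X R)"
  then show "x \<otimes>\<^bsub>presented_group X R\<^esub> y \<in> carrier (presented_group X R)"
    by (elim presented_group_carrierE) (simp add: presented_group_mult word_class_in_carrier)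
next
  show "\<one>\<^bsub>presented_group X R\<^esub> \<in> carrier (presented_group X R)"
    by (simp add: presented_group_one word_class_in_carrier)
next
  fix x assume "x \<in> carrier (presented_group X R)"
  then obtain u where u: "u \<in> lists (X \<times> UNIV)" "x = word_class X R u"
    by (rule presented_group_carrierE)
  then show "\<one>\<^bsub>presented_group X R\<^esub> \<otimes>\<^bsub>presented_group X R\<^esub> x = x"
    by (simp add: presented_group_one presented_group_mult)
  show "\<exists>y\<in>carrier (presented_group X R). y \<otimes>\<^bsub>presented_group X R\<^esub> x = \<one>\<^bsub>presented_group X R\<^esub>"
  proof (rule bexI)
    show "word_class X R (inv_word u) \<in> carrier (presented_group X R)"
      by (rule word_class_in_carrier[OF inv_word_in_lists[OF u(1)]])
    show "word_class X R (inv_word u) \<otimes>\<^bsub>presented_group X R\<^esub> x = \<one>\<^bsub>presented_group X R\<^esub>"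
      using u inv_word_in_lists[OF u(1)] word_eq_inv_word[OF u(1)]
      by (simp add: presented_group_one presented_group_mult word_class_eq_iff)
  qed
qed

interpretation Gt: group G_tilde
  unfolding G_tilde_def by (rule group_presented_group)

lemma gen_closed: "i < 7 \<Longrightarrow> gen i \<in> carrier G_tilde"
  by (simp add: G_tilde_def gen_def word_class_in_carrier)

lemma gen_relation:
  assumes "i < 7"
  shows "gen i \<otimes>\<^bsub>G_tilde\<^esub> gen ((i + 1) mod 7) \<otimes>\<^bsub>G_tilde\<^esub> gen ((i + 3) mod 7) = \<one>\<^bsub>G_tilde\<^esub>"
proof -
  let ?r = "[(i, True), ((i + 1) mod 7, True), ((i + 3) mod 7, True)]"
  have "word_eq {..<7} relators ([] @ ?r @ []) ([] @ [])"
    using assms by (intro word_eq.relator) (auto simp: relators_def)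
  then show ?thesis
    using assms by (simp add: G_tilde_def gen_def presented_group_mult presented_group_one word_class_eq_iff)
qed

definition G_sub :: "nat word set set" where
  "G_sub = generate G_tilde {gen 0, gen 1}"

lemma subgroup_G_sub: "subgroup G_sub G_tilde"
  unfolding G_sub_def by (intro Gt.generate_is_subgroup) (simp add: gen_closed)

interpretation G_sub: subgroup G_sub G_tilde
  by (rule subgroup_G_sub)

text \<open>\<open>par i\<close> tells whether \<open>x\<^sub>i\<close> lies outside of \<open>G\<close>, and \<open>{1, x\<^sub>2}\<close> represents the two cosets
  of \<open>G\<close>, so that \<open>step i e\<close> is the Schreier generator which \<open>x\<^sub>i\<close> gives at the coset \<open>e\<close>.\<close>

definition par :: "nat \<Rightarrow> bool" where
  "par i \<longleftrightarrow> i \<in> {2, 4, 5, 6}"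

definition coset_rep :: "bool \<Rightarrow> nat word set" where
  "coset_rep e = (if e then gen 2 else \<one>\<^bsub>G_tilde\<^esub>)"

definition step :: "nat \<Rightarrow> bool \<Rightarrow> nat word set" where
  "step i e = coset_rep e \<otimes>\<^bsub>G_tilde\<^esub> gen i \<otimes>\<^bsub>G_tilde\<^esub> inv\<^bsub>G_tilde\<^esub> coset_rep (e \<noteq> par i)"

lemma coset_rep_closed: "coset_rep e \<in> carrier G_tilde"
  by (simp add: coset_rep_def gen_closed)

lemma (in group) cancel_left:
  assumes "x \<in> carrier G" "y \<in> carrier G"
  shows "x \<otimes> (inv x \<otimes> y) = y" "inv x \<otimes> (x \<otimes> y) = y"
  using assms by (simp_all flip: m_assoc)

lemma (in group) conj_cancel:
  assumes "r \<in> carrier G" "s \<in> carrier G" "q \<in> carrier G" "x \<in> carrier G" "y \<in> carrier G"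
  shows "(r \<otimes> x \<otimes> inv s) \<otimes> (s \<otimes> y \<otimes> inv q) = r \<otimes> (x \<otimes> y) \<otimes> inv q"
  using assms by (simp add: m_assoc cancel_left)

text \<open>The coset representatives telescope, so the three Schreier generators multiply to a
  conjugate of a relator.\<close>

lemma step_relation:
  assumes "i < 7" and e': "e' = (e \<noteq> par i)" and e'': "e'' = (e' \<noteq> par ((i + 1) mod 7))"
  shows "step i e \<otimes>\<^bsub>G_tilde\<^esub> step ((i + 1) mod 7) e' \<otimes>\<^bsub>G_tilde\<^esub> step ((i + 3) mod 7) e'' = \<one>\<^bsub>G_tilde\<^esub>"
    and "(e'' \<noteq> par ((i + 3) mod 7)) = e"
proof -
  \<comment> \<open>The odd letters 2, 4, 5, 6 form the complement of the Fano line {0, 1, 3}, which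
    meets every line {i, i+1, i+3} in none or two points. Hence the coset returns to
    \<open>e\<close>.\<close>
  have "i \<in> {0, 1, 2, 3, 4, 5, 6}" using assms(1) by auto
  then show e: "(e'' \<noteq> par ((i + 3) mod 7)) = e"
    unfolding e' e'' by (elim insertE emptyE) (simp_all add: par_def)
  let ?r = "coset_rep e"
  have "step i e \<otimes>\<^bsub>G_tilde\<^esub> step ((i + 1) mod 7) e' \<otimes>\<^bsub>G_tilde\<^esub> step ((i + 3) mod 7) e''
    = ?r \<otimes>\<^bsub>G_tilde\<^esub> (gen i \<otimes>\<^bsub>G_tilde\<^esub> gen ((i + 1) mod 7) \<otimes>\<^bsub>G_tilde\<^esub> gen ((i + 3) mod 7)) \<otimes>\<^bsub>G_tilde\<^esub> inv\<^bsub>G_tilde\<^esub> ?r"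
    unfolding step_def e e'[symmetric] e''[symmetric]
    using assms(1) by (simp add: Gt.conj_cancel coset_rep_closed gen_closed)
  also have "\<dots> = \<one>\<^bsub>G_tilde\<^esub>"
    using assms(1) by (simp only: gen_relation) (simp add: coset_rep_closed)
  finally show "step i e \<otimes>\<^bsub>G_tilde\<^esub> step ((i + 1) mod 7) e' \<otimes>\<^bsub>G_tilde\<^esub> step ((i + 3) mod 7) e'' = \<one>\<^bsub>G_tilde\<^esub>" .
qed

lemma (in group) subgroup_conj_preimage:
  assumes "subgroup H G" and "t \<in> carrier G"
  shows "subgroup {a \<in> H. t \<otimes> a \<otimes> inv t \<in> H} G"
proof -
  interpret H: subgroup H G by fact
  show ?thesis
  proof (rule subgroupI)
    show "{a \<in> H. t \<otimes> a \<otimes> inv t \<in> H} \<noteq> {}"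
      using assms by (auto intro!: exI[of _ \<one>] simp: H.one_closed)
  next
    fix a assume "a \<in> {a \<in> H. t \<otimes> a \<otimes> inv t \<in> H}"
    then have a: "a \<in> H" "t \<otimes> a \<otimes> inv t \<in> H" by auto
    have "inv (t \<otimes> a \<otimes> inv t) = t \<otimes> inv a \<otimes> inv t"
      using a assms(2) by (simp add: inv_mult_group m_assoc)
    with a show "inv a \<in> {a \<in> H. t \<otimes> a \<otimes> inv t \<in> H}"
      using H.m_inv_closed by fastforce
  next
    fix a b assume "a \<in> {a \<in> H. t \<otimes> a \<otimes> inv t \<in> H}" "b \<in> {a \<in> H. t \<otimes> a \<otimes> inv t \<in> H}"
    then have *: "a \<in> H" "t \<otimes> a \<otimes> inv t \<in> H" "b \<in> H" "t \<otimes> b \<otimes> inv t \<in> H" by auto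
    then have "t \<otimes> (a \<otimes> b) \<otimes> inv t = (t \<otimes> a \<otimes> inv t) \<otimes> (t \<otimes> b \<otimes> inv t)"
      using assms(2) by (simp add: conj_cancel)
    with * show "a \<otimes> b \<in> {a \<in> H. t \<otimes> a \<otimes> inv t \<in> H}"
      using H.m_closed by auto
  qed auto
qed

lemma gen_0_1_3_in_G_sub: "gen 0 \<in> G_sub" "gen 1 \<in> G_sub" "gen 3 \<in> G_sub"
proof -
  show 0: "gen 0 \<in> G_sub" and 1: "gen 1 \<in> G_sub"
    by (simp_all add: G_sub_def generate.incl)
  have "inv\<^bsub>G_tilde\<^esub> gen 3 = gen 0 \<otimes>\<^bsub>G_tilde\<^esub> gen 1"
    using gen_relation[of 0] by (intro Gt.inv_equality) (simp_all add: gen_closed)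
  then have "inv\<^bsub>G_tilde\<^esub> gen 3 \<in> G_sub"
    using 0 1 by simp
  then show "gen 3 \<in> G_sub"
    using G_sub.m_inv_closed by (metis Gt.inv_inv gen_closed numeral_less_iff semiring_norm(77,80))
qed

text \<open>Eliminating \<open>x\<^sub>4, x\<^sub>5, x\<^sub>6\<close> from the relators leaves three relations for \<open>t = x\<^sub>2\<close>, which
  express \<open>t t\<close>, \<open>t x\<^sub>1 t\<close> and \<open>t x\<^sub>3 x\<^sub>1 t\<close> by the elements \<open>x\<^sub>0, x\<^sub>1, x\<^sub>3\<close> of \<open>G\<close>.\<close>

lemma (in group) index_two_relations:
  assumes "x0 \<in> carrier G" "x1 \<in> carrier G" "t \<in> carrier G" "x3 \<in> carrier G"
    "x4 \<in> carrier G" "x5 \<in> carrier G" "x6 \<in> carrier G"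
    and 1: "x1 \<otimes> t \<otimes> x4 = \<one>" and 2: "t \<otimes> x3 \<otimes> x5 = \<one>" and 3: "x3 \<otimes> x4 \<otimes> x6 = \<one>"
    and 4: "x4 \<otimes> x5 \<otimes> x0 = \<one>" and 5: "x5 \<otimes> x6 \<otimes> x1 = \<one>" and 6: "x6 \<otimes> x0 \<otimes> t = \<one>"
  shows "x4 = inv t \<otimes> inv x1" "x5 = inv x3 \<otimes> inv t" "x6 = inv t \<otimes> inv x0"
    "t \<otimes> t = inv x0 \<otimes> x1 \<otimes> inv x3" "t \<otimes> x1 \<otimes> t = inv x0 \<otimes> x3" "t \<otimes> (x3 \<otimes> x1) \<otimes> t = x0"
proof -
  have "(inv t \<otimes> inv x1) \<otimes> (x1 \<otimes> t \<otimes> x4) \<otimes> \<one> = (inv t \<otimes> inv x1) \<otimes> \<one> \<otimes> \<one>"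
    by (simp only: 1)
  then show x4: "x4 = inv t \<otimes> inv x1"
    using assms(1-7) by (simp add: m_assoc cancel_left inv_mult_group)
  have "(inv x3 \<otimes> inv t) \<otimes> (t \<otimes> x3 \<otimes> x5) \<otimes> \<one> = (inv x3 \<otimes> inv t) \<otimes> \<one> \<otimes> \<one>"
    by (simp only: 2)
  then show x5: "x5 = inv x3 \<otimes> inv t"
    using assms(1-7) by (simp add: m_assoc cancel_left inv_mult_group)
  have "\<one> \<otimes> (x6 \<otimes> x0 \<otimes> t) \<otimes> (inv t \<otimes> inv x0) = \<one> \<otimes> \<one> \<otimes> (inv t \<otimes> inv x0)"
    by (simp only: 6)
  then show x6: "x6 = inv t \<otimes> inv x0"
    using assms(1-7) by (simp add: m_assoc cancel_left inv_mult_group)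
  have "(t \<otimes> t \<otimes> x3) \<otimes> (x5 \<otimes> x6 \<otimes> x1) \<otimes> inv x3 = (t \<otimes> t \<otimes> x3) \<otimes> \<one> \<otimes> inv x3"
    by (simp only: 5)
  then show "t \<otimes> t = inv x0 \<otimes> x1 \<otimes> inv x3"
    using assms(1-7) by (simp add: x5 x6 m_assoc cancel_left inv_mult_group)
  have "inv x0 \<otimes> (x3 \<otimes> x4 \<otimes> x6) \<otimes> (x0 \<otimes> t \<otimes> x1 \<otimes> t) = inv x0 \<otimes> \<one> \<otimes> (x0 \<otimes> t \<otimes> x1 \<otimes> t)"
    by (simp only: 3)
  then show "t \<otimes> x1 \<otimes> t = inv x0 \<otimes> x3"
    using assms(1-7) by (simp add: x4 x6 m_assoc cancel_left inv_mult_group)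
  have "(t \<otimes> x3 \<otimes> x1 \<otimes> t) \<otimes> (x4 \<otimes> x5 \<otimes> x0) \<otimes> \<one> = (t \<otimes> x3 \<otimes> x1 \<otimes> t) \<otimes> \<one> \<otimes> \<one>"
    by (simp only: 4)
  then show "t \<otimes> (x3 \<otimes> x1) \<otimes> t = x0"
    using assms(1-7) by (simp add: x4 x5 m_assoc cancel_left inv_mult_group)
qed

text \<open>The Reidemeister-Schreier step. What has to be shown is that conjugation by t = x_2 maps
  x_0, x_1, x_3 into G and that t t lies in G; the fourteen Schreier generators are then explicit
  products of such elements.\<close>

lemma step_in_G_sub:
  assumes "i < 7"
  shows "step i e \<in> G_sub"
proof -
  note [simp] = gen_closed and [simp del] = One_nat_def
  define t where "t = gen 2"
  have t: "t \<in> carrier G_tilde" by (simp add: t_def)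
  note H = gen_0_1_3_in_G_sub
  have R: "gen 1 \<otimes>\<^bsub>G_tilde\<^esub> t \<otimes>\<^bsub>G_tilde\<^esub> gen 4 = \<one>\<^bsub>G_tilde\<^esub>"
    "t \<otimes>\<^bsub>G_tilde\<^esub> gen 3 \<otimes>\<^bsub>G_tilde\<^esub> gen 5 = \<one>\<^bsub>G_tilde\<^esub>"
    "gen 3 \<otimes>\<^bsub>G_tilde\<^esub> gen 4 \<otimes>\<^bsub>G_tilde\<^esub> gen 6 = \<one>\<^bsub>G_tilde\<^esub>"
    "gen 4 \<otimes>\<^bsub>G_tilde\<^esub> gen 5 \<otimes>\<^bsub>G_tilde\<^esub> gen 0 = \<one>\<^bsub>G_tilde\<^esub>"
    "gen 5 \<otimes>\<^bsub>G_tilde\<^esub> gen 6 \<otimes>\<^bsub>G_tilde\<^esub> gen 1 = \<one>\<^bsub>G_tilde\<^esub>"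
    "gen 6 \<otimes>\<^bsub>G_tilde\<^esub> gen 0 \<otimes>\<^bsub>G_tilde\<^esub> t = \<one>\<^bsub>G_tilde\<^esub>"
    using gen_relation[of 1] gen_relation[of 2] gen_relation[of 3] gen_relation[of 4]
      gen_relation[of 5] gen_relation[of 6] by (simp_all add: t_def One_nat_def numeral_2_eq_2)
  have c: "gen 0 \<in> carrier G_tilde" "gen 1 \<in> carrier G_tilde" "gen 3 \<in> carrier G_tilde"
    "gen 4 \<in> carrier G_tilde" "gen 5 \<in> carrier G_tilde" "gen 6 \<in> carrier G_tilde"
    by simp_all
  note rels = Gt.index_two_relations[OF c(1,2) t c(3-6) R]
  have tt: "t \<otimes>\<^bsub>G_tilde\<^esub> t \<in> G_sub" "inv\<^bsub>G_tilde\<^esub> (t \<otimes>\<^bsub>G_tilde\<^esub> t) \<in> G_sub"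
    using H by (simp_all add: rels(4))
  \<comment> \<open>The elements that t conjugates into G form a subgroup. As t a t^-1 = (t a t) (t
    t)^-1, the relations place x_1 and x_3 x_1 in it, hence x_3, and finally x_0 as the inverse of
    x_1 x_3.\<close>
  define K where "K = {a \<in> G_sub. t \<otimes>\<^bsub>G_tilde\<^esub> a \<otimes>\<^bsub>G_tilde\<^esub> inv\<^bsub>G_tilde\<^esub> t \<in> G_sub}"
  interpret K: subgroup K G_tilde
    unfolding K_def using subgroup_G_sub t by (rule Gt.subgroup_conj_preimage)
  have conj: "t \<otimes>\<^bsub>G_tilde\<^esub> a \<otimes>\<^bsub>G_tilde\<^esub> inv\<^bsub>G_tilde\<^esub> t
      = (t \<otimes>\<^bsub>G_tilde\<^esub> a \<otimes>\<^bsub>G_tilde\<^esub> t) \<otimes>\<^bsub>G_tilde\<^esub> inv\<^bsub>G_tilde\<^esub> (t \<otimes>\<^bsub>G_tilde\<^esub> t)"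
    if "a \<in> carrier G_tilde" for a
    using that t by (simp add: Gt.inv_mult_group Gt.m_assoc Gt.cancel_left)
  have KI: "a \<in> K" if "a \<in> G_sub" "t \<otimes>\<^bsub>G_tilde\<^esub> a \<otimes>\<^bsub>G_tilde\<^esub> t \<in> G_sub" for a
    using that tt conj[of a] by (simp add: K_def)
  have 1: "gen 1 \<in> K"
    using H by (intro KI) (simp_all add: rels(5))
  have "gen 3 \<otimes>\<^bsub>G_tilde\<^esub> gen 1 \<in> K"
    using H by (intro KI) (simp_all add: rels(6))
  then have "(gen 3 \<otimes>\<^bsub>G_tilde\<^esub> gen 1) \<otimes>\<^bsub>G_tilde\<^esub> inv\<^bsub>G_tilde\<^esub> gen 1 \<in> K"
    using 1 by simp
  then have 3: "gen 3 \<in> K"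
    by (simp add: Gt.m_assoc)
  have "gen 0 = inv\<^bsub>G_tilde\<^esub> (gen 1 \<otimes>\<^bsub>G_tilde\<^esub> gen 3)"
    using gen_relation[of 0] by (intro Gt.inv_equality[symmetric]) (simp_all add: Gt.m_assoc)
  then have 0: "gen 0 \<in> K"
    using 1 3 by simp
  have "(t \<otimes>\<^bsub>G_tilde\<^esub> gen 0 \<otimes>\<^bsub>G_tilde\<^esub> inv\<^bsub>G_tilde\<^esub> t) \<otimes>\<^bsub>G_tilde\<^esub> (t \<otimes>\<^bsub>G_tilde\<^esub> t) \<in> G_sub"
    using 0 tt by (simp add: K_def)
  moreover have "(t \<otimes>\<^bsub>G_tilde\<^esub> gen 0 \<otimes>\<^bsub>G_tilde\<^esub> inv\<^bsub>G_tilde\<^esub> t) \<otimes>\<^bsub>G_tilde\<^esub> (t \<otimes>\<^bsub>G_tilde\<^esub> t)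
      = t \<otimes>\<^bsub>G_tilde\<^esub> gen 0 \<otimes>\<^bsub>G_tilde\<^esub> t"
    using t by (simp add: Gt.m_assoc Gt.cancel_left)
  ultimately have "t \<otimes>\<^bsub>G_tilde\<^esub> gen 0 \<otimes>\<^bsub>G_tilde\<^esub> t \<in> G_sub" by simp
  then have t0t: "inv\<^bsub>G_tilde\<^esub> (t \<otimes>\<^bsub>G_tilde\<^esub> gen 0 \<otimes>\<^bsub>G_tilde\<^esub> t) \<in> G_sub" by simp
  have "t \<otimes>\<^bsub>G_tilde\<^esub> gen 1 \<otimes>\<^bsub>G_tilde\<^esub> t \<in> G_sub"
    using H by (simp add: rels(5))
  then have t1t: "inv\<^bsub>G_tilde\<^esub> (t \<otimes>\<^bsub>G_tilde\<^esub> gen 1 \<otimes>\<^bsub>G_tilde\<^esub> t) \<in> G_sub" by simp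
  have t3: "t \<otimes>\<^bsub>G_tilde\<^esub> inv\<^bsub>G_tilde\<^esub> gen 3 \<otimes>\<^bsub>G_tilde\<^esub> inv\<^bsub>G_tilde\<^esub> t \<in> G_sub"
    using K.m_inv_closed[OF 3] by (simp add: K_def)
  have eqs: "step 0 False = gen 0"
    "step 1 False = gen 1"
    "step 2 False = \<one>\<^bsub>G_tilde\<^esub>"
    "step 3 False = gen 3"
    "step 4 False = inv\<^bsub>G_tilde\<^esub> (t \<otimes>\<^bsub>G_tilde\<^esub> gen 1 \<otimes>\<^bsub>G_tilde\<^esub> t)"
    "step 5 False = inv\<^bsub>G_tilde\<^esub> gen 3 \<otimes>\<^bsub>G_tilde\<^esub> inv\<^bsub>G_tilde\<^esub> (t \<otimes>\<^bsub>G_tilde\<^esub> t)"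
    "step 6 False = inv\<^bsub>G_tilde\<^esub> (t \<otimes>\<^bsub>G_tilde\<^esub> gen 0 \<otimes>\<^bsub>G_tilde\<^esub> t)"
    "step 0 True = t \<otimes>\<^bsub>G_tilde\<^esub> gen 0 \<otimes>\<^bsub>G_tilde\<^esub> inv\<^bsub>G_tilde\<^esub> t"
    "step 1 True = t \<otimes>\<^bsub>G_tilde\<^esub> gen 1 \<otimes>\<^bsub>G_tilde\<^esub> inv\<^bsub>G_tilde\<^esub> t"
    "step 2 True = t \<otimes>\<^bsub>G_tilde\<^esub> t"
    "step 3 True = t \<otimes>\<^bsub>G_tilde\<^esub> gen 3 \<otimes>\<^bsub>G_tilde\<^esub> inv\<^bsub>G_tilde\<^esub> t"
    "step 4 True = inv\<^bsub>G_tilde\<^esub> gen 1"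
    "step 5 True = t \<otimes>\<^bsub>G_tilde\<^esub> inv\<^bsub>G_tilde\<^esub> gen 3 \<otimes>\<^bsub>G_tilde\<^esub> inv\<^bsub>G_tilde\<^esub> t"
    "step 6 True = inv\<^bsub>G_tilde\<^esub> gen 0"
    using c t
    by (simp_all add: step_def coset_rep_def par_def t_def[symmetric] rels(1-3) Gt.cancel_left
        Gt.inv_mult_group Gt.m_assoc)
  have K_conj: "t \<otimes>\<^bsub>G_tilde\<^esub> a \<otimes>\<^bsub>G_tilde\<^esub> inv\<^bsub>G_tilde\<^esub> t \<in> G_sub" if "a \<in> K" for a
    using that by (simp add: K_def)
  have "step 0 e \<in> G_sub \<and> step 1 e \<in> G_sub \<and> step 2 e \<in> G_sub \<and> step 3 e \<in> G_sub
      \<and> step 4 e \<in> G_sub \<and> step 5 e \<in> G_sub \<and> step 6 e \<in> G_sub"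
    using H tt t0t t1t t3 K_conj[OF 0] K_conj[OF 1] K_conj[OF 3]
      G_sub.m_closed[OF G_sub.m_inv_closed[OF H(3)] tt(2)]
      G_sub.m_inv_closed[OF H(1)] G_sub.m_inv_closed[OF H(2)] G_sub.one_closed
    by (cases e) (simp_all only: eqs simp_thms)
  moreover have "i \<in> {0, 1, 2, 3, 4, 5, 6}" using assms by auto
  ultimately show ?thesis by blast
qed

section \<open>Block Toeplitz matrices\<close>

lemma block_toeplitz_mult: "(A \<otimes>\<^bsub>block_toeplitz\<^esub> B) i j = (\<Sum>l = i..j. A i l ** B l j)"
  by (simp add: block_toeplitz_def)

lemma block_toeplitz_one: "\<one>\<^bsub>block_toeplitz\<^esub> i j = (if i = j then mat 1 else 0)"
  by (simp add: block_toeplitz_def)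

lemma matrix_add_rdistrib:
  fixes B C :: "'a :: semiring_1 ^ 'n ^ 'm"
  shows "(B + C) ** A = B ** A + C ** A"
  by (simp only: matrix_matrix_mult_def vec_eq_iff vec_lambda_beta vector_add_component
      distrib_right sum.distrib simp_thms)

lemma matrix_mul_sum_left: "sum f I ** (B :: block) = (\<Sum>i\<in>I. f i ** B)"
  by (induction I rule: infinite_finite_induct) (simp_all add: matrix_add_rdistrib)

lemma matrix_mul_sum_right: "(B :: block) ** sum f I = (\<Sum>i\<in>I. B ** f i)"
  by (induction I rule: infinite_finite_induct) (simp_all add: matrix_add_ldistrib)

lemma block_toeplitz_carrierD:
  assumes "A \<in> carrier block_toeplitz"
  shows "j < i \<Longrightarrow> A i j = 0" and "A i i = mat 1" and "A (i + 3) (j + 3) = A i j"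
    and "\<exists>N. \<forall>i j. i + N < j \<longrightarrow> A i j = 0"
  using assms by (auto simp: block_toeplitz_def)

lemma block_toeplitz_carrierI:
  assumes "\<And>i j. j < i \<Longrightarrow> A i j = 0" and "\<And>i. A i i = mat 1"
    and "\<And>i j. A (i + 3) (j + 3) = A i j" and "\<And>i j. i + N < j \<Longrightarrow> A i j = 0"
  shows "A \<in> carrier block_toeplitz"
  using assms by (auto simp: block_toeplitz_def)

text \<open>Both bracketings sum over the chains \<open>i \<le> k \<le> l \<le> j\<close>.\<close>

lemma block_toeplitz_assoc:
  "(A \<otimes>\<^bsub>block_toeplitz\<^esub> B) \<otimes>\<^bsub>block_toeplitz\<^esub> C = A \<otimes>\<^bsub>block_toeplitz\<^esub> (B \<otimes>\<^bsub>block_toeplitz\<^esub> C)"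
proof (intro ext)
  fix i j :: nat
  have "((A \<otimes>\<^bsub>block_toeplitz\<^esub> B) \<otimes>\<^bsub>block_toeplitz\<^esub> C) i j
      = (\<Sum>l\<in>{i..j}. \<Sum>k\<in>{k \<in> {i..j}. k \<le> l}. A i k ** B k l ** C l j)"
    unfolding block_toeplitz_mult matrix_mul_sum_left by (intro sum.cong) auto
  also have "\<dots> = (\<Sum>k\<in>{i..j}. \<Sum>l\<in>{l \<in> {i..j}. k \<le> l}. A i k ** B k l ** C l j)"
    by (rule sum.swap_restrict) auto
  also have "\<dots> = (A \<otimes>\<^bsub>block_toeplitz\<^esub> (B \<otimes>\<^bsub>block_toeplitz\<^esub> C)) i j"
    unfolding block_toeplitz_mult matrix_mul_sum_right matrix_mul_assoc
    by (intro sum.cong) auto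
  finally show "((A \<otimes>\<^bsub>block_toeplitz\<^esub> B) \<otimes>\<^bsub>block_toeplitz\<^esub> C) i j
      = (A \<otimes>\<^bsub>block_toeplitz\<^esub> (B \<otimes>\<^bsub>block_toeplitz\<^esub> C)) i j" .
qed

lemma block_toeplitz_mult_closed:
  assumes A: "A \<in> carrier block_toeplitz" and B: "B \<in> carrier block_toeplitz"
  shows "A \<otimes>\<^bsub>block_toeplitz\<^esub> B \<in> carrier block_toeplitz"
proof -
  note A' = block_toeplitz_carrierD[OF A] and B' = block_toeplitz_carrierD[OF B]
  obtain M N where M: "\<And>i j. i + M < j \<Longrightarrow> A i j = 0" and N: "\<And>i j. i + N < j \<Longrightarrow> B i j = 0"
    using A'(4) B'(4) by blast
  show ?thesis
  proof (rule block_toeplitz_carrierI)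
    fix i j :: nat
    show "(A \<otimes>\<^bsub>block_toeplitz\<^esub> B) (i + 3) (j + 3) = (A \<otimes>\<^bsub>block_toeplitz\<^esub> B) i j"
      unfolding block_toeplitz_mult sum.shift_bounds_cl_nat_ivl
      by (simp only: A'(3) B'(3))
    show "(A \<otimes>\<^bsub>block_toeplitz\<^esub> B) i j = 0" if "i + (M + N) < j"
      unfolding block_toeplitz_mult
    proof (intro sum.neutral ballI)
      fix l
      show "A i l ** B l j = 0"
        using M[of i l] N[of l j] that by (cases "i + M < l") auto
    qed
  qed (simp_all add: block_toeplitz_mult A' B')
qed

text \<open>In general this is no group: the inverse of a matrix with finitely many diagonals can
  have infinitely many. Invertibility of the generators will come from the relators.\<close>

lemma monoid_block_toeplitz: "monoid block_toeplitz"
proof (rule monoidI)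
  show "\<one>\<^bsub>block_toeplitz\<^esub> \<in> carrier block_toeplitz"
    by (intro block_toeplitz_carrierI[where N = 0]) (auto simp: block_toeplitz_one)
  fix A assume A: "A \<in> carrier block_toeplitz"
  note A' = block_toeplitz_carrierD[OF A]
  show "\<one>\<^bsub>block_toeplitz\<^esub> \<otimes>\<^bsub>block_toeplitz\<^esub> A = A"
  proof (intro ext)
    fix i j
    have "(\<one>\<^bsub>block_toeplitz\<^esub> \<otimes>\<^bsub>block_toeplitz\<^esub> A) i j = (\<Sum>l\<in>{i..j}. if i = l then A l j else 0)"
      unfolding block_toeplitz_mult block_toeplitz_one by (intro sum.cong) auto
    then show "(\<one>\<^bsub>block_toeplitz\<^esub> \<otimes>\<^bsub>block_toeplitz\<^esub> A) i j = A i j"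
      using A'(1)[of j i] by auto
  qed
  show "A \<otimes>\<^bsub>block_toeplitz\<^esub> \<one>\<^bsub>block_toeplitz\<^esub> = A"
  proof (intro ext)
    fix i j
    have "(A \<otimes>\<^bsub>block_toeplitz\<^esub> \<one>\<^bsub>block_toeplitz\<^esub>) i j = (\<Sum>l\<in>{i..j}. if l = j then A i l else 0)"
      unfolding block_toeplitz_mult block_toeplitz_one by (intro sum.cong) auto
    then show "(A \<otimes>\<^bsub>block_toeplitz\<^esub> \<one>\<^bsub>block_toeplitz\<^esub>) i j = A i j"
      using A'(1)[of j i] by auto
  qed
qed (simp_all add: block_toeplitz_mult_closed block_toeplitz_assoc)

interpretation BT: monoid block_toeplitz
  by (rule monoid_block_toeplitz)

section \<open>Blocks over F_2 as nine Booleans\<close>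

definition bits :: "bool \<Rightarrow> bool \<Rightarrow> bool \<Rightarrow> bool \<Rightarrow> bool \<Rightarrow> bool \<Rightarrow> bool \<Rightarrow> bool \<Rightarrow> bool \<Rightarrow> block" where
  "bits a b c d e f g h i = vector [vector [of_bool a, of_bool b, of_bool c],
     vector [of_bool d, of_bool e, of_bool f], vector [of_bool g, of_bool h, of_bool i]]"

lemma of_bool_add_bit: "of_bool p + of_bool q = (of_bool (p \<noteq> q) :: bit)"
  by auto

lemma bits_add:
  "bits a b c d e f g h i + bits a' b' c' d' e' f' g' h' i'
    = bits (a \<noteq> a') (b \<noteq> b') (c \<noteq> c') (d \<noteq> d') (e \<noteq> e') (f \<noteq> f') (g \<noteq> g') (h \<noteq> h') (i \<noteq> i')"
  by (simp only: bits_def vec_eq_iff forall_3 vector_3 vector_add_component of_bool_add_bit simp_thms)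

text \<open>Addition in F_2 is inequality of Booleans and multiplication is conjunction, so products
  of concrete blocks are evaluated by propositional rewriting.\<close>

lemma bits_mult:
  "bits a b c d e f g h i ** bits a' b' c' d' e' f' g' h' i'
    = bits (((a \<and> a') \<noteq> (b \<and> d')) \<noteq> (c \<and> g')) (((a \<and> b') \<noteq> (b \<and> e')) \<noteq> (c \<and> h')) (((a \<and> c') \<noteq> (b \<and> f')) \<noteq> (c \<and> i'))
        (((d \<and> a') \<noteq> (e \<and> d')) \<noteq> (f \<and> g')) (((d \<and> b') \<noteq> (e \<and> e')) \<noteq> (f \<and> h')) (((d \<and> c') \<noteq> (e \<and> f')) \<noteq> (f \<and> i'))
        (((g \<and> a') \<noteq> (h \<and> d')) \<noteq> (i \<and> g')) (((g \<and> b') \<noteq> (h \<and> e')) \<noteq> (i \<and> h')) (((g \<and> c') \<noteq> (h \<and> f')) \<noteq> (i \<and> i'))"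
  by (simp only: bits_def vec_eq_iff forall_3 vector_3 matrix_matrix_mult_def vec_lambda_beta sum_3
      of_bool_conj[symmetric] of_bool_add_bit simp_thms)

lemma bits_0: "0 = bits False False False False False False False False False"
  by (simp add: bits_def vec_eq_iff forall_3)

lemma bits_1: "mat 1 = bits True False False False True False False False True"
  by (simp add: bits_def vec_eq_iff forall_3 mat_def)

lemma xi_bits: "xi_mat = bits False True False False False True True True False"
  by (simp add: bits_def xi_mat_def)

lemma frob_bits: "frob_mat = bits True False False False False True False True True"
  by (simp add: bits_def frob_mat_def)

lemma xi_pow_Suc: "xi_pow (Suc n) = xi_mat ** xi_pow n" and xi_pow_0: "xi_pow 0 = mat 1"
  by (simp_all add: xi_pow_def)

lemma xi_pow_7: "xi_pow 7 = mat 1"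
  by (simp add: eval_nat_numeral xi_pow_Suc xi_pow_0) (simp add: xi_bits bits_1 bits_mult)

lemma xi_pow_mod: "xi_pow n = xi_pow (n mod 7)"
proof -
  have "xi_pow (m + n) = xi_pow m ** xi_pow n" for m n
    by (induction m) (simp_all add: xi_pow_Suc xi_pow_0 matrix_mul_assoc)
  moreover have "xi_pow (7 * q) = mat 1" for q
    by (induction q) (simp_all add: xi_pow_0 calculation xi_pow_7)
  ultimately show ?thesis
    by (metis mult_div_mod_eq matrix_mul_lid)
qed

lemma xi_pow_bits:
  "xi_pow 0 = bits True False False False True False False False True"
  "xi_pow (Suc 0) = bits False True False False False True True True False"
  "xi_pow 2 = bits False False True True True False False True True"
  "xi_pow 3 = bits True True False False True True True True True"
  "xi_pow 4 = bits False True True True True True True False True"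
  "xi_pow 5 = bits True True True True False True True False False"
  "xi_pow 6 = bits True False True True False False False True False"
  by (simp_all add: eval_nat_numeral xi_pow_Suc xi_pow_0) (simp_all add: xi_bits bits_1 bits_mult)


lemma xi_pow_reduce: "7 \<le> n \<Longrightarrow> xi_pow n = xi_pow (n mod 7)"
  by (rule xi_pow_mod)

section \<open>Rows of periodic banded matrices as lists of blocks\<close>

definition nth0 :: "block list \<Rightarrow> nat \<Rightarrow> block" where
  "nth0 xs k = (if k < length xs then xs ! k else 0)"

fun add_list :: "block list \<Rightarrow> block list \<Rightarrow> block list" where
  "add_list [] ys = ys"
| "add_list (x # xs) [] = x # xs"
| "add_list (x # xs) (y # ys) = (x + y) # add_list xs ys"

text \<open>One row of a product, where \<open>A\<close>, \<open>B\<close>, \<open>C\<close> are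
  three consecutive rows of a 3-periodic right factor. The next block of the left row meets the next
  row on the right, hence the rotation, and lies one diagonal further, hence the leading 0.\<close>

fun conv :: "block list \<Rightarrow> block list \<Rightarrow> block list \<Rightarrow> block list \<Rightarrow> block list" where
  "conv [] A B C = []"
| "conv (x # xs) A B C = add_list (map (\<lambda>a. x ** a) A) (0 # conv xs B C A)"

lemma nth0_simps: "nth0 [] k = 0" "nth0 (x # xs) 0 = x" "nth0 (x # xs) (Suc k) = nth0 xs k"
  by (simp_all add: nth0_def)

lemma nth0_add_list: "nth0 (add_list xs ys) k = nth0 xs k + nth0 ys k"
proof (induction xs ys arbitrary: k rule: add_list.induct)
  case (3 x xs y ys)
  then show ?case by (cases k) (simp_all add: nth0_simps)
qed (simp_all add: nth0_simps)

lemma nth0_map: "nth0 (map (\<lambda>a. x ** a) A) k = x ** nth0 A k"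
  by (simp add: nth0_def)

lemma nth0_conv:
  assumes "\<And>r. R (r + 3) = R r"
  shows "nth0 (conv xs (R r) (R (r + 1)) (R (r + 2))) d = (\<Sum>k\<le>d. nth0 xs k ** nth0 (R (r + k)) (d - k))"
proof (induction xs arbitrary: r d)
  case (Cons x xs)
  have IH: "nth0 (conv xs (R (r + 1)) (R (r + 2)) (R r)) d = (\<Sum>k\<le>d. nth0 xs k ** nth0 (R (r + 1 + k)) (d - k))" for d
    using Cons[of "r + 1" d] assms[of r] by (simp add: numeral_3_eq_3 numeral_2_eq_2)
  show ?case
  proof (cases d)
    case (Suc d')
    show ?thesis
      unfolding Suc sum.atMost_Suc_shift
      using IH[of d'] by (simp add: nth0_add_list nth0_map nth0_simps)
  qed (simp add: nth0_add_list nth0_map nth0_simps)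
qed (simp add: nth0_simps)

definition toep :: "(nat \<Rightarrow> block list) \<Rightarrow> block_matrix" where
  "toep R i j = (if i \<le> j then nth0 (R i) (j - i) else 0)"

lemma toep_mult:
  assumes "\<And>r. S (r + 3) = S r"
  shows "toep R \<otimes>\<^bsub>block_toeplitz\<^esub> toep S = toep (\<lambda>r. conv (R r) (S r) (S (r + 1)) (S (r + 2)))"
proof (intro ext)
  fix i j
  show "(toep R \<otimes>\<^bsub>block_toeplitz\<^esub> toep S) i j = toep (\<lambda>r. conv (R r) (S r) (S (r + 1)) (S (r + 2))) i j"
  proof (cases "i \<le> j")
    case True
    have "(toep R \<otimes>\<^bsub>block_toeplitz\<^esub> toep S) i j = (\<Sum>l\<in>{0 + i..(j - i) + i}. toep R i l ** toep S l j)"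
      using True by (simp add: block_toeplitz_mult)
    also have "\<dots> = (\<Sum>k\<in>{0..j - i}. toep R i (k + i) ** toep S (k + i) j)"
      by (rule sum.shift_bounds_cl_nat_ivl)
    also have "\<dots> = (\<Sum>k\<le>j - i. nth0 (R i) k ** nth0 (S (i + k)) (j - i - k))"
      unfolding atMost_atLeast0 using True
      by (intro sum.cong) (auto simp: toep_def add.commute diff_diff_add)
    finally show ?thesis
      using True nth0_conv[of S, OF assms] by (simp add: toep_def)
  qed (simp add: toep_def block_toeplitz_mult)
qed

definition gen_row :: "nat \<Rightarrow> nat \<Rightarrow> block list" where
  "gen_row i r = gen_blocks i ! (r mod 3)"

lemma gen_matrix_toep: "gen_matrix i = toep (gen_row i)"
proof (intro ext)
  fix r c :: nat
  have "r mod 3 \<in> {0, 1, 2}" by auto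
  then have "length (gen_row i r) = 6"
    by (auto simp: gen_row_def gen_blocks_def Let_def)
  then show "gen_matrix i r c = toep (gen_row i) r c"
    by (auto simp: gen_matrix_def toep_def nth0_def gen_row_def)
qed

lemma gen_row_periodic: "gen_row i (r + 3) = gen_row i r"
  by (simp add: gen_row_def)

lemmas block_simps = bits_1 xi_pow_bits xi_pow_bits(3)[unfolded numeral_2_eq_2] xi_pow_reduce
  frob_bits bits_add bits_mult

text \<open>Lists computed by \<open>conv\<close> keep trailing zero blocks, so a row of the unit
  matrix is recognised up to such a tail.\<close>

definition unit_row :: "block list \<Rightarrow> bool" where
  "unit_row xs \<longleftrightarrow> (\<exists>zs. xs = mat 1 # zs \<and> (\<forall>z\<in>set zs. z = 0))"

lemma toep_unit_row:
  assumes "\<And>r. unit_row (R r)"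
  shows "toep R = \<one>\<^bsub>block_toeplitz\<^esub>"
proof (intro ext)
  fix i j
  obtain zs where zs: "R i = mat 1 # zs" "\<And>z. z \<in> set zs \<Longrightarrow> z = 0"
    using assms[of i] by (auto simp: unit_row_def)
  then show "toep R i j = \<one>\<^bsub>block_toeplitz\<^esub> i j"
    by (cases "j - i") (auto simp: toep_def block_toeplitz_one nth0_def)
qed

text \<open>The conceptual reason is that the twisted polynomials satisfy g_i g_{i+1} g_{i+3} = 1 +
  Z, which is central and so acts trivially by conjugation. Here the seven relators are evaluated on
  the three residues of the row index.\<close>

lemma gen_row_relation:
  assumes "i < 7"
  shows "unit_row (conv (conv (gen_row i r)
      (gen_row ((i + 1) mod 7) r) (gen_row ((i + 1) mod 7) (r + 1)) (gen_row ((i + 1) mod 7) (r + 2)))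
      (gen_row ((i + 3) mod 7) r) (gen_row ((i + 3) mod 7) (r + 1)) (gen_row ((i + 3) mod 7) (r + 2)))"
proof -
  have i: "i \<in> {0, 1, 2, 3, 4, 5, 6}" using assms by auto
  have "r mod 3 = 0 \<and> (r + 1) mod 3 = 1 \<and> (r + 2) mod 3 = 2
      \<or> r mod 3 = 1 \<and> (r + 1) mod 3 = 2 \<and> (r + 2) mod 3 = 0
      \<or> r mod 3 = 2 \<and> (r + 1) mod 3 = 0 \<and> (r + 2) mod 3 = 1"
    by presburger
  then show ?thesis
  proof (elim disjE)
    assume r: "r mod 3 = 0 \<and> (r + 1) mod 3 = 1 \<and> (r + 2) mod 3 = 2"
    from i show ?thesis
      unfolding gen_row_def r[THEN conjunct1] r[THEN conjunct2, THEN conjunct1] r[THEN conjunct2, THEN conjunct2]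
      by (elim insertE emptyE) (simp_all add: gen_blocks_def Let_def block_simps bits_0[symmetric] unit_row_def)
  next
    assume r: "r mod 3 = 1 \<and> (r + 1) mod 3 = 2 \<and> (r + 2) mod 3 = 0"
    from i show ?thesis
      unfolding gen_row_def r[THEN conjunct1] r[THEN conjunct2, THEN conjunct1] r[THEN conjunct2, THEN conjunct2]
      by (elim insertE emptyE) (simp_all add: gen_blocks_def Let_def block_simps bits_0[symmetric] unit_row_def)
  next
    assume r: "r mod 3 = 2 \<and> (r + 1) mod 3 = 0 \<and> (r + 2) mod 3 = 1"
    from i show ?thesis
      unfolding gen_row_def r[THEN conjunct1] r[THEN conjunct2, THEN conjunct1] r[THEN conjunct2, THEN conjunct2]
      by (elim insertE emptyE) (simp_all add: gen_blocks_def Let_def block_simps bits_0[symmetric] unit_row_def)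
  qed
qed

lemma gen_matrix_relation:
  assumes "i < 7"
  shows "gen_matrix i \<otimes>\<^bsub>block_toeplitz\<^esub> gen_matrix ((i + 1) mod 7) \<otimes>\<^bsub>block_toeplitz\<^esub> gen_matrix ((i + 3) mod 7)
    = \<one>\<^bsub>block_toeplitz\<^esub>"
  unfolding gen_matrix_toep toep_mult[of "gen_row _", OF gen_row_periodic]
  by (intro toep_unit_row gen_row_relation assms)

lemma gen_matrix_closed: "gen_matrix i \<in> carrier block_toeplitz"
proof (rule block_toeplitz_carrierI[where N = 5])
  fix r c :: nat
  show "gen_matrix i (r + 3) (c + 3) = gen_matrix i r c"
    by (simp add: gen_matrix_def)
  have "r mod 3 \<in> {0, 1, 2}" by auto
  then show "gen_matrix i r r = mat 1"
    by (auto simp: gen_matrix_def gen_blocks_def Let_def)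
qed (simp_all add: gen_matrix_def)

text \<open>The relator starting with x_i gives a right inverse. The relator ending with x_i, which
  starts at i + 4 = i - 3 modulo 7, gives a left inverse.\<close>

lemma gen_matrix_Units:
  assumes "i < 7"
  shows "gen_matrix i \<in> Units block_toeplitz"
proof -
  have "(i + 4) mod 7 < 7" "((i + 4) mod 7 + 3) mod 7 = i"
    using assms by presburger+
  with gen_matrix_relation[of "(i + 4) mod 7"]
  have l: "(gen_matrix ((i + 4) mod 7) \<otimes>\<^bsub>block_toeplitz\<^esub> gen_matrix (((i + 4) mod 7 + 1) mod 7)) \<otimes>\<^bsub>block_toeplitz\<^esub> gen_matrix i = \<one>\<^bsub>block_toeplitz\<^esub>"
    by metis
  have r: "gen_matrix i \<otimes>\<^bsub>block_toeplitz\<^esub> (gen_matrix ((i + 1) mod 7) \<otimes>\<^bsub>block_toeplitz\<^esub> gen_matrix ((i + 3) mod 7)) = \<one>\<^bsub>block_toeplitz\<^esub>"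
    using gen_matrix_relation[OF assms] by (simp add: block_toeplitz_assoc)
  have "gen_matrix ((i + 4) mod 7) \<otimes>\<^bsub>block_toeplitz\<^esub> gen_matrix (((i + 4) mod 7 + 1) mod 7)
      = gen_matrix ((i + 1) mod 7) \<otimes>\<^bsub>block_toeplitz\<^esub> gen_matrix ((i + 3) mod 7)"
    using BT.inv_unique[OF l r] gen_matrix_closed by simp
  with l r show ?thesis
    unfolding Units_def using gen_matrix_closed by auto
qed

text \<open>Replaces the abstract inverse by a product that can be evaluated.\<close>

lemma letter_matrix_False:
  assumes "i < 7"
  shows "letter_matrix (i, False) = gen_matrix ((i + 1) mod 7) \<otimes>\<^bsub>block_toeplitz\<^esub> gen_matrix ((i + 3) mod 7)"
  using BT.inv_unique[of "inv\<^bsub>block_toeplitz\<^esub> gen_matrix i" "gen_matrix i"]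
    gen_matrix_relation[OF assms] gen_matrix_Units[OF assms]
  by (simp add: block_toeplitz_assoc gen_matrix_closed)

section \<open>Congruence of matrices up to a given diagonal\<close>

definition agree :: "nat \<Rightarrow> block_matrix \<Rightarrow> block_matrix \<Rightarrow> bool" where
  "agree k A B \<longleftrightarrow> (\<forall>i. \<forall>d\<le>k. A i (i + d) = B i (i + d))"

text \<open>The entry at \<open>(i, i + d)\<close> of a product sums over \<open>l\<close> from
  \<open>i\<close> to \<open>i + d\<close>, so it sees diagonals up to \<open>d\<close> of either
  factor.\<close>

lemma agree_mult:
  assumes "agree k A A'" and "agree k B B'"
  shows "agree k (A \<otimes>\<^bsub>block_toeplitz\<^esub> B) (A' \<otimes>\<^bsub>block_toeplitz\<^esub> B')"
  unfolding agree_def block_toeplitz_mult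
proof (intro allI impI sum.cong HOL.refl)
  fix i d l assume "d \<le> k" "l \<in> {i..i + d}"
  then have "A i l = A' i l" "B l (i + d) = B' l (i + d)"
    using assms[unfolded agree_def, THEN spec[of _ i], THEN spec[of _ "l - i"]]
      assms[unfolded agree_def, THEN spec[of _ l], THEN spec[of _ "i + d - l"]] by auto
  then show "A i l ** B l (i + d) = A' i l ** B' l (i + d)" by simp
qed

text \<open>The blocks with indices 0, 1, 2 multiply like a unitriangular block matrix of size
  three, so these three positions suffice for computing with two diagonals.\<close>

lemma jets_mult:
  assumes "A \<in> carrier block_toeplitz" and "B \<in> carrier block_toeplitz"
  shows "(A \<otimes>\<^bsub>block_toeplitz\<^esub> B) 0 (Suc 0) = A 0 (Suc 0) + B 0 (Suc 0)"
    and "(A \<otimes>\<^bsub>block_toeplitz\<^esub> B) (Suc 0) 2 = A (Suc 0) 2 + B (Suc 0) 2"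
    and "(A \<otimes>\<^bsub>block_toeplitz\<^esub> B) 0 2 = A 0 2 + A 0 (Suc 0) ** B (Suc 0) 2 + B 0 2"
  using block_toeplitz_carrierD(2)[OF assms(1)] block_toeplitz_carrierD(2)[OF assms(2)]
  by (simp_all add: block_toeplitz_mult numeral_2_eq_2 sum.atLeast_Suc_atMost add_ac)

lemma letter_jets:
  "letter_matrix (0, True) 0 (Suc 0) = bits False False False False True True False True False"
  "letter_matrix (0, True) (Suc 0) 2 = bits False False False False True True False True False"
  "letter_matrix (0, True) 0 2 = bits False False False False True False False False True"
  "letter_matrix (0, False) 0 (Suc 0) = bits False False False False True True False True False"
  "letter_matrix (0, False) (Suc 0) 2 = bits False False False False True True False True False"
  "letter_matrix (0, False) 0 2 = bits False False False False True True False True False"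
  "letter_matrix (Suc 0, True) 0 (Suc 0) = bits False False False True True True False False True"
  "letter_matrix (Suc 0, True) (Suc 0) 2 = bits False True True False False False True False False"
  "letter_matrix (Suc 0, True) 0 2 = bits False False False False True True True True True"
  "letter_matrix (Suc 0, False) 0 (Suc 0) = bits False False False True True True False False True"
  "letter_matrix (Suc 0, False) (Suc 0) 2 = bits False True True False False False True False False"
  "letter_matrix (Suc 0, False) 0 2 = bits False False False True False False False True True"
  "letter_matrix (3, True) 0 (Suc 0) = bits False False False True False False False True True"
  "letter_matrix (3, True) (Suc 0) 2 = bits False True True False True True True True False"
  "letter_matrix (3, True) 0 2 = bits False False False True True False False True True"
  "letter_matrix (3, False) 0 (Suc 0) = bits False False False True False False False True True"
  "letter_matrix (3, False) (Suc 0) 2 = bits False True True False True True True True False"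
  "letter_matrix (3, False) 0 2 = bits False False False True False True True True False"
  by (simp_all add: letter_matrix_False jets_mult gen_matrix_closed del: letter_matrix.simps(2))
    (simp_all add: gen_matrix_def gen_blocks_def Let_def
      block_simps)

section \<open>The representation and the finite quotients\<close>

lemma letter_matrix_Units: "i < 7 \<Longrightarrow> letter_matrix (i, b) \<in> Units block_toeplitz"
  by (cases b) (simp_all add: gen_matrix_Units)

lemma letter_matrix_cancel:
  assumes "i < 7"
  shows "letter_matrix (i, b) \<otimes>\<^bsub>block_toeplitz\<^esub> letter_matrix (i, \<not> b) = \<one>\<^bsub>block_toeplitz\<^esub>"
  using gen_matrix_Units[OF assms] by (cases b) simp_all

lemma word_matrix_Nil: "word_matrix [] = \<one>\<^bsub>block_toeplitz\<^esub>"
  and word_matrix_Cons: "word_matrix (l # w) = letter_matrix l \<otimes>\<^bsub>block_toeplitz\<^esub> word_matrix w"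
  by (simp_all add: word_matrix_def)

lemma word_matrix_Units:
  "w \<in> lists ({..<7} \<times> UNIV) \<Longrightarrow> word_matrix w \<in> Units block_toeplitz"
  by (induction w) (auto simp: word_matrix_Nil word_matrix_Cons letter_matrix_Units)

lemma word_matrix_append:
  assumes "v \<in> lists ({..<7} \<times> UNIV)"
  shows "word_matrix (u @ v) = word_matrix u \<otimes>\<^bsub>block_toeplitz\<^esub> word_matrix v"
  using BT.Units_closed[OF word_matrix_Units[OF assms]]
  by (induction u) (simp_all add: word_matrix_Nil word_matrix_Cons block_toeplitz_assoc)

lemma word_matrix_cong:
  "word_eq {..<7} relators u v \<Longrightarrow> word_matrix u = word_matrix v"
proof (induction rule: word_eq.induct)
  case (cancel u v a b)
  then have "a < 7" by simp
  from cancel word_matrix_Units[OF cancel(2)] show ?case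
    using letter_matrix_Units[OF \<open>a < 7\<close>]
    by (simp add: word_matrix_append word_matrix_Cons letter_matrix_cancel[OF \<open>a < 7\<close>] BT.Units_closed
        flip: block_toeplitz_assoc)
next
  case (relator u v r)
  then obtain i where i: "i < 7" "r = [(i, True), ((i + 1) mod 7, True), ((i + 3) mod 7, True)]"
    by (auto simp: relators_def)
  have "word_matrix r = \<one>\<^bsub>block_toeplitz\<^esub>"
    using gen_matrix_relation[OF i(1)]
    by (simp add: i(2) word_matrix_Cons word_matrix_Nil gen_matrix_closed flip: block_toeplitz_assoc)
  then show ?case
    using relator word_matrix_Units by (simp add: word_matrix_append BT.Units_closed)
qed auto

text \<open>Makes the image in the definition of \<open>rep\<close> a singleton, so that
  \<open>the_elem\<close> has its intended value.\<close>

lemma rep_word_class: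
  assumes "w \<in> lists ({..<7} \<times> UNIV)"
  shows "rep (word_class {..<7} relators w) = word_matrix w"
proof -
  have "word_matrix ` word_class {..<7} relators w = (\<lambda>_. word_matrix w) ` word_class {..<7} relators w"
    by (intro image_cong HOL.refl) (use word_matrix_cong in \<open>auto simp: word_class_def\<close>)
  also have "\<dots> = {word_matrix w}"
    using word_eq.refl[OF assms] by (auto simp: word_class_def)
  finally show ?thesis by (simp add: rep_def)
qed

lemma G_tilde_carrierE:
  assumes "g \<in> carrier G_tilde"
  obtains w where "w \<in> lists ({..<7} \<times> UNIV)" "g = word_class {..<7} relators w"
  using assms unfolding G_tilde_def by (rule presented_group_carrierE)

lemma rep_Units: "g \<in> carrier G_tilde \<Longrightarrow> rep g \<in> Units block_toeplitz"
  by (elim G_tilde_carrierE) (simp add: rep_word_class word_matrix_Units)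

lemma rep_closed: "g \<in> carrier G_tilde \<Longrightarrow> rep g \<in> carrier block_toeplitz"
  by (rule BT.Units_closed[OF rep_Units])

lemma rep_mult:
  assumes "g \<in> carrier G_tilde" and "h \<in> carrier G_tilde"
  shows "rep (g \<otimes>\<^bsub>G_tilde\<^esub> h) = rep g \<otimes>\<^bsub>block_toeplitz\<^esub> rep h"
proof -
  obtain u v where uv: "u \<in> lists ({..<7} \<times> UNIV)" "v \<in> lists ({..<7} \<times> UNIV)"
    "g = word_class {..<7} relators u" "h = word_class {..<7} relators v"
    using assms by (metis G_tilde_carrierE)
  then have "g \<otimes>\<^bsub>G_tilde\<^esub> h = word_class {..<7} relators (u @ v)"
    by (simp add: G_tilde_def presented_group_mult)
  with uv show ?thesis by (simp add: rep_word_class word_matrix_append)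
qed

lemma rep_one: "rep \<one>\<^bsub>G_tilde\<^esub> = \<one>\<^bsub>block_toeplitz\<^esub>"
  by (simp add: G_tilde_def presented_group_one rep_word_class word_matrix_Nil)

lemma rep_inv:
  assumes "g \<in> carrier G_tilde"
  shows "rep (inv\<^bsub>G_tilde\<^esub> g) = inv\<^bsub>block_toeplitz\<^esub> rep g"
  using assms rep_closed rep_mult[of g "inv\<^bsub>G_tilde\<^esub> g"] rep_mult[of "inv\<^bsub>G_tilde\<^esub> g" g]
  by (intro BT.inv_unique') (simp_all add: rep_one)

lemma rep_gen:
  assumes "i < 7"
  shows "rep (gen i) = letter_matrix (i, True)" and "rep (inv\<^bsub>G_tilde\<^esub> gen i) = letter_matrix (i, False)"
proof -
  show "rep (gen i) = letter_matrix (i, True)"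
    using assms by (simp add: gen_def rep_word_class word_matrix_Cons word_matrix_Nil gen_matrix_closed)
  then show "rep (inv\<^bsub>G_tilde\<^esub> gen i) = letter_matrix (i, False)"
    using assms by (simp add: rep_inv gen_closed)
qed

lemma agree_refl: "agree k A A"
  and agree_sym: "agree k A B \<Longrightarrow> agree k B A"
  and agree_mono: "agree k A B \<Longrightarrow> j \<le> k \<Longrightarrow> agree j A B"
  by (simp_all add: agree_def)

lemma agree_rep_mult:
  assumes "g \<in> carrier G_tilde" "g' \<in> carrier G_tilde" "h \<in> carrier G_tilde" "h' \<in> carrier G_tilde"
    and "agree k (rep g) (rep g')" "agree k (rep h) (rep h')"
  shows "agree k (rep (g \<otimes>\<^bsub>G_tilde\<^esub> h)) (rep (g' \<otimes>\<^bsub>G_tilde\<^esub> h'))"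
  using assms by (simp add: rep_mult agree_mult)

lemma G_group_simps:
  "carrier G_group = G_sub" "monoid.mult G_group = monoid.mult G_tilde" "one G_group = one G_tilde"
  by (simp_all add: G_group_def G_sub_def)

lemma group_G_group: "group G_group"
  using Gt.subgroup_imp_group[OF subgroup_G_sub] by (simp add: G_group_def G_sub_def)

interpretation G: group G_group
  by (rule group_G_group)

lemma G_group_inv: "g \<in> G_sub \<Longrightarrow> inv\<^bsub>G_group\<^esub> g = inv\<^bsub>G_tilde\<^esub> g"
  using Gt.m_inv_consistent[OF subgroup_G_sub] by (simp add: G_group_def G_sub_def)

text \<open>Diagonal 0 may be included because it is the identity throughout the group. In this form
  normality of \<open>G_up k\<close> and the description of its cosets follow from
  \<open>agree_mult\<close>.\<close>

lemma G_up_eq: "G_up k = {g \<in> G_sub. agree k (rep g) (rep \<one>\<^bsub>G_tilde\<^esub>)}"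
proof -
  have "(\<forall>d\<in>{1..k}. \<forall>i. rep g i (i + d) = 0) \<longleftrightarrow> agree k (rep g) (rep \<one>\<^bsub>G_tilde\<^esub>)" if "g \<in> G_sub" for g
  proof -
    have "rep g i i = mat 1" for i
      using block_toeplitz_carrierD(2)[OF rep_closed] that by simp
    then show ?thesis
      unfolding agree_def rep_one block_toeplitz_one
      by (auto simp: Ball_def)
  qed
  then show ?thesis by (auto simp: G_up_def G_group_simps)
qed

lemma agree_rep_inv:
  assumes "g \<in> carrier G_tilde" "h \<in> carrier G_tilde"
  shows "agree k (rep (g \<otimes>\<^bsub>G_tilde\<^esub> inv\<^bsub>G_tilde\<^esub> h)) (rep \<one>\<^bsub>G_tilde\<^esub>) \<longleftrightarrow> agree k (rep g) (rep h)"
proof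
  assume "agree k (rep (g \<otimes>\<^bsub>G_tilde\<^esub> inv\<^bsub>G_tilde\<^esub> h)) (rep \<one>\<^bsub>G_tilde\<^esub>)"
  then have "agree k (rep (g \<otimes>\<^bsub>G_tilde\<^esub> inv\<^bsub>G_tilde\<^esub> h \<otimes>\<^bsub>G_tilde\<^esub> h)) (rep (\<one>\<^bsub>G_tilde\<^esub> \<otimes>\<^bsub>G_tilde\<^esub> h))"
    using assms by (intro agree_rep_mult agree_refl) auto
  then show "agree k (rep g) (rep h)" using assms by (simp add: Gt.m_assoc)
next
  assume "agree k (rep g) (rep h)"
  then have "agree k (rep (g \<otimes>\<^bsub>G_tilde\<^esub> inv\<^bsub>G_tilde\<^esub> h)) (rep (h \<otimes>\<^bsub>G_tilde\<^esub> inv\<^bsub>G_tilde\<^esub> h))"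
    using assms by (intro agree_rep_mult agree_refl) auto
  then show "agree k (rep (g \<otimes>\<^bsub>G_tilde\<^esub> inv\<^bsub>G_tilde\<^esub> h)) (rep \<one>\<^bsub>G_tilde\<^esub>)" using assms by simp
qed

lemma normal_G_up: "G_up k \<lhd> G_group"
  unfolding G.normal_inv_iff
proof (intro conjI ballI G.subgroupI)
  show "G_up k \<subseteq> carrier G_group" by (auto simp: G_up_eq G_group_simps)
  show "G_up k \<noteq> {}" using G_sub.one_closed agree_refl by (auto simp: G_up_eq intro!: exI[of _ "\<one>\<^bsub>G_tilde\<^esub>"])
next
  fix g assume "g \<in> G_up k"
  then have g: "g \<in> G_sub" "agree k (rep g) (rep \<one>\<^bsub>G_tilde\<^esub>)" by (auto simp: G_up_eq)
  have "agree k (rep (\<one>\<^bsub>G_tilde\<^esub> \<otimes>\<^bsub>G_tilde\<^esub> inv\<^bsub>G_tilde\<^esub> g)) (rep \<one>\<^bsub>G_tilde\<^esub>)"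
    using g by (subst agree_rep_inv) (auto intro: agree_sym)
  then show "inv\<^bsub>G_group\<^esub> g \<in> G_up k"
    using g by (simp add: G_up_eq G_group_inv)
next
  fix g h assume "g \<in> G_up k" "h \<in> G_up k"
  then have gh: "g \<in> G_sub" "agree k (rep g) (rep \<one>\<^bsub>G_tilde\<^esub>)" "h \<in> G_sub" "agree k (rep h) (rep \<one>\<^bsub>G_tilde\<^esub>)"
    by (auto simp: G_up_eq)
  then have "agree k (rep (g \<otimes>\<^bsub>G_tilde\<^esub> h)) (rep (\<one>\<^bsub>G_tilde\<^esub> \<otimes>\<^bsub>G_tilde\<^esub> \<one>\<^bsub>G_tilde\<^esub>))"
    by (intro agree_rep_mult) auto
  with gh show "g \<otimes>\<^bsub>G_group\<^esub> h \<in> G_up k" by (simp add: G_up_eq G_group_simps)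
next
  fix x h assume "x \<in> carrier G_group" "h \<in> G_up k"
  then have xh: "x \<in> G_sub" "h \<in> G_sub" "agree k (rep h) (rep \<one>\<^bsub>G_tilde\<^esub>)"
    by (auto simp: G_up_eq G_group_simps)
  then have "agree k (rep (x \<otimes>\<^bsub>G_tilde\<^esub> h)) (rep (x \<otimes>\<^bsub>G_tilde\<^esub> \<one>\<^bsub>G_tilde\<^esub>))"
    by (intro agree_rep_mult agree_refl) auto
  then have "agree k (rep (x \<otimes>\<^bsub>G_tilde\<^esub> h \<otimes>\<^bsub>G_tilde\<^esub> inv\<^bsub>G_tilde\<^esub> x)) (rep \<one>\<^bsub>G_tilde\<^esub>)"
    using xh by (subst agree_rep_inv) auto
  with xh show "x \<otimes>\<^bsub>G_group\<^esub> h \<otimes>\<^bsub>G_group\<^esub> inv\<^bsub>G_group\<^esub> x \<in> G_up k"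
    by (simp add: G_up_eq G_group_simps G_group_inv)
qed

lemma G_up_coset_eq_iff:
  assumes "g \<in> G_sub" "h \<in> G_sub"
  shows "G_up k #>\<^bsub>G_group\<^esub> g = G_up k #>\<^bsub>G_group\<^esub> h \<longleftrightarrow> agree k (rep g) (rep h)"
proof -
  have sub: "subgroup (G_up k) G_group"
    using normal_G_up by (rule normal_imp_subgroup)
  have "G_up k #>\<^bsub>G_group\<^esub> g = G_up k #>\<^bsub>G_group\<^esub> h \<longleftrightarrow> g \<in> G_up k #>\<^bsub>G_group\<^esub> h"
    using G.repr_independence[OF _ _ sub, of g h] G.rcos_self[OF _ sub, of g] assms
    by (auto simp: G_group_simps)
  also have "\<dots> \<longleftrightarrow> g \<otimes>\<^bsub>G_group\<^esub> inv\<^bsub>G_group\<^esub> h \<in> G_up k"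
    using subgroup.rcos_module[OF sub G.group_axioms, of h g] assms by (simp add: G_group_simps)
  also have "\<dots> \<longleftrightarrow> agree k (rep g) (rep h)"
    using assms agree_rep_inv[of g h k] by (auto simp: G_up_eq G_group_simps G_group_inv)
  finally show ?thesis .
qed

lemma UNIV_bit: "(UNIV :: bit set) = {0, 1}"
  by (rule UNIV_eq_I) (metis bit_not_zero_iff insert_iff)

instance bit :: finite
  by standard (simp add: UNIV_bit)

text \<open>By 3-periodicity a coset is determined by the blocks of three rows on the diagonals 0 to
  k, and there are finitely many blocks.\<close>

lemma finite_G_quot: "finite (carrier (G_quot k))"
proof -
  define T where "T g = restrict (\<lambda>p. rep g (fst p) (fst p + snd p)) ({..<3} \<times> {..k})" for g
  have agr: "agree k (rep g) (rep h)" if gh: "g \<in> G_sub" "h \<in> G_sub" "T g = T h" for g h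
    unfolding agree_def
  proof (intro allI impI)
    fix i d assume "d \<le> k"
    have shift: "rep g i (i + d) = rep g (i mod 3) (i mod 3 + d)" if "g \<in> G_sub" for g i
    proof (induction i rule: less_induct)
      case (less i)
      show ?case
      proof (cases "i < 3")
        case False
        then have "rep g i (i + d) = rep g (i - 3 + 3) (i - 3 + d + 3)" by simp
        also have "\<dots> = rep g (i - 3) (i - 3 + d)"
          using block_toeplitz_carrierD(3)[OF rep_closed] that by simp
        finally show ?thesis using less[of "i - 3"] False by (simp add: le_mod_geq)
      qed simp
    qed
    have "T g (i mod 3, d) = T h (i mod 3, d)" using gh(3) by simp
    then have "rep g (i mod 3) (i mod 3 + d) = rep h (i mod 3) (i mod 3 + d)"
      using \<open>d \<le> k\<close> by (simp add: T_def)
    then show "rep g i (i + d) = rep h i (i + d)"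
      using shift[OF gh(1), of i] shift[OF gh(2), of i] by (simp only:)
  qed
  have eq: "G_up k #>\<^bsub>G_group\<^esub> g = G_up k #>\<^bsub>G_group\<^esub> h" if "g \<in> G_sub" "h \<in> G_sub" "T g = T h" for g h
    using agr[OF that] G_up_coset_eq_iff[OF that(1,2)] by simp
  have "T ` G_sub \<subseteq> ({..<3} \<times> {..k}) \<rightarrow>\<^sub>E UNIV"
    unfolding T_def by (intro image_subsetI iffD2[OF restrict_PiE_iff]) simp
  then have "finite (T ` G_sub)"
    by (rule finite_subset) (intro finite_PiE, auto)
  moreover have "carrier (G_quot k) \<subseteq> (\<lambda>t. G_up k #>\<^bsub>G_group\<^esub> inv_into G_sub T t) ` (T ` G_sub)"
  proof
    fix c assume "c \<in> carrier (G_quot k)"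
    then obtain g where g: "g \<in> G_sub" "c = G_up k #>\<^bsub>G_group\<^esub> g"
      by (auto simp: G_quot_def FactGroup_def RCOSETS_def G_group_simps)
    then have "T g \<in> T ` G_sub" by blast
    then have "c = G_up k #>\<^bsub>G_group\<^esub> inv_into G_sub T (T g)"
      unfolding g(2) using g(1) by (intro eq) (simp_all only: inv_into_into f_inv_into_f)
    with \<open>T g \<in> T ` G_sub\<close> show "c \<in> (\<lambda>t. G_up k #>\<^bsub>G_group\<^esub> inv_into G_sub T t) ` (T ` G_sub)"
      by (rule image_eqI[where x = "T g", rotated])
  qed
  ultimately show ?thesis by (rule finite_subset[rotated, OF finite_imageI])
qed

section \<open>Cayley graphs with one orbit of triangles\<close>

lemma (in group) sum_mult_right:
  assumes "s \<in> carrier G"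
  shows "(\<Sum>h\<in>carrier G. F (h \<otimes> s)) = (\<Sum>h\<in>carrier G. F h :: real)"
proof (rule sum.reindex_bij_witness[of _ "\<lambda>h. h \<otimes> inv s" "\<lambda>h. h \<otimes> s"])
qed (use assms in \<open>simp_all add: m_assoc\<close>)

definition three_gens :: "('a, 'm) monoid_scheme \<Rightarrow> 'a \<Rightarrow> 'a \<Rightarrow> 'a \<Rightarrow> 'a set" where
  "three_gens Q a b c = {a, inv\<^bsub>Q\<^esub> a, b, inv\<^bsub>Q\<^esub> b, c, inv\<^bsub>Q\<^esub> c}"

text \<open>The six triples are the rotations of a b c and of its inverse, so \<open>triples\<close>
  says that all triangles are left translates of one. As before, \<open>invariant_const\<close>
  expresses that \<open>a\<close> and \<open>b\<close> generate.\<close>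

locale triangle_group = group Q for Q (structure) +
  fixes a b c
  assumes finite_Q: "finite (carrier Q)"
    and abc_closed [simp]: "a \<in> carrier Q" "b \<in> carrier Q" "c \<in> carrier Q"
    and abc: "a \<otimes> b \<otimes> c = \<one>"
    and card_gens: "card (three_gens Q a b c) = 6"
    and one_notin_gens: "\<one> \<notin> three_gens Q a b c"
    and triples: "\<lbrakk>s \<in> three_gens Q a b c; s' \<in> three_gens Q a b c; s'' \<in> three_gens Q a b c; s \<otimes> s' \<otimes> s'' = \<one>\<rbrakk>
      \<Longrightarrow> (s, s', s'') \<in> {(a, b, c), (b, c, a), (c, a, b), (inv c, inv b, inv a), (inv b, inv a, inv c), (inv a, inv c, inv b)}"
    and invariant_const: "\<lbrakk>\<And>h. h \<in> carrier Q \<Longrightarrow> (f :: _ \<Rightarrow> real) (h \<otimes> a) = f h;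
        \<And>h. h \<in> carrier Q \<Longrightarrow> f (h \<otimes> b) = f h; h \<in> carrier Q; h' \<in> carrier Q\<rbrakk> \<Longrightarrow> f h = f h'"
begin

abbreviation S where "S \<equiv> three_gens Q a b c"
abbreviation \<Gamma> where "\<Gamma> \<equiv> Cay Q S"

lemma S_closed: "s \<in> S \<Longrightarrow> s \<in> carrier Q"
  by (auto simp: three_gens_def)

lemma S_inv: "s \<in> S \<Longrightarrow> inv s \<in> S"
  by (auto simp: three_gens_def)

lemma verts_\<Gamma>: "verts \<Gamma> = carrier Q"
  by (simp add: Cay_def)

lemma edge_iff:
  assumes "h \<in> carrier Q" "k \<in> carrier Q"
  shows "{h, k} \<in> edges \<Gamma> \<longleftrightarrow> (\<exists>s\<in>S. k = h \<otimes> s)"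
proof
  assume "{h, k} \<in> edges \<Gamma>"
  then obtain g s where *: "g \<in> carrier Q" "s \<in> S" "{h, k} = {g, g \<otimes> s}"
    by (auto simp: Cay_def)
  then consider "h = g" "k = g \<otimes> s" | "h = g \<otimes> s" "k = g"
    by (auto simp: doubleton_eq_iff)
  then show "\<exists>s\<in>S. k = h \<otimes> s"
  proof cases
    case 2
    then have "k = h \<otimes> inv s" using * S_closed by (simp add: m_assoc)
    then show ?thesis using S_inv[OF *(2)] by blast
  qed (use * in blast)
next
  assume "\<exists>s\<in>S. k = h \<otimes> s"
  then show "{h, k} \<in> edges \<Gamma>" using assms by (auto simp: Cay_def)
qed

lemma nbrs_\<Gamma>: "h \<in> carrier Q \<Longrightarrow> nbrs \<Gamma> h = (\<lambda>s. h \<otimes> s) ` S"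
  using edge_iff S_closed by (auto simp: nbrs_def verts_\<Gamma>)

lemma inj_mult_left: "h \<in> carrier Q \<Longrightarrow> inj_on (\<lambda>s. h \<otimes> s) S"
  using S_closed by (auto simp: inj_on_def)

lemma regular_\<Gamma>: "regular 6 \<Gamma>"
  using card_gens by (simp add: regular_def verts_\<Gamma> nbrs_\<Gamma> card_image inj_mult_left)

lemma finite_simple_\<Gamma>: "finite_simple \<Gamma>"
  unfolding finite_simple_def
proof (intro conjI ballI)
  show "finite (verts \<Gamma>)" by (simp add: verts_\<Gamma> finite_Q)
  fix e assume "e \<in> edges \<Gamma>"
  then obtain h s where e: "e = {h, h \<otimes> s}" "h \<in> carrier Q" "s \<in> S" by (auto simp: Cay_def)
  then show "e \<subseteq> verts \<Gamma>" using S_closed by (simp add: verts_\<Gamma>)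
  have "h \<otimes> s \<noteq> h"
    using Units_l_cancel[of h s \<one>] e(2,3) one_notin_gens S_closed[OF e(3)] by auto
  then show "card e = 2" using e(1) by auto
qed

lemma gens_distinct: "distinct [a, inv a, b, inv b, c, inv c]"
proof (rule card_distinct)
  show "card (set [a, inv a, b, inv b, c, inv c]) = length [a, inv a, b, inv b, c, inv c]"
    using card_gens by (simp only: three_gens_def) simp
qed

lemma sum_S: "(\<Sum>s\<in>S. g s) = g a + g (inv a) + g b + g (inv b) + g c + g (inv c)" for g :: "_ \<Rightarrow> real"
  using gens_distinct by (simp add: three_gens_def)

lemma adj_op_\<Gamma>:
  assumes "h \<in> carrier Q"
  shows "adj_op \<Gamma> f h = f (h \<otimes> a) + f (h \<otimes> inv a) + f (h \<otimes> b) + f (h \<otimes> inv b) + f (h \<otimes> c) + f (h \<otimes> inv c)"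
  using assms by (simp add: adj_op_def verts_\<Gamma> nbrs_\<Gamma> sum.reindex inj_mult_left sum_S)

lemma sum_mult_inv:
  assumes "s \<in> carrier Q"
  shows "(\<Sum>h\<in>carrier Q. f h * f (h \<otimes> inv s)) = (\<Sum>h\<in>carrier Q. f h * f (h \<otimes> s) :: real)"
proof -
  have "(\<Sum>h\<in>carrier Q. f h * f (h \<otimes> inv s)) = (\<Sum>h\<in>carrier Q. f (h \<otimes> s) * f (h \<otimes> s \<otimes> inv s))"
    using sum_mult_right[OF assms, of "\<lambda>h. f h * f (h \<otimes> inv s)"] by simp
  also have "\<dots> = (\<Sum>h\<in>carrier Q. f h * f (h \<otimes> s))"
    using assms by (intro sum.cong) (simp_all add: m_assoc)
  finally show ?thesis .
qed

text \<open>The quadratic form of 6 - A, where A is the adjacency operator: a generator and its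
  inverse contribute equally, so each pair is represented once.\<close>

definition energy :: "('a \<Rightarrow> real) \<Rightarrow> real" where
  "energy f = (\<Sum>h\<in>carrier Q. (f (h \<otimes> a) - f h)\<^sup>2) + (\<Sum>h\<in>carrier Q. (f (h \<otimes> b) - f h)\<^sup>2)
     + (\<Sum>h\<in>carrier Q. (f (h \<otimes> c) - f h)\<^sup>2)"

lemma energy_gen:
  fixes f :: "'a \<Rightarrow> real"
  assumes "s \<in> carrier Q"
  shows "(\<Sum>h\<in>carrier Q. (f (h \<otimes> s) - f h)\<^sup>2) = 2 * (\<Sum>h\<in>carrier Q. (f h)\<^sup>2) - 2 * (\<Sum>h\<in>carrier Q. f h * f (h \<otimes> s))"
proof -
  have "(\<Sum>h\<in>carrier Q. (f (h \<otimes> s) - f h)\<^sup>2)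
      = (\<Sum>h\<in>carrier Q. (f (h \<otimes> s))\<^sup>2 + (f h)\<^sup>2 - 2 * (f h * f (h \<otimes> s)))"
    by (intro sum.cong) (simp_all add: power2_eq_square algebra_simps)
  also have "\<dots> = (\<Sum>h\<in>carrier Q. (f (h \<otimes> s))\<^sup>2) + (\<Sum>h\<in>carrier Q. (f h)\<^sup>2) - 2 * (\<Sum>h\<in>carrier Q. f h * f (h \<otimes> s))"
    by (simp add: sum.distrib sum_subtractf sum_distrib_left)
  also have "(\<Sum>h\<in>carrier Q. (f (h \<otimes> s))\<^sup>2) = (\<Sum>h\<in>carrier Q. (f h)\<^sup>2)"
    using sum_mult_right[OF assms, of "\<lambda>h. (f h)\<^sup>2"] .
  finally show ?thesis by simp
qed

lemma energy_eq: "energy f = 6 * (\<Sum>h\<in>carrier Q. (f h)\<^sup>2) - (\<Sum>h\<in>carrier Q. f h * adj_op \<Gamma> f h)"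
proof -
  have "(\<Sum>h\<in>carrier Q. f h * adj_op \<Gamma> f h)
      = (\<Sum>h\<in>carrier Q. f h * f (h \<otimes> a) + f h * f (h \<otimes> inv a) + f h * f (h \<otimes> b) + f h * f (h \<otimes> inv b)
          + f h * f (h \<otimes> c) + f h * f (h \<otimes> inv c))"
    by (intro sum.cong) (simp_all add: adj_op_\<Gamma> algebra_simps)
  then show ?thesis
    by (simp add: energy_def energy_gen sum.distrib sum_mult_inv)
qed

lemma energy_eigenfunction:
  assumes "f \<in> eigenspace \<Gamma> \<mu>"
  shows "energy f = (6 - \<mu>) * (\<Sum>h\<in>carrier Q. (f h)\<^sup>2)"
proof -
  have "adj_op \<Gamma> f = (\<lambda>h. \<mu> * f h)" using assms by (simp add: eigenspace_def)
  then show ?thesis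
    by (simp add: energy_eq sum_distrib_left power2_eq_square algebra_simps)
qed

lemma energy_nonneg: "0 \<le> energy f"
  unfolding energy_def by (intro add_nonneg_nonneg sum_nonneg) simp_all

lemma energy_0_const:
  assumes "energy f = 0" "h \<in> carrier Q" "h' \<in> carrier Q"
  shows "f h = f h'"
proof -
  have "(\<Sum>h\<in>carrier Q. (f (h \<otimes> a) - f h)\<^sup>2) = 0" "(\<Sum>h\<in>carrier Q. (f (h \<otimes> b) - f h)\<^sup>2) = 0"
    using assms(1) sum_nonneg[of "carrier Q" "\<lambda>h. (f (h \<otimes> a) - f h)\<^sup>2"]
      sum_nonneg[of "carrier Q" "\<lambda>h. (f (h \<otimes> b) - f h)\<^sup>2"] sum_nonneg[of "carrier Q" "\<lambda>h. (f (h \<otimes> c) - f h)\<^sup>2"]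
    unfolding energy_def by (smt (verit) zero_le_power2)+
  then have "f (h \<otimes> a) = f h" "f (h \<otimes> b) = f h" if "h \<in> carrier Q" for h
    using that finite_Q by (simp_all add: sum_nonneg_eq_0_iff)
  then show ?thesis using invariant_const assms(2,3) by blast
qed

lemma eigenspace_6_const:
  assumes "f \<in> eigenspace \<Gamma> 6" "h \<in> carrier Q" "h' \<in> carrier Q"
  shows "f h = f h'"
  using energy_eigenfunction[OF assms(1)] energy_0_const[OF _ assms(2,3)] by simp

lemma spectrum_le_6: "\<mu> \<in> adj_spectrum \<Gamma> \<Longrightarrow> \<mu> \<le> 6"
proof -
  assume "\<mu> \<in> adj_spectrum \<Gamma>"
  then obtain f where f: "f \<in> eigenspace \<Gamma> \<mu>" "f \<noteq> (\<lambda>_. 0)" by (auto simp: adj_spectrum_def)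
  then have "0 < (\<Sum>h\<in>carrier Q. (f h)\<^sup>2)"
    using eigenfunction_norm_pos[of \<Gamma> f] finite_Q by (simp add: verts_\<Gamma> eigenspace_def)
  with energy_eigenfunction[OF f(1)] energy_nonneg[of f] show "\<mu> \<le> 6"
    by (simp add: zero_le_mult_iff)
qed

lemma const_in_eigenspace_6: "indicator (carrier Q) \<in> eigenspace \<Gamma> 6"
  by (auto simp: eigenspace_def functions_on_def verts_\<Gamma> fun_eq_iff indicator_def adj_op_\<Gamma>)
    (simp add: adj_op_def verts_\<Gamma>)

lemma six_in_spectrum: "6 \<in> adj_spectrum \<Gamma>"
proof -
  have "indicator (carrier Q) \<noteq> (\<lambda>_. 0 :: real)"
    using one_closed by (metis indicator_simps(1) zero_neq_one)
  then show ?thesis using const_in_eigenspace_6 unfolding adj_spectrum_def by blast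
qed

lemma eigenfunction_sum_0:
  assumes "f \<in> eigenspace \<Gamma> \<mu>" "\<mu> \<noteq> 6"
  shows "(\<Sum>h\<in>carrier Q. f h) = 0"
proof -
  have "(\<Sum>h\<in>verts \<Gamma>. f h * indicator (carrier Q) h) = 0"
    using assms finite_Q const_in_eigenspace_6
    by (intro eigenfunctions_orthogonal[of \<Gamma> f \<mu> _ 6]) (simp_all add: verts_\<Gamma>)
  then show ?thesis by (simp add: verts_\<Gamma> sum.inter_restrict)
qed

text \<open>The operators between functions on vertices and functions on triangles, where the triangle
  \<open>{h, h a, h a b}\<close> is represented by \<open>h\<close>.\<close>

definition tri :: "'a \<Rightarrow> 'a set" where
  "tri h = {h, h \<otimes> a, h \<otimes> inv c}"

definition up :: "('a \<Rightarrow> real) \<Rightarrow> 'a \<Rightarrow> real" where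
  "up f h = (if h \<in> carrier Q then f h + f (h \<otimes> a) + f (h \<otimes> inv c) else 0)"

definition down :: "('a \<Rightarrow> real) \<Rightarrow> 'a \<Rightarrow> real" where
  "down f h = (if h \<in> carrier Q then f h + f (h \<otimes> inv a) + f (h \<otimes> c) else 0)"

lemma ab: "a \<otimes> b = inv c" "b \<otimes> c = inv a" "c \<otimes> a = inv b"
  and inv_ab: "inv a \<otimes> inv c = b" "inv c \<otimes> inv b = a" "inv b \<otimes> inv a = c"
proof -
  show 1: "a \<otimes> b = inv c"
    using abc by (simp add: inv_equality)
  have "a \<otimes> (b \<otimes> c) = \<one>" using abc by (simp add: m_assoc)
  then show 2: "b \<otimes> c = inv a"
    using inv_equality[of "b \<otimes> c" a] inv_comm[of a "b \<otimes> c"] by simp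
  have "c \<otimes> a \<otimes> b = \<one>"
    by (simp add: 1 m_assoc)
  then show 3: "c \<otimes> a = inv b" by (simp add: inv_equality)
  show "inv a \<otimes> inv c = b" unfolding 1[symmetric] by (simp flip: m_assoc)
  show "inv c \<otimes> inv b = a" unfolding 1[symmetric] by (simp add: m_assoc)
  show "inv b \<otimes> inv a = c" unfolding 2[symmetric] by (simp flip: m_assoc)
qed

text \<open>A vertex \<open>h\<close> lies in the triangles based at \<open>h\<close>,
  \<open>h \<otimes> inv a\<close> and \<open>h \<otimes> c\<close>, whose other corners are the six
  neighbours of \<open>h\<close>, each occurring once.\<close>

lemma down_up:
  assumes "h \<in> carrier Q"
  shows "down (up f) h = 3 * f h + adj_op \<Gamma> f h"
proof -
  have "h \<otimes> inv a \<otimes> a = h" "h \<otimes> inv a \<otimes> inv c = h \<otimes> b" "h \<otimes> c \<otimes> a = h \<otimes> inv b" "h \<otimes> c \<otimes> inv c = h"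
    using assms by (simp_all add: m_assoc ab inv_ab)
  then show ?thesis using assms by (simp add: down_def up_def adj_op_\<Gamma>)
qed

lemma sum_up_down: "(\<Sum>h\<in>carrier Q. f h * up g h) = (\<Sum>h\<in>carrier Q. down f h * g h)"
proof -
  have 1: "(\<Sum>h\<in>carrier Q. f h * g (h \<otimes> a)) = (\<Sum>h\<in>carrier Q. f (h \<otimes> inv a) * g h)"
    using sum_mult_right[of a "\<lambda>h. f (h \<otimes> inv a) * g h"] by (simp add: m_assoc)
  have 2: "(\<Sum>h\<in>carrier Q. f h * g (h \<otimes> inv c)) = (\<Sum>h\<in>carrier Q. f (h \<otimes> c) * g h)"
    using sum_mult_right[of "inv c" "\<lambda>h. f (h \<otimes> c) * g h"] by (simp add: m_assoc)
  have "(\<Sum>h\<in>carrier Q. f h * up g h) = (\<Sum>h\<in>carrier Q. f h * g h + f h * g (h \<otimes> a) + f h * g (h \<otimes> inv c))"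
    by (intro sum.cong) (simp_all add: up_def algebra_simps)
  also have "\<dots> = (\<Sum>h\<in>carrier Q. f h * g h + f (h \<otimes> inv a) * g h + f (h \<otimes> c) * g h)"
    by (simp add: sum.distrib 1 2)
  also have "\<dots> = (\<Sum>h\<in>carrier Q. down f h * g h)"
    by (intro sum.cong) (simp_all add: down_def algebra_simps)
  finally show ?thesis .
qed

text \<open>As \<open>down\<close> is adjoint to \<open>up\<close>, the operator A + 3 is positive
  semidefinite.\<close>

lemma spectrum_ge: "\<mu> \<in> adj_spectrum \<Gamma> \<Longrightarrow> - 3 \<le> \<mu>"
proof -
  assume "\<mu> \<in> adj_spectrum \<Gamma>"
  then obtain f where f: "f \<in> eigenspace \<Gamma> \<mu>" "f \<noteq> (\<lambda>_. 0)" by (auto simp: adj_spectrum_def)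
  then have pos: "0 < (\<Sum>h\<in>carrier Q. (f h)\<^sup>2)"
    using eigenfunction_norm_pos[of \<Gamma> f] finite_Q by (simp add: verts_\<Gamma> eigenspace_def)
  have "adj_op \<Gamma> f = (\<lambda>h. \<mu> * f h)" using f by (simp add: eigenspace_def)
  then have "(\<Sum>h\<in>carrier Q. down (up f) h * f h) = (\<mu> + 3) * (\<Sum>h\<in>carrier Q. (f h)\<^sup>2)"
    unfolding sum_distrib_left by (intro sum.cong) (simp_all add: down_up power2_eq_square algebra_simps)
  then have "(\<mu> + 3) * (\<Sum>h\<in>carrier Q. (f h)\<^sup>2) = (\<Sum>h\<in>carrier Q. up f h * up f h)"
    by (simp add: sum_up_down)
  also have "\<dots> \<ge> 0" by (intro sum_nonneg) simp
  finally show ?thesis using pos by (simp add: zero_le_mult_iff)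
qed

text \<open>The incidence matrix between vertices and triangles is square, so a kernel on one side
  produces a kernel on the other side.\<close>

lemma minus_3_in_spectrum:
  assumes g: "\<And>h. h \<notin> carrier Q \<Longrightarrow> g h = 0" "g \<noteq> 0" and "down g = 0"
  shows "- 3 \<in> adj_spectrum \<Gamma>"
proof -
  define W where "W = functions_on \<Gamma>"
  have "\<exists>f\<in>W. up f = 0 \<and> f \<noteq> 0"
  proof (rule ccontr)
    assume no: "\<not> ?thesis"
    have "W \<subseteq> up ` W"
    proof (rule supported_inj_imp_surj[of "carrier Q"])
      show "Vector_Spaces.linear (\<lambda>(c::real) f v. c * f v) (\<lambda>(c::real) f v. c * f v) up"
        by (intro Vector_Spaces.linear.intro fun_vs.vector_space_axioms module_hom.intro
            fun_vs.module_axioms module_hom_axioms.intro) (auto simp: up_def fun_eq_iff algebra_simps)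
      show "fun_vs.subspace W"
        by (rule fun_vs.subspaceI) (auto simp: W_def functions_on_def)
      show "up ` W \<subseteq> W"
        by (auto simp: W_def functions_on_def verts_\<Gamma> up_def)
    qed (use no finite_Q in \<open>auto simp: W_def functions_on_def verts_\<Gamma>\<close>)
    moreover have "g \<in> W" using g by (simp add: W_def functions_on_def verts_\<Gamma>)
    ultimately obtain f where "g = up f" by blast
    \<comment> \<open>A kernel element of \<open>down\<close> is orthogonal to the image of
      \<open>up\<close>, so it can lie in that image only if it is zero.\<close>
    then have "(\<Sum>h\<in>carrier Q. g h * g h) = (\<Sum>h\<in>carrier Q. down g h * f h)"
      using sum_up_down[of g f] by simp
    also have "\<dots> = 0" using assms(3) by simp
    finally have "\<forall>h\<in>carrier Q. g h = 0"
      using finite_Q by (simp add: sum_nonneg_eq_0_iff)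
    with g show False by (metis ext zero_fun_apply)
  qed
  then obtain f where f: "f \<in> W" "up f = 0" "f \<noteq> 0" by blast
  have "adj_op \<Gamma> f h = - 3 * f h" for h
  proof (cases "h \<in> carrier Q")
    case True
    have "down (up f) h = 0" unfolding f(2) by (simp add: down_def)
    then show ?thesis using down_up[OF True, of f] by simp
  qed (use f(1) in \<open>simp add: W_def functions_on_def adj_op_def verts_\<Gamma>\<close>)
  then show ?thesis
    using f unfolding adj_spectrum_def eigenspace_def W_def by (auto simp: zero_fun_def)
qed

section \<open>Triangles of the Cayley graph\<close>

lemma cancel_iff:
  assumes "h \<in> carrier Q" "x \<in> carrier Q" "y \<in> carrier Q"
  shows "h \<otimes> x = h \<otimes> y \<longleftrightarrow> x = y" "h \<otimes> x = h \<longleftrightarrow> x = \<one>" "h = h \<otimes> x \<longleftrightarrow> x = \<one>"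
  using assms Units_l_cancel[of h x y] Units_l_cancel[of h x \<one>] by auto

lemma gens_neq:
  "a \<noteq> inv a" "a \<noteq> c" "c \<noteq> inv c" "a \<noteq> inv c" "inv a \<noteq> c" "a \<noteq> \<one>" "inv a \<noteq> \<one>" "c \<noteq> \<one>" "inv c \<noteq> \<one>"
  using gens_distinct one_notin_gens by (auto simp: three_gens_def)

lemma tri_subset: "h \<in> carrier Q \<Longrightarrow> tri h \<subseteq> carrier Q"
  by (simp add: tri_def)

lemma mem_tri_iff:
  assumes "h \<in> carrier Q" "v \<in> carrier Q"
  shows "v \<in> tri h \<longleftrightarrow> h \<in> {v, v \<otimes> inv a, v \<otimes> c}"
  using assms by (auto simp: tri_def m_assoc)

lemma sum_tri:
  fixes f :: "'a \<Rightarrow> real"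
  assumes "h \<in> carrier Q"
  shows "(\<Sum>v\<in>tri h. f v) = f h + f (h \<otimes> a) + f (h \<otimes> inv c)"
  using assms gens_neq by (simp add: tri_def cancel_iff)

lemma card_tri: "h \<in> carrier Q \<Longrightarrow> card (tri h) = 3"
  using gens_neq by (simp add: tri_def cancel_iff)

lemma sum_tri_at:
  fixes f :: "'a \<Rightarrow> real"
  assumes "v \<in> carrier Q"
  shows "(\<Sum>h\<in>{v, v \<otimes> inv a, v \<otimes> c}. f h) = f v + f (v \<otimes> inv a) + f (v \<otimes> c)"
  using assms gens_neq by (simp add: cancel_iff)

lemma card_tri_at: "v \<in> carrier Q \<Longrightarrow> card {v, v \<otimes> inv a, v \<otimes> c} = 3"
  using gens_neq by (simp add: cancel_iff)

text \<open>A triangle determines its base point, because a, inv a, c, inv c are distinct. So there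
  are as many triangles as vertices and the incidence matrix is square.\<close>

lemma inj_tri: "inj_on tri (carrier Q)"
proof (rule inj_onI, rule ccontr)
  fix h k assume hk: "h \<in> carrier Q" "k \<in> carrier Q" "tri h = tri k" "h \<noteq> k"
  have "h \<in> tri k" "k \<in> tri h" using hk(3) by (auto simp: tri_def)
  then have "k \<in> {h \<otimes> inv a, h \<otimes> c}" "k \<in> {h \<otimes> a, h \<otimes> inv c}"
    using hk mem_tri_iff[OF hk(2,1)] by (auto simp: tri_def)
  then show False
    using gens_neq gens_distinct hk(1) by (auto simp: cancel_iff)
qed

text \<open>Walking round a triangle gives three generators with product one. Each of the six cases
  of \<open>triples\<close> singles out the corner that is the base point.\<close>

lemma triangles_\<Gamma>: "triangles \<Gamma> = tri ` carrier Q"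
proof (intro equalityI subsetI)
  fix t assume "t \<in> triangles \<Gamma>"
  then have t: "t \<subseteq> carrier Q" "card t = 3" "\<And>v w. v \<in> t \<Longrightarrow> w \<in> t \<Longrightarrow> v \<noteq> w \<Longrightarrow> {v, w} \<in> edges \<Gamma>"
    by (auto simp: triangles_def verts_\<Gamma>)
  obtain u v w where uvw: "t = {u, v, w}" "u \<noteq> v" "v \<noteq> w" "u \<noteq> w"
    using t(2) by (auto simp: card_3_iff)
  have in_Q: "u \<in> carrier Q" "v \<in> carrier Q" "w \<in> carrier Q" using t(1) uvw by auto
  obtain s where s: "s \<in> S" "v = u \<otimes> s" using t(3)[of u v] uvw edge_iff in_Q by auto
  obtain s' where s': "s' \<in> S" "w = v \<otimes> s'" using t(3)[of v w] uvw edge_iff in_Q by auto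
  obtain s'' where s'': "s'' \<in> S" "u = w \<otimes> s''" using t(3)[of w u] uvw edge_iff in_Q by auto
  note cl = S_closed[OF s(1)] S_closed[OF s'(1)] S_closed[OF s''(1)]
  have "u \<otimes> (s \<otimes> s' \<otimes> s'') = u \<otimes> s \<otimes> s' \<otimes> s''"
    using in_Q(1) cl by (simp add: m_assoc)
  then have "u = u \<otimes> (s \<otimes> s' \<otimes> s'')"
    by (simp only: s(2)[symmetric] s'(2)[symmetric] s''(2)[symmetric])
  then have "s \<otimes> s' \<otimes> s'' = \<one>"
    using cancel_iff(3)[OF in_Q(1), of "s \<otimes> s' \<otimes> s''"] cl by simp
  from triples[OF s(1) s'(1) s''(1) this]
  consider "s = a" "s' = b" "s'' = c" | "s = b" "s' = c" "s'' = a" | "s = c" "s' = a" "s'' = b"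
    | "s = inv c" "s' = inv b" "s'' = inv a" | "s = inv b" "s' = inv a" "s'' = inv c"
    | "s = inv a" "s' = inv c" "s'' = inv b"
    by auto
  then have "t = tri u \<or> t = tri v \<or> t = tri w"
  proof cases
    case 1
    then have "tri u = {u, v, w}" using s s' in_Q by (simp add: tri_def m_assoc ab)
    then show ?thesis using uvw by simp
  next
    case 2
    then have "tri w = {w, u, v}" using s s' in_Q by (simp add: tri_def m_assoc ab inv_ab)
    then show ?thesis using uvw by auto
  next
    case 3
    then have "tri v = {v, w, u}" using s s' in_Q by (simp add: tri_def m_assoc ab)
    then show ?thesis using uvw by auto
  next
    case 4
    then have "tri u = {u, w, v}" using s s' in_Q by (simp add: tri_def m_assoc inv_ab)
    then show ?thesis using uvw by auto
  next
    case 5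
    then have "tri w = {w, v, u}" using s s' in_Q by (simp add: tri_def m_assoc ab inv_ab)
    then show ?thesis using uvw by auto
  next
    case 6
    then have "tri v = {v, u, w}" using s s' in_Q by (simp add: tri_def m_assoc inv_ab)
    then show ?thesis using uvw by auto
  qed
  then show "t \<in> tri ` carrier Q" using in_Q by blast
next
  fix t assume "t \<in> tri ` carrier Q"
  then obtain h where h: "h \<in> carrier Q" "t = tri h" by auto
  have S: "a \<in> S" "inv a \<in> S" "b \<in> S" "inv b \<in> S" "c \<in> S" "inv c \<in> S" by (simp_all add: three_gens_def)
  have e: "{x, x \<otimes> s} \<in> edges \<Gamma>" "{x \<otimes> s, x} \<in> edges \<Gamma>" if "x \<in> carrier Q" "s \<in> S" for x s
    using that by (auto simp: Cay_def insert_commute)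
  have "h \<otimes> inv c = h \<otimes> a \<otimes> b" using h(1) by (simp add: m_assoc ab)
  then have "{h \<otimes> a, h \<otimes> inv c} \<in> edges \<Gamma>" "{h \<otimes> inv c, h \<otimes> a} \<in> edges \<Gamma>"
    using e[of "h \<otimes> a" b] h(1) S by auto
  then show "t \<in> triangles \<Gamma>"
    using e[of h a] e[of h "inv c"] h S card_tri[OF h(1)] tri_subset[OF h(1)]
    unfolding triangles_def verts_\<Gamma> by (simp add: tri_def)
qed

text \<open>Ensures that no old edge survives in \<open>delta_Y\<close>, which makes the new graph
  bipartite.\<close>

lemma edge_in_triangle:
  assumes "e \<in> edges \<Gamma>"
  shows "\<exists>t\<in>triangles \<Gamma>. e \<subseteq> t"
proof -
  obtain h s where e: "e = {h, h \<otimes> s}" "h \<in> carrier Q" "s \<in> S" using assms by (auto simp: Cay_def)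
  have "\<exists>k\<in>{h, h \<otimes> inv a, h \<otimes> c}. {h, h \<otimes> s} \<subseteq> tri k"
    using e(2,3) unfolding three_gens_def
    by (elim insertE emptyE) (auto simp: tri_def m_assoc ab inv_ab)
  then obtain k where "k \<in> {h, h \<otimes> inv a, h \<otimes> c}" "{h, h \<otimes> s} \<subseteq> tri k" by blast
  moreover have "k \<in> carrier Q" using calculation(1) e(2) by auto
  ultimately show ?thesis unfolding triangles_\<Gamma> e(1) by blast
qed

section \<open>The bipartite graph of vertices and triangles\<close>

abbreviation T where "T \<equiv> delta_Y \<Gamma>"

lemma verts_T: "verts T = Inl ` carrier Q \<union> Inr ` tri ` carrier Q"
  by (simp add: delta_Y_def verts_\<Gamma> triangles_\<Gamma>)

lemma edges_T: "edges T = {{Inl v, Inr (tri h)} | v h. h \<in> carrier Q \<and> v \<in> tri h}"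
proof -
  have "{Inl ` e | e. e \<in> edges \<Gamma> \<and> \<not> (\<exists>t\<in>triangles \<Gamma>. e \<subseteq> t)} = ({} :: ('a + 'a set) set set)"
    using edge_in_triangle by blast
  then show ?thesis by (auto simp: delta_Y_def triangles_\<Gamma>)
qed

lemma nbrs_T_Inl:
  assumes "v \<in> carrier Q"
  shows "nbrs T (Inl v) = (\<lambda>h. Inr (tri h)) ` {v, v \<otimes> inv a, v \<otimes> c}"
proof -
  have "nbrs T (Inl v) = (\<lambda>h. Inr (tri h)) ` {h \<in> carrier Q. v \<in> tri h}"
    unfolding nbrs_def verts_T edges_T by (auto simp: doubleton_eq_iff)
  also have "{h \<in> carrier Q. v \<in> tri h} = {v, v \<otimes> inv a, v \<otimes> c}"
    using mem_tri_iff[OF _ assms] assms by auto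
  finally show ?thesis .
qed

lemma nbrs_T_Inr:
  assumes "h \<in> carrier Q"
  shows "nbrs T (Inr (tri h)) = Inl ` tri h"
  using assms tri_subset[OF assms] unfolding nbrs_def verts_T edges_T by (auto simp: doubleton_eq_iff)

lemma inj_Inr_tri: "v \<in> carrier Q \<Longrightarrow> inj_on (\<lambda>h. Inr (tri h)) {v, v \<otimes> inv a, v \<otimes> c}"
  by (rule inj_onI) (auto dest!: inj_onD[OF inj_tri])

lemma regular_T: "regular 3 T"
proof -
  have "card (nbrs T (Inl v)) = 3" if "v \<in> carrier Q" for v
    unfolding nbrs_T_Inl[OF that] card_image[OF inj_Inr_tri[OF that]] by (rule card_tri_at[OF that])
  moreover have "card (nbrs T (Inr (tri h))) = 3" if "h \<in> carrier Q" for h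
    unfolding nbrs_T_Inr[OF that] by (simp add: card_image card_tri[OF that])
  ultimately show ?thesis unfolding regular_def verts_T by auto
qed

lemma finite_simple_T: "finite_simple T"
  unfolding finite_simple_def
proof (intro conjI ballI)
  show "finite (verts T)" by (simp add: verts_T finite_Q)
  fix e assume "e \<in> edges T"
  then obtain v h where e: "e = {Inl v, Inr (tri h)}" "h \<in> carrier Q" "v \<in> tri h"
    unfolding edges_T by blast
  then show "e \<subseteq> verts T" using tri_subset[OF e(2)] by (auto simp: verts_T)
  show "card e = 2" by (simp add: e(1))
qed

lemma bipartite_T: "bipartite T"
  unfolding bipartite_def
proof (intro exI conjI ballI)
  show "verts T = Inl ` carrier Q \<union> Inr ` tri ` carrier Q" by (rule verts_T)
  show "Inl ` carrier Q \<inter> Inr ` tri ` carrier Q = {}" by auto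
  fix e assume "e \<in> edges T"
  then obtain v h where e: "e = {Inl v, Inr (tri h)}" "h \<in> carrier Q" "v \<in> tri h"
    unfolding edges_T by blast
  then have "v \<in> carrier Q" using tri_subset[OF e(2)] by auto
  with e show "\<exists>x\<in>Inl ` carrier Q. \<exists>y\<in>Inr ` tri ` carrier Q. e = {x, y}" by blast
qed

definition vert_part :: "('a + 'a set \<Rightarrow> real) \<Rightarrow> 'a \<Rightarrow> real" where
  "vert_part F h = (if h \<in> carrier Q then F (Inl h) else 0)"

text \<open>Triangles are indexed by their base points, so both halves of a function live on the
  group and \<open>up\<close> and \<open>down\<close> apply.\<close>

definition tri_part :: "('a + 'a set \<Rightarrow> real) \<Rightarrow> 'a \<Rightarrow> real" where
  "tri_part F h = (if h \<in> carrier Q then F (Inr (tri h)) else 0)"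

lemma adj_op_T_Inl:
  assumes "v \<in> carrier Q"
  shows "adj_op T F (Inl v) = down (tri_part F) v"
proof -
  have "adj_op T F (Inl v) = (\<Sum>h\<in>{v, v \<otimes> inv a, v \<otimes> c}. F (Inr (tri h)))"
    using assms sum.reindex[OF inj_Inr_tri[OF assms], of F]
    by (simp only: adj_op_def nbrs_T_Inl verts_T) (simp add: o_def)
  then show ?thesis using assms by (simp add: sum_tri_at down_def tri_part_def)
qed

lemma adj_op_T_Inr:
  assumes "h \<in> carrier Q"
  shows "adj_op T F (Inr (tri h)) = up (vert_part F) h"
proof -
  have "adj_op T F (Inr (tri h)) = (\<Sum>v\<in>tri h. F (Inl v))"
    using assms sum.reindex[of Inl "tri h" F]
    by (simp add: adj_op_def nbrs_T_Inr verts_T o_def)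
  then show ?thesis using assms by (simp add: sum_tri up_def vert_part_def)
qed

text \<open>The adjacency matrix of the bipartite graph has the incidence matrix and its transpose
  as off-diagonal blocks; its square acts as A + 3 on the vertex part.\<close>

lemma eigenspace_T_parts:
  assumes "F \<in> eigenspace T \<theta>"
  shows "down (tri_part F) = (\<lambda>h. \<theta> * vert_part F h)" and "up (vert_part F) = (\<lambda>h. \<theta> * tri_part F h)"
    and "vert_part F \<in> eigenspace \<Gamma> (\<theta>\<^sup>2 - 3)"
proof -
  have F: "adj_op T F = (\<lambda>x. \<theta> * F x)" using assms by (simp add: eigenspace_def)
  show d: "down (tri_part F) = (\<lambda>h. \<theta> * vert_part F h)"
  proof
    fix h show "down (tri_part F) h = \<theta> * vert_part F h"
      using adj_op_T_Inl[of h F] F by (cases "h \<in> carrier Q") (simp_all add: vert_part_def down_def)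
  qed
  show u: "up (vert_part F) = (\<lambda>h. \<theta> * tri_part F h)"
  proof
    fix h show "up (vert_part F) h = \<theta> * tri_part F h"
      using adj_op_T_Inr[of h F] F by (cases "h \<in> carrier Q") (simp_all add: tri_part_def up_def)
  qed
  have "adj_op \<Gamma> (vert_part F) h = (\<theta>\<^sup>2 - 3) * vert_part F h" for h
  proof (cases "h \<in> carrier Q")
    case True
    have "down (up (vert_part F)) h = \<theta> * down (tri_part F) h"
      unfolding u by (simp add: down_def algebra_simps)
    then show ?thesis
      using down_up[OF True, of "vert_part F"] by (simp add: d power2_eq_square algebra_simps)
  qed (simp add: adj_op_def verts_\<Gamma> vert_part_def)
  then show "vert_part F \<in> eigenspace \<Gamma> (\<theta>\<^sup>2 - 3)"
    by (auto simp: eigenspace_def functions_on_def verts_\<Gamma> vert_part_def)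
qed

lemma functions_on_T_eqI:
  assumes "F \<in> functions_on T" "vert_part F = 0" "tri_part F = 0"
  shows "F = (\<lambda>_. 0)"
proof
  fix x
  show "F x = 0"
  proof (cases "x \<in> verts T")
    case True
    then consider h where "h \<in> carrier Q" "x = Inl h" | h where "h \<in> carrier Q" "x = Inr (tri h)"
      unfolding verts_T by blast
    then show ?thesis
    proof cases
      case 1
      then show ?thesis using fun_cong[OF assms(2), of h] by (simp add: vert_part_def)
    next
      case 2
      then show ?thesis using fun_cong[OF assms(3), of h] by (simp add: tri_part_def)
    qed
  qed (use assms(1) in \<open>simp add: functions_on_def\<close>)
qed

text \<open>The delicate case is an eigenfunction that vanishes on all old vertices. Then the
  eigenvalue is 0 and its triangle part lies in the kernel of \<open>down\<close>; the eigenfunction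
  for -3 comes from the squareness of the incidence matrix.\<close>

lemma spectrum_T:
  assumes "\<theta> \<in> adj_spectrum T"
  shows "\<theta>\<^sup>2 - 3 \<in> adj_spectrum \<Gamma>"
proof -
  obtain F where F: "F \<in> eigenspace T \<theta>" "F \<noteq> (\<lambda>_. 0)"
    using assms by (auto simp: adj_spectrum_def)
  note parts = eigenspace_T_parts[OF F(1)]
  show ?thesis
  proof (cases "vert_part F = 0")
    case False
    then show ?thesis
      using parts(3) unfolding adj_spectrum_def by (auto simp: zero_fun_def)
  next
    case True
    have g: "tri_part F \<noteq> 0"
      using functions_on_T_eqI[of F] F True by (auto simp: eigenspace_def)
    then obtain h where h: "tri_part F h \<noteq> 0" by (auto simp: fun_eq_iff)
    have "\<theta> * tri_part F h = 0"
      using fun_cong[OF parts(2), of h] by (auto simp: True up_def split: if_splits)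
    then have \<theta>: "\<theta> = 0" using h by simp
    have "down (tri_part F) = 0"
      unfolding parts(1) by (simp add: \<theta> fun_eq_iff)
    then have "- 3 \<in> adj_spectrum \<Gamma>"
      using g by (intro minus_3_in_spectrum[of "tri_part F"]) (simp_all add: tri_part_def)
    then show ?thesis by (simp add: \<theta>)
  qed
qed

lemma spectrum_T_bounds:
  assumes "\<theta> \<in> adj_spectrum T"
  shows "\<theta> \<in> {-3..3}" and "\<theta>\<^sup>2 - 3 \<in> {-3..6}"
proof -
  have le: "\<theta>\<^sup>2 - 3 \<le> 6" using spectrum_le_6[OF spectrum_T[OF assms]] .
  then have "\<theta>\<^sup>2 \<le> 3\<^sup>2" by simp
  then have "\<bar>\<theta>\<bar> \<le> 3" by (metis abs_le_square_iff abs_numeral)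
  then show "\<theta> \<in> {-3..3}" by auto
  show "\<theta>\<^sup>2 - 3 \<in> {-3..6}" using le by simp
qed

lemma eigenspace_T_3_const:
  assumes F: "F \<in> eigenspace T 3" and "x \<in> verts T" "y \<in> verts T"
  shows "F x = F y"
proof -
  note parts = eigenspace_T_parts[OF F]
  have vert: "F (Inl h) = F (Inl \<one>)" if "h \<in> carrier Q" for h
    using eigenspace_6_const[of "vert_part F" h \<one>] parts(3) that by (simp add: vert_part_def)
  have tri: "F (Inr (tri h)) = F (Inl \<one>)" if h: "h \<in> carrier Q" for h
    using fun_cong[OF parts(2), of h] h vert[of h] vert[of "h \<otimes> a"] vert[of "h \<otimes> inv c"]
    by (simp add: up_def vert_part_def tri_part_def)
  have "F z = F (Inl \<one>)" if "z \<in> verts T" for z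
  proof -
    from that consider h where "h \<in> carrier Q" "z = Inl h" | h where "h \<in> carrier Q" "z = Inr (tri h)"
      unfolding verts_T by blast
    then show ?thesis by cases (simp_all only: vert tri)
  qed
  with assms show ?thesis by metis
qed

lemma three_in_spectrum_T: "3 \<in> adj_spectrum T" and minus_three_in_spectrum_T: "- 3 \<in> adj_spectrum T"
proof -
  have main: "3 * r \<in> adj_spectrum T" if "r * r = 1" for r :: real
  proof -
    \<comment> \<open>The sign \<open>r = 1\<close> gives the constant eigenfunction and
      \<open>r = - 1\<close> the bipartite one.\<close>
    define F where "F x = (if x \<in> verts T then case x of Inl _ \<Rightarrow> r | Inr _ \<Rightarrow> 1 else 0)" for x
    have F_Inl: "F (Inl h) = r" if "h \<in> carrier Q" for h
      using that by (simp add: F_def verts_T)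
    have F_Inr: "F (Inr (tri h)) = 1" if "h \<in> carrier Q" for h
      using that by (simp add: F_def verts_T)
    have "adj_op T F x = 3 * r * F x" for x
    proof (cases "x \<in> verts T")
      case True
      then consider h where "h \<in> carrier Q" "x = Inl h" | h where "h \<in> carrier Q" "x = Inr (tri h)"
        unfolding verts_T by blast
      then show ?thesis
      proof cases
        case 1
        then show ?thesis using that
          by (simp add: adj_op_T_Inl down_def tri_part_def F_Inl F_Inr)
      next
        case 2
        then show ?thesis using that
          by (simp add: adj_op_T_Inr up_def vert_part_def F_Inl F_Inr)
      qed
    qed (simp add: adj_op_def F_def)
    then have "adj_op T F = (\<lambda>x. 3 * r * F x)" by (rule ext)
    then have "F \<in> eigenspace T (3 * r)"
      by (simp add: eigenspace_def functions_on_def) (simp add: F_def)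
    moreover have "F \<noteq> (\<lambda>_. 0)"
      using F_Inr[of \<one>] by (metis one_closed zero_neq_one)
    ultimately show ?thesis unfolding adj_spectrum_def by blast
  qed
  show "3 \<in> adj_spectrum T" using main[of 1] by simp
  show "- 3 \<in> adj_spectrum T" using main[of "- 1"] by simp
qed

text \<open>For the bipartite graph, -3 serves as the eigenvalue different from the degree. For the
  Cayley graph such an eigenvalue is a hypothesis, later met by -2.\<close>

theorem spectral_consequences:
  assumes C: "\<And>\<mu>. \<mu> \<in> adj_spectrum \<Gamma> \<Longrightarrow> \<mu> \<le> C \<or> \<mu> = 6"
    and other: "\<mu> \<in> adj_spectrum \<Gamma>" "\<mu> \<noteq> 6" and "0 < C" "C < 6"
  shows "second_eigenvalue \<Gamma> \<le> C" and "adj_spectrum \<Gamma> \<subseteq> {-3..C} \<union> {6}"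
    and "second_eigenvalue T \<le> sqrt (C + 3)"
    and "adj_spectrum T \<subseteq> {- sqrt (C + 3)..sqrt (C + 3)} \<union> {3, -3}"
proof -
  show "second_eigenvalue \<Gamma> \<le> C"
  proof (rule second_eigenvalue_le[OF _ C six_in_spectrum other])
    show "finite (verts \<Gamma>)" by (simp add: verts_\<Gamma> finite_Q)
  qed (use eigenspace_6_const in \<open>auto simp: verts_\<Gamma>\<close>)
  show "adj_spectrum \<Gamma> \<subseteq> {-3..C} \<union> {6}"
    using C spectrum_ge by fastforce
  have T: "\<bar>\<theta>\<bar> \<le> sqrt (C + 3) \<or> \<theta> = 3 \<or> \<theta> = - 3" if "\<theta> \<in> adj_spectrum T" for \<theta>
  proof -
    from C[OF spectrum_T[OF that]] consider "\<theta>\<^sup>2 \<le> C + 3" | "\<theta>\<^sup>2 = 3\<^sup>2" by fastforce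
    then show ?thesis
    proof cases
      case 1
      then show ?thesis using real_le_rsqrt real_sqrt_le_mono by fastforce
    next
      case 2
      then have "\<theta> = 3 \<or> \<theta> = - 3" by (simp only: power2_eq_iff)
      then show ?thesis by blast
    qed
  qed
  then show "adj_spectrum T \<subseteq> {- sqrt (C + 3)..sqrt (C + 3)} \<union> {3, -3}"
    by (auto simp: abs_le_iff) fastforce+
  show "second_eigenvalue T \<le> sqrt (C + 3)"
  proof (rule second_eigenvalue_le[OF _ _ three_in_spectrum_T minus_three_in_spectrum_T])
    show "finite (verts T)" using finite_simple_T by (simp add: finite_simple_def)
    fix \<theta> assume "\<theta> \<in> adj_spectrum T"
    from T[OF this] show "\<theta> \<le> sqrt (C + 3) \<or> \<theta> = 3"
      using \<open>0 < C\<close> real_sqrt_ge_zero[of "C + 3"] by linarith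
  qed (use eigenspace_T_3_const in auto)
qed

end

section \<open>The graphs \<open>X\<^sub>k\<close> and \<open>T\<^sub>k\<close>\<close>

definition proj :: "nat \<Rightarrow> nat word set \<Rightarrow> nat word set set" where
  "proj k g = G_up k #>\<^bsub>G_group\<^esub> g"

lemma group_G_quot: "group (G_quot k)"
  unfolding G_quot_def by (rule normal.factorgroup_is_group[OF normal_G_up])

lemma proj_mult:
  assumes "g \<in> G_sub" "h \<in> G_sub"
  shows "proj k g \<otimes>\<^bsub>G_quot k\<^esub> proj k h = proj k (g \<otimes>\<^bsub>G_tilde\<^esub> h)"
  using normal.rcos_sum[OF normal_G_up] assms
  by (simp add: proj_def G_quot_def FactGroup_def G_group_simps)

lemma proj_closed: "g \<in> G_sub \<Longrightarrow> proj k g \<in> carrier (G_quot k)"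
  by (auto simp: proj_def G_quot_def FactGroup_def RCOSETS_def G_group_simps)

lemma G_quot_carrierE:
  assumes "x \<in> carrier (G_quot k)"
  obtains g where "g \<in> G_sub" "x = proj k g"
  using assms by (auto simp: proj_def G_quot_def FactGroup_def RCOSETS_def G_group_simps)

lemma proj_one: "proj k \<one>\<^bsub>G_tilde\<^esub> = \<one>\<^bsub>G_quot k\<^esub>"
proof -
  interpret Q: group "G_quot k" by (rule group_G_quot)
  have "proj k \<one>\<^bsub>G_tilde\<^esub> \<otimes>\<^bsub>G_quot k\<^esub> proj k \<one>\<^bsub>G_tilde\<^esub> = proj k \<one>\<^bsub>G_tilde\<^esub>"
    by (simp add: proj_mult)
  then show ?thesis
    using Q.Units_l_cancel[of "proj k \<one>\<^bsub>G_tilde\<^esub>" "proj k \<one>\<^bsub>G_tilde\<^esub>" "\<one>\<^bsub>G_quot k\<^esub>"] proj_closed by simp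
qed

lemma proj_inv:
  assumes "g \<in> G_sub"
  shows "inv\<^bsub>G_quot k\<^esub> proj k g = proj k (inv\<^bsub>G_tilde\<^esub> g)"
proof -
  interpret Q: group "G_quot k" by (rule group_G_quot)
  show ?thesis
    by (rule Q.inv_equality) (use assms in \<open>simp_all add: proj_mult proj_closed proj_one\<close>)
qed

lemma proj_eq_iff:
  assumes "g \<in> G_sub" "h \<in> G_sub"
  shows "proj k g = proj k h \<longleftrightarrow> agree k (rep g) (rep h)"
  unfolding proj_def by (rule G_up_coset_eq_iff[OF assms])

definition letters :: "(nat \<times> bool) set" where
  "letters = {(0, True), (0, False), (1, True), (1, False), (3, True), (3, False)}"

definition letter_elem :: "nat \<times> bool \<Rightarrow> nat word set" where
  "letter_elem l = (if snd l then gen (fst l) else inv\<^bsub>G_tilde\<^esub> gen (fst l))"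

lemma letter_elem:
  assumes "l \<in> letters"
  shows "letter_elem l \<in> G_sub" and "rep (letter_elem l) = letter_matrix l"
    and "letter_matrix l \<in> carrier block_toeplitz"
proof -
  show mem: "letter_elem l \<in> G_sub"
    using assms gen_0_1_3_in_G_sub by (auto simp: letters_def letter_elem_def)
  have "fst l < 7" using assms by (auto simp: letters_def)
  then show "rep (letter_elem l) = letter_matrix l"
    using rep_gen[of "fst l"] by (cases l) (auto simp: letter_elem_def)
  with mem show "letter_matrix l \<in> carrier block_toeplitz"
    using rep_closed by (metis G_sub.mem_carrier)
qed

lemma bits_eq_iff:
  "bits a b c d e f g h i = bits a' b' c' d' e' f' g' h' i' \<longleftrightarrow>
    (a = a' \<and> b = b' \<and> c = c' \<and> d = d' \<and> e = e' \<and> f = f' \<and> g = g' \<and> h = h' \<and> i = i')"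
  by (auto simp: bits_def vec_eq_iff forall_3 of_bool_eq_iff)

lemma agree_2D:
  assumes "agree 2 A B"
  shows "A 0 (Suc 0) = B 0 (Suc 0)" and "A 0 2 = B 0 2"
  using assms[unfolded agree_def, THEN spec[of _ 0], THEN spec[of _ 1]]
    assms[unfolded agree_def, THEN spec[of _ 0], THEN spec[of _ 2]] by (simp_all add: numeral_2_eq_2)

text \<open>On the first diagonal a generator coincides with its inverse, as the blocks have
  characteristic 2. The second diagonal separates them, which explains the bound
  \<open>2 \<le> k\<close>.\<close>

lemma letter_matrix_inj:
  assumes "l \<in> letters" "l' \<in> letters" "agree 2 (letter_matrix l) (letter_matrix l')"
  shows "l = l'"
  using assms(1,2) agree_2D[OF assms(3)] unfolding letters_def
  by (elim insertE emptyE) (simp_all add: letter_jets bits_eq_iff del: letter_matrix.simps)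

lemma letter_matrix_not_one:
  assumes "l \<in> letters"
  shows "\<not> agree 2 (letter_matrix l) \<one>\<^bsub>block_toeplitz\<^esub>"
proof
  assume "agree 2 (letter_matrix l) \<one>\<^bsub>block_toeplitz\<^esub>"
  from agree_2D(1)[OF this] assms show False unfolding letters_def block_toeplitz_one
    by (elim insertE emptyE) (simp_all add: letter_jets bits_eq_iff bits_0 del: letter_matrix.simps)
qed

text \<open>Modulo the third block diagonal the squares of \<open>x\<^sub>0, x\<^sub>1, x\<^sub>3\<close> are linearly independent in a
  central elementary abelian subgroup, which excludes all other products of three letters.\<close>

lemma letter_matrix_triple:
  assumes "l \<in> letters" "l' \<in> letters" "l'' \<in> letters"
    and "agree 2 (letter_matrix l \<otimes>\<^bsub>block_toeplitz\<^esub> letter_matrix l' \<otimes>\<^bsub>block_toeplitz\<^esub> letter_matrix l'') \<one>\<^bsub>block_toeplitz\<^esub>"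
  shows "(l, l', l'') \<in> {((0, True), (1, True), (3, True)), ((1, True), (3, True), (0, True)), ((3, True), (0, True), (1, True)),
    ((3, False), (1, False), (0, False)), ((1, False), (0, False), (3, False)), ((0, False), (3, False), (1, False))}"
proof -
  let ?M = letter_matrix
  note cl = letter_elem(3)[OF assms(1)] letter_elem(3)[OF assms(2)] letter_elem(3)[OF assms(3)]
  have 1: "?M l 0 (Suc 0) + ?M l' 0 (Suc 0) + ?M l'' 0 (Suc 0) = 0"
    using agree_2D(1)[OF assms(4)] cl by (simp add: jets_mult block_toeplitz_one del: letter_matrix.simps)
  have 2: "?M l 0 2 + ?M l 0 (Suc 0) ** ?M l' (Suc 0) 2 + ?M l' 0 2
      + (?M l 0 (Suc 0) + ?M l' 0 (Suc 0)) ** ?M l'' (Suc 0) 2 + ?M l'' 0 2 = 0"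
    using agree_2D(2)[OF assms(4)] cl by (simp add: jets_mult block_toeplitz_one del: letter_matrix.simps)
  \<comment> \<open>Of the 216 triples, condition \<open>1\<close> leaves the 48 in which x_0, x_1,
    x_3 occur once each up to order and inversion, and condition \<open>2\<close> leaves six of
    these.\<close>
  show ?thesis
    using assms(1-3) 1 2 unfolding letters_def
    by (elim insertE emptyE; simp add: letter_jets bits_add bits_mult bits_0 bits_eq_iff del: letter_matrix.simps)
qed

lemma three_gens_G_quot:
  "three_gens (G_quot k) (proj k (gen 0)) (proj k (gen 1)) (proj k (gen 3)) = (\<lambda>l. proj k (letter_elem l)) ` letters"
  using gen_0_1_3_in_G_sub by (simp add: three_gens_def letters_def letter_elem_def proj_inv)

lemma X_graph_eq:
  "X_graph k = Cay (G_quot k) (three_gens (G_quot k) (proj k (gen 0)) (proj k (gen 1)) (proj k (gen 3)))"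
  by (simp add: X_graph_def S_quot_def three_gens_def x_quot_def proj_def insert_commute)

text \<open>Invariance extends from x_0 and x_1 to all of G by induction over
  \<open>generate\<close>, and G acts transitively on its quotient by right multiplication.\<close>

lemma generate_invariant:
  assumes inv: "\<And>h. h \<in> carrier (G_quot k) \<Longrightarrow> f (h \<otimes>\<^bsub>G_quot k\<^esub> proj k (gen 0)) = f h"
    "\<And>h. h \<in> carrier (G_quot k) \<Longrightarrow> f (h \<otimes>\<^bsub>G_quot k\<^esub> proj k (gen 1)) = f h"
    and "h \<in> carrier (G_quot k)" "h' \<in> carrier (G_quot k)"
  shows "f h = f h'"
proof -
  interpret Q: group "G_quot k" by (rule group_G_quot)
  have gen: "f (x \<otimes>\<^bsub>G_quot k\<^esub> proj k g) = f x" if "g \<in> G_sub" "x \<in> carrier (G_quot k)" for g x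
    using that unfolding G_sub_def
  proof (induction g arbitrary: x rule: generate.induct)
    case one
    then show ?case by (simp add: proj_one)
  next
    case (incl s)
    then show ?case using inv by auto
  next
    case (inv s)
    then have s: "s \<in> G_sub" using gen_0_1_3_in_G_sub by auto
    have "f (x \<otimes>\<^bsub>G_quot k\<^esub> inv\<^bsub>G_quot k\<^esub> proj k s \<otimes>\<^bsub>G_quot k\<^esub> proj k s) = f (x \<otimes>\<^bsub>G_quot k\<^esub> inv\<^bsub>G_quot k\<^esub> proj k s)"
      using inv assms(1,2)[of "x \<otimes>\<^bsub>G_quot k\<^esub> inv\<^bsub>G_quot k\<^esub> proj k s"] s by (auto simp: proj_closed)
    then show ?case
      using s inv(2) by (simp add: Q.m_assoc proj_closed proj_inv proj_mult proj_one)
  next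
    case (eng g1 g2)
    then have "g1 \<in> G_sub" "g2 \<in> G_sub" by (simp_all add: G_sub_def)
    then show ?case
      using eng(3)[of x] eng(4)[of "x \<otimes>\<^bsub>G_quot k\<^esub> proj k g1"] eng(5)
      by (simp add: proj_closed Q.m_assoc flip: proj_mult)
  qed
  have "f x = f \<one>\<^bsub>G_quot k\<^esub>" if x: "x \<in> carrier (G_quot k)" for x
  proof -
    obtain g where "g \<in> G_sub" "x = proj k g" using x by (rule G_quot_carrierE)
    then show ?thesis using gen[of g "\<one>\<^bsub>G_quot k\<^esub>"] x by simp
  qed
  then show ?thesis using assms(3,4) by metis
qed

text \<open>Equal elements of the quotient for k agree on two diagonals, so the coincidences to be
  excluded are already excluded at level 2.\<close>

lemma triangle_group_G_quot:
  assumes "2 \<le> k"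
  shows "triangle_group (G_quot k) (proj k (gen 0)) (proj k (gen 1)) (proj k (gen 3))"
proof -
  interpret Q: group "G_quot k" by (rule group_G_quot)
  let ?a = "proj k (gen 0)" and ?b = "proj k (gen 1)" and ?c = "proj k (gen 3)"
  let ?p = "\<lambda>l. proj k (letter_elem l)"
  have agree2: "agree 2 (rep g) (rep h)" if "proj k g = proj k h" "g \<in> G_sub" "h \<in> G_sub" for g h
    using that agree_mono[OF _ assms] by (simp add: proj_eq_iff)
  show ?thesis
  proof (intro triangle_group.intro Q.group_axioms triangle_group_axioms.intro)
    show "finite (carrier (G_quot k))" by (rule finite_G_quot)
    show "?a \<in> carrier (G_quot k)" "?b \<in> carrier (G_quot k)" "?c \<in> carrier (G_quot k)"
      using gen_0_1_3_in_G_sub by (simp_all add: proj_closed)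
    have "gen 0 \<otimes>\<^bsub>G_tilde\<^esub> gen 1 \<otimes>\<^bsub>G_tilde\<^esub> gen 3 = \<one>\<^bsub>G_tilde\<^esub>"
      using gen_relation[of 0] by simp
    then show "?a \<otimes>\<^bsub>G_quot k\<^esub> ?b \<otimes>\<^bsub>G_quot k\<^esub> ?c = \<one>\<^bsub>G_quot k\<^esub>"
      using gen_0_1_3_in_G_sub by (simp only: proj_mult G_sub.m_closed proj_one)
    have "inj_on ?p letters"
    proof (rule inj_onI)
      fix l l' assume l: "l \<in> letters" "l' \<in> letters" "?p l = ?p l'"
      then have "agree 2 (letter_matrix l) (letter_matrix l')"
        using agree2[of "letter_elem l" "letter_elem l'"] letter_elem by metis
      then show "l = l'" by (rule letter_matrix_inj[OF l(1,2)])
    qed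
    moreover have "card letters = 6" by (simp add: letters_def)
    ultimately show "card (three_gens (G_quot k) ?a ?b ?c) = 6"
      unfolding three_gens_G_quot by (simp add: card_image)
    show "\<one>\<^bsub>G_quot k\<^esub> \<notin> three_gens (G_quot k) ?a ?b ?c"
      unfolding three_gens_G_quot
    proof
      assume "\<one>\<^bsub>G_quot k\<^esub> \<in> ?p ` letters"
      then obtain l where l: "l \<in> letters" "proj k (letter_elem l) = proj k \<one>\<^bsub>G_tilde\<^esub>"
        by (auto simp: proj_one)
      then have "agree 2 (letter_matrix l) \<one>\<^bsub>block_toeplitz\<^esub>"
        using agree2[OF l(2)] letter_elem[OF l(1)] by (simp add: rep_one)
      then show False using letter_matrix_not_one l(1) by blast
    qed
  next
    fix s s' s''
    assume "s \<in> three_gens (G_quot k) ?a ?b ?c" "s' \<in> three_gens (G_quot k) ?a ?b ?c" "s'' \<in> three_gens (G_quot k) ?a ?b ?c"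
      and one: "s \<otimes>\<^bsub>G_quot k\<^esub> s' \<otimes>\<^bsub>G_quot k\<^esub> s'' = \<one>\<^bsub>G_quot k\<^esub>"
    then obtain l l' l'' where l: "l \<in> letters" "l' \<in> letters" "l'' \<in> letters" "s = ?p l" "s' = ?p l'" "s'' = ?p l''"
      unfolding three_gens_G_quot by blast
    note mem = letter_elem(1)[OF l(1)] letter_elem(1)[OF l(2)] letter_elem(1)[OF l(3)]
    have "proj k (letter_elem l \<otimes>\<^bsub>G_tilde\<^esub> letter_elem l' \<otimes>\<^bsub>G_tilde\<^esub> letter_elem l'') = proj k \<one>\<^bsub>G_tilde\<^esub>"
      using one mem by (simp add: l(4-6) proj_mult proj_one)
    from agree2[OF this] mem
    have "agree 2 (letter_matrix l \<otimes>\<^bsub>block_toeplitz\<^esub> letter_matrix l' \<otimes>\<^bsub>block_toeplitz\<^esub> letter_matrix l'') \<one>\<^bsub>block_toeplitz\<^esub>"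
      by (simp add: rep_mult rep_one letter_elem(2)[OF l(1)] letter_elem(2)[OF l(2)] letter_elem(2)[OF l(3)] del: letter_matrix.simps)
    note tr = letter_matrix_triple[OF l(1-3) this]
    have pT: "?p (i, True) = proj k (gen i)" for i
      by (simp add: letter_elem_def)
    have pF: "?p (i, False) = inv\<^bsub>G_quot k\<^esub> proj k (gen i)" if "i \<in> {0, 1, 3}" for i
      using that gen_0_1_3_in_G_sub by (auto simp: letter_elem_def proj_inv)
    from tr show "(s, s', s'') \<in> {(?a, ?b, ?c), (?b, ?c, ?a), (?c, ?a, ?b),
      (inv\<^bsub>G_quot k\<^esub> ?c, inv\<^bsub>G_quot k\<^esub> ?b, inv\<^bsub>G_quot k\<^esub> ?a), (inv\<^bsub>G_quot k\<^esub> ?b, inv\<^bsub>G_quot k\<^esub> ?a, inv\<^bsub>G_quot k\<^esub> ?c),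
      (inv\<^bsub>G_quot k\<^esub> ?a, inv\<^bsub>G_quot k\<^esub> ?c, inv\<^bsub>G_quot k\<^esub> ?b)}"
      unfolding l(4-6) by (elim insertE emptyE) (simp_all add: pT pF)
  next
    fix f :: "_ \<Rightarrow> real" and h h'
    assume "\<And>h. h \<in> carrier (G_quot k) \<Longrightarrow> f (h \<otimes>\<^bsub>G_quot k\<^esub> ?a) = f h"
      "\<And>h. h \<in> carrier (G_quot k) \<Longrightarrow> f (h \<otimes>\<^bsub>G_quot k\<^esub> ?b) = f h"
      "h \<in> carrier (G_quot k)" "h' \<in> carrier (G_quot k)"
    then show "f h = f h'" by (rule generate_invariant)
  qed
qed


text \<open>The homomorphism to \<open>{1, -1}\<close> with \<open>x\<^sub>0, x\<^sub>1 \<mapsto> -1\<close> and \<open>x\<^sub>3 \<mapsto> 1\<close>, which is visible in the first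
  block diagonal, is an eigenfunction.\<close>

lemma minus_2_in_spectrum:
  assumes k: "2 \<le> k"
  shows "- 2 \<in> adj_spectrum (X_graph k)"
proof -
  interpret triangle_group "G_quot k" "proj k (gen 0)" "proj k (gen 1)" "proj k (gen 3)"
    by (rule triangle_group_G_quot[OF k])
  \<comment> \<open>The first diagonal is additive under products; this entry of it is 1 at x_0 and
    x_1 and 0 at x_3.\<close>
  define \<phi> where "\<phi> g = rep g 0 (Suc 0) $ 2 $ 2" for g
  \<comment> \<open>The sign of any representative; congruent representatives share the entry
    \<open>\<phi>\<close>.\<close>
  define f where "f x = (if x \<in> carrier (G_quot k) then
      if \<phi> (SOME g. g \<in> G_sub \<and> proj k g = x) = 0 then 1 else - 1 else 0 :: real)" for x
  have f: "f (proj k g) = (if \<phi> g = 0 then 1 else - 1)" if g: "g \<in> G_sub" for g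
  proof -
    define h where "h = (SOME h. h \<in> G_sub \<and> proj k h = proj k g)"
    have h: "h \<in> G_sub" "proj k h = proj k g"
      unfolding h_def by (rule someI2[of _ g]; use g in simp)+
    then have "agree 2 (rep h) (rep g)"
      using agree_mono[OF _ k] g by (simp add: proj_eq_iff)
    then have "\<phi> h = \<phi> g" unfolding \<phi>_def by (simp add: agree_2D)
    then show ?thesis by (simp add: f_def proj_closed[OF g] flip: h_def)
  qed
  have \<phi>_letter: "\<phi> (letter_elem l) = of_bool (fst l \<noteq> 3)" if "l \<in> letters" for l
    using that letter_elem(2)[OF that] unfolding \<phi>_def letters_def
    by (elim insertE emptyE) (simp_all add: letter_jets bits_def del: letter_matrix.simps)
  have step: "f (x \<otimes>\<^bsub>G_quot k\<^esub> proj k (letter_elem l)) = (if fst l = 3 then f x else - f x)"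
    if l: "l \<in> letters" and x: "x \<in> carrier (G_quot k)" for l x
  proof -
    obtain g where g: "g \<in> G_sub" "x = proj k g" using x by (rule G_quot_carrierE)
    have "\<phi> (g \<otimes>\<^bsub>G_tilde\<^esub> letter_elem l) = \<phi> g + \<phi> (letter_elem l)"
      using g letter_elem(1)[OF l] by (simp add: \<phi>_def rep_mult jets_mult rep_closed)
    then show ?thesis
      using g letter_elem(1)[OF l] \<phi>_letter[OF l] by (simp add: proj_mult f)
  qed
  have S: "\<Gamma> = X_graph k" by (simp add: X_graph_eq)
  \<comment> \<open>Four of the six neighbours carry the opposite sign and two carry the same
    sign.\<close>
  have "adj_op \<Gamma> f x = - 2 * f x" for x
  proof (cases "x \<in> carrier (G_quot k)")
    case True
    have "f (x \<otimes>\<^bsub>G_quot k\<^esub> proj k (gen i)) = (if i = 3 then f x else - f x)"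
      "f (x \<otimes>\<^bsub>G_quot k\<^esub> inv\<^bsub>G_quot k\<^esub> proj k (gen i)) = (if i = 3 then f x else - f x)" if "i \<in> {0, 1, 3}" for i
      using step[OF _ True, of "(i, True)"] step[OF _ True, of "(i, False)"] that gen_0_1_3_in_G_sub
      by (auto simp: letters_def letter_elem_def proj_inv)
    then show ?thesis using True by (simp add: adj_op_\<Gamma> del: One_nat_def)
  qed (simp add: adj_op_def verts_\<Gamma> f_def del: One_nat_def)
  then have "adj_op \<Gamma> f = (\<lambda>x. - 2 * f x)" by (rule ext)
  then have "f \<in> eigenspace \<Gamma> (- 2)"
    by (simp add: eigenspace_def functions_on_def verts_\<Gamma> del: One_nat_def) (simp add: f_def)
  moreover have "f (proj k \<one>\<^bsub>G_tilde\<^esub>) \<noteq> 0" by (simp add: f)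
  then have "f \<noteq> (\<lambda>_. 0)" by auto
  ultimately show ?thesis unfolding S[symmetric] adj_spectrum_def by blast
qed

section \<open>Uniform comparison of generating sets and transfer of the gap\<close>

definition displacement :: "nat \<Rightarrow> nat word set \<Rightarrow> (nat word set set \<Rightarrow> real) \<Rightarrow> real" where
  "displacement k g f = (\<Sum>h\<in>carrier (G_quot k). (f (h \<otimes>\<^bsub>G_quot k\<^esub> proj k g) - f h)\<^sup>2)"

definition gen_energy :: "nat \<Rightarrow> (nat word set set \<Rightarrow> real) \<Rightarrow> real" where
  "gen_energy k f = displacement k (gen 0) f + displacement k (gen 1) f + displacement k (gen 3) f"

lemma displacement_nonneg: "0 \<le> displacement k g f"
  unfolding displacement_def by (intro sum_nonneg) simp

text \<open>The constant is fixed before \<open>k\<close> and \<open>f\<close>: it comes from one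
  derivation of \<open>g\<close> from x_0 and x_1, where a product costs 2 L1 + 2 L2. This order of
  quantifiers is the source of uniformity.\<close>

lemma displacement_le_gen_energy:
  assumes "g \<in> G_sub"
  shows "\<exists>L. \<forall>k f. displacement k g f \<le> L * gen_energy k f"
  using assms unfolding G_sub_def
proof (induction g rule: generate.induct)
  case one
  have "displacement k \<one>\<^bsub>G_tilde\<^esub> f = 0" for k f
    using monoid.r_one[OF group.is_monoid[OF group_G_quot]] by (simp add: displacement_def proj_one)
  then show ?case by (intro exI[of _ 0]) simp
next
  case (incl s)
  then have "displacement k s f \<le> 1 * gen_energy k f" for k f
    using displacement_nonneg[of k "gen 0" f] displacement_nonneg[of k "gen 1" f] displacement_nonneg[of k "gen 3" f]
    by (auto simp: gen_energy_def)
  then show ?case by blast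
next
  case (inv s)
  then have s: "s \<in> G_sub" using gen_0_1_3_in_G_sub by auto
  have "displacement k (inv\<^bsub>G_tilde\<^esub> s) f = displacement k s f" for k f
  proof -
    interpret Q: group "G_quot k" by (rule group_G_quot)
    have "displacement k (inv\<^bsub>G_tilde\<^esub> s) f
        = (\<Sum>h\<in>carrier (G_quot k). (f (h \<otimes>\<^bsub>G_quot k\<^esub> proj k s \<otimes>\<^bsub>G_quot k\<^esub> proj k (inv\<^bsub>G_tilde\<^esub> s)) - f (h \<otimes>\<^bsub>G_quot k\<^esub> proj k s))\<^sup>2)"
      unfolding displacement_def
      using Q.sum_mult_right[OF proj_closed[OF s], of "\<lambda>h. (f (h \<otimes>\<^bsub>G_quot k\<^esub> proj k (inv\<^bsub>G_tilde\<^esub> s)) - f h)\<^sup>2"]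
      by simp
    also have "\<dots> = displacement k s f"
      unfolding displacement_def using s
      by (intro sum.cong) (simp_all add: Q.m_assoc proj_closed proj_mult proj_one power2_commute)
    finally show ?thesis .
  qed
  moreover have "displacement k s f \<le> 1 * gen_energy k f" for k f
    using inv displacement_nonneg[of k "gen 0" f] displacement_nonneg[of k "gen 1" f] displacement_nonneg[of k "gen 3" f]
    by (auto simp: gen_energy_def)
  ultimately show ?case by (intro exI[of _ 1]) simp
next
  case (eng g1 g2)
  then have g: "g1 \<in> G_sub" "g2 \<in> G_sub" by (simp_all add: G_sub_def)
  obtain L1 L2 where L: "\<And>k f. displacement k g1 f \<le> L1 * gen_energy k f" "\<And>k f. displacement k g2 f \<le> L2 * gen_energy k f"
    using eng.IH by blast
  have "displacement k (g1 \<otimes>\<^bsub>G_tilde\<^esub> g2) f \<le> (2 * L1 + 2 * L2) * gen_energy k f" for k f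
  proof -
    interpret Q: group "G_quot k" by (rule group_G_quot)
    let ?q = "\<lambda>h g. h \<otimes>\<^bsub>G_quot k\<^esub> proj k g"
    have "displacement k (g1 \<otimes>\<^bsub>G_tilde\<^esub> g2) f
        \<le> (\<Sum>h\<in>carrier (G_quot k). 2 * (f (?q (?q h g1) g2) - f (?q h g1))\<^sup>2 + 2 * (f (?q h g1) - f h)\<^sup>2)"
      unfolding displacement_def
    proof (rule sum_mono)
      fix h assume "h \<in> carrier (G_quot k)"
      then have "?q h (g1 \<otimes>\<^bsub>G_tilde\<^esub> g2) = ?q (?q h g1) g2"
        using g by (simp add: Q.m_assoc proj_closed proj_mult)
      moreover have "(x - z)\<^sup>2 \<le> 2 * (x - y)\<^sup>2 + 2 * (y - z)\<^sup>2" for x y z :: real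
        using zero_le_power2[of "(x - y) - (y - z)"] by (simp add: power2_eq_square algebra_simps)
      ultimately show "(f (?q h (g1 \<otimes>\<^bsub>G_tilde\<^esub> g2)) - f h)\<^sup>2
          \<le> 2 * (f (?q (?q h g1) g2) - f (?q h g1))\<^sup>2 + 2 * (f (?q h g1) - f h)\<^sup>2"
        by metis
    qed
    also have "\<dots> = 2 * displacement k g2 f + 2 * displacement k g1 f"
      using Q.sum_mult_right[OF proj_closed[OF g(1)], of "\<lambda>h. (f (?q h g2) - f h)\<^sup>2"]
      by (simp add: sum.distrib displacement_def flip: sum_distrib_left)
    also have "\<dots> \<le> (2 * L1 + 2 * L2) * gen_energy k f"
      using L[of k f] by (simp add: algebra_simps)
    finally show ?thesis .
  qed
  then show ?case by blast
qed

text \<open>The pair \<open>(h, e)\<close> stands for the right coset of G^k obtained from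
  \<open>h\<close> times \<open>coset_rep e\<close>. Right multiplication by x_i replaces the
  representative and leaves the Schreier generator \<open>step i e\<close> behind in G.\<close>

definition induced_action :: "nat \<Rightarrow> nat \<Rightarrow> nat word set set \<times> bool \<Rightarrow> nat word set set \<times> bool" where
  "induced_action k i = (\<lambda>(h, e). (h \<otimes>\<^bsub>G_quot k\<^esub> proj k (step i e), e \<noteq> par i))"

text \<open>The relations are those of \<open>step_relation\<close>. For transitivity, x_0 and x_1
  act on the sheet \<open>False\<close> as themselves, and x_2 carries \<open>(h, False)\<close> to
  \<open>(h, True)\<close> because its Schreier generator there is trivial.\<close>

lemma fano_action_induced: "fano_action (carrier (G_quot k) \<times> UNIV) (induced_action k)"
proof
  interpret Q: group "G_quot k" by (rule group_G_quot)
  show "finite (carrier (G_quot k) \<times> (UNIV :: bool set))" by (simp add: finite_G_quot)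
  show maps: "induced_action k i \<omega> \<in> carrier (G_quot k) \<times> UNIV" if "i < 7" "\<omega> \<in> carrier (G_quot k) \<times> UNIV" for i \<omega>
    using that by (auto simp: induced_action_def proj_closed step_in_G_sub)
  show "induced_action k ((i + 3) mod 7) (induced_action k ((i + 1) mod 7) (induced_action k i \<omega>)) = \<omega>"
    if i: "i < 7" and mem_\<omega>: "\<omega> \<in> carrier (G_quot k) \<times> UNIV" for i \<omega>
  proof -
    obtain h e where \<omega>: "\<omega> = (h, e)" "h \<in> carrier (G_quot k)" using mem_\<omega> by auto
    define e' where "e' = (e \<noteq> par i)"
    define e'' where "e'' = (e' \<noteq> par ((i + 1) mod 7))"
    note rel = step_relation[OF i e'_def e''_def]
    have mem: "step i e \<in> G_sub" "step ((i + 1) mod 7) e' \<in> G_sub" "step ((i + 3) mod 7) e'' \<in> G_sub"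
      using i by (simp_all add: step_in_G_sub)
    have "proj k (step i e) \<otimes>\<^bsub>G_quot k\<^esub> proj k (step ((i + 1) mod 7) e') \<otimes>\<^bsub>G_quot k\<^esub> proj k (step ((i + 3) mod 7) e'')
        = \<one>\<^bsub>G_quot k\<^esub>"
      using mem rel(1) by (simp only: proj_mult G_sub.m_closed proj_one)
    then have "h \<otimes>\<^bsub>G_quot k\<^esub> proj k (step i e) \<otimes>\<^bsub>G_quot k\<^esub> proj k (step ((i + 1) mod 7) e') \<otimes>\<^bsub>G_quot k\<^esub> proj k (step ((i + 3) mod 7) e'') = h"
      using \<omega>(2) proj_closed[OF mem(1)] proj_closed[OF mem(2)] proj_closed[OF mem(3)] by (simp add: Q.m_assoc)
    then show ?thesis
      unfolding induced_action_def \<omega>(1) case_prod_conv e'_def[symmetric] e''_def[symmetric] rel(2) by simp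
  qed
  fix f :: "nat word set set \<times> bool \<Rightarrow> real" and \<omega> \<omega>' :: "nat word set set \<times> bool"
  assume inv: "\<And>i \<omega>. i < 7 \<Longrightarrow> \<omega> \<in> carrier (G_quot k) \<times> UNIV \<Longrightarrow> f (induced_action k i \<omega>) = f \<omega>"
    and \<omega>: "\<omega> \<in> carrier (G_quot k) \<times> UNIV" "\<omega>' \<in> carrier (G_quot k) \<times> UNIV"
  have steps: "step 0 False = gen 0" "step 1 False = gen 1" "step 2 False = \<one>\<^bsub>G_tilde\<^esub>"
    by (simp_all add: step_def coset_rep_def par_def gen_closed)
  have False_const: "f (h, False) = f (h', False)" if "h \<in> carrier (G_quot k)" "h' \<in> carrier (G_quot k)" for h h'
  proof (rule generate_invariant[of k "\<lambda>h. f (h, False)", OF _ _ that])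
    show "f (x \<otimes>\<^bsub>G_quot k\<^esub> proj k (gen 0), False) = f (x, False)" if "x \<in> carrier (G_quot k)" for x
      using inv[of 0 "(x, False)"] that by (simp add: induced_action_def steps par_def)
    show "f (x \<otimes>\<^bsub>G_quot k\<^esub> proj k (gen 1), False) = f (x, False)" if "x \<in> carrier (G_quot k)" for x
      using inv[of 1 "(x, False)"] that steps(2) by (simp add: induced_action_def par_def)
  qed
  have True_False: "f (h, True) = f (h, False)" if "h \<in> carrier (G_quot k)" for h
    using inv[of 2 "(h, False)"] that by (simp add: induced_action_def steps par_def proj_one)
  have "f (h, e) = f (h, False)" if "h \<in> carrier (G_quot k)" for h e
    using True_False[OF that] by (cases e) simp_all
  with \<omega> False_const show "f \<omega> = f \<omega>'"
    by (metis mem_Sigma_iff surj_pair)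
qed

lemma sum_times_bool: "(\<Sum>\<omega>\<in>A \<times> (UNIV :: bool set). g (fst \<omega>)) = 2 * (\<Sum>h\<in>A. g h :: real)"
  by (simp add: sum.cartesian_product' UNIV_bool sum_distrib_left)

text \<open>The constant does not depend on \<open>k\<close>, because the Schreier generators are fixed words in
  \<open>x\<^sub>0\<close> and \<open>x\<^sub>1\<close>.\<close>

lemma uniform_gap:
  "\<exists>K\<ge>1. \<forall>k f. (\<Sum>h\<in>carrier (G_quot k). f h) = 0 \<longrightarrow> (\<Sum>h\<in>carrier (G_quot k). (f h)\<^sup>2) \<le> K * gen_energy k f"
proof -
  have "\<forall>p. fst p < 7 \<longrightarrow> (\<exists>L. \<forall>k f. displacement k (step (fst p) (snd p)) f \<le> L * gen_energy k f)"
    using displacement_le_gen_energy step_in_G_sub by blast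
  then obtain L where L: "\<And>i e k f. i < 7 \<Longrightarrow> displacement k (step i e) f \<le> L (i, e) * gen_energy k f"
    by (metis fst_conv snd_conv)
  \<comment> \<open>The fourteen Schreier constants are added up; the maximum with 1 places
    \<open>6 - 1 / K\<close> strictly between 0 and 6.\<close>
  define K where "K = max 1 (\<Sum>e\<in>UNIV. \<Sum>i<7. L (i, e))"
  have "(\<Sum>h\<in>carrier (G_quot k). (f h)\<^sup>2) \<le> K * gen_energy k f" if f: "(\<Sum>h\<in>carrier (G_quot k). f h) = 0" for k f
  proof -
    interpret fano_action "carrier (G_quot k) \<times> UNIV" "induced_action k" by (rule fano_action_induced)
    \<comment> \<open>The pullback is constant on the two sheets, so its sum and squared norm are
      doubled and mean zero is kept.\<close>
    let ?F = "\<lambda>\<omega>. f (fst \<omega>)"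
    have E: "0 \<le> gen_energy k f"
      using displacement_nonneg by (simp add: gen_energy_def)
    have "(\<Sum>\<omega>\<in>carrier (G_quot k) \<times> (UNIV :: bool set). ?F \<omega>) = 0"
      using f by (simp add: sum_times_bool)
    then have "14/11 * (\<Sum>\<omega>\<in>carrier (G_quot k) \<times> (UNIV :: bool set). (?F \<omega>)\<^sup>2)
        \<le> (\<Sum>\<omega>\<in>carrier (G_quot k) \<times> UNIV. \<Sum>i<7. (?F (induced_action k i \<omega>) - ?F \<omega>)\<^sup>2)"
      by (rule spectral_gap)
    also have "\<dots> = (\<Sum>h\<in>carrier (G_quot k). \<Sum>e\<in>UNIV. \<Sum>i<7. (f (h \<otimes>\<^bsub>G_quot k\<^esub> proj k (step i e)) - f h)\<^sup>2)"
      by (simp only: sum.cartesian_product' induced_action_def case_prod_conv fst_conv)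
    also have "\<dots> = (\<Sum>e\<in>UNIV. \<Sum>i<7. displacement k (step i e) f)"
      unfolding displacement_def by (subst sum.swap) (intro sum.cong HOL.refl sum.swap)
    also have "\<dots> \<le> (\<Sum>e\<in>UNIV. \<Sum>i<7. L (i, e) * gen_energy k f)"
      by (intro sum_mono L) simp
    also have "\<dots> = (\<Sum>e\<in>UNIV. \<Sum>i<7. L (i, e)) * gen_energy k f"
      by (simp only: sum_distrib_right)
    also have "\<dots> \<le> K * gen_energy k f"
      using E by (intro mult_right_mono) (simp_all add: K_def)
    finally have "14/11 * (\<Sum>\<omega>\<in>carrier (G_quot k) \<times> (UNIV :: bool set). (?F \<omega>)\<^sup>2) \<le> K * gen_energy k f" .
    moreover have "(\<Sum>\<omega>\<in>carrier (G_quot k) \<times> (UNIV :: bool set). (?F \<omega>)\<^sup>2) = 2 * (\<Sum>h\<in>carrier (G_quot k). (f h)\<^sup>2)"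
      using sum_times_bool[of "\<lambda>h. (f h)\<^sup>2"] .
    moreover have "0 \<le> (\<Sum>h\<in>carrier (G_quot k). (f h)\<^sup>2)" by (intro sum_nonneg) simp
    ultimately show ?thesis by linarith
  qed
  moreover have "1 \<le> K" by (simp add: K_def)
  ultimately show ?thesis by blast
qed

text \<open>An eigenfunction for \<open>\<mu> \<noteq> 6\<close> has mean zero and energy
  \<open>6 - \<mu>\<close> times its squared norm, so the uniform gap reads
  \<open>1 \<le> K * (6 - \<mu>)\<close>.\<close>

lemma uniform_spectral_bound:
  "\<exists>C. 0 < C \<and> C < 6 \<and> (\<forall>k\<ge>2. \<forall>\<mu>\<in>adj_spectrum (X_graph k). \<mu> \<le> C \<or> \<mu> = 6)"
proof -
  obtain K where K: "1 \<le> K" "\<And>k f. (\<Sum>h\<in>carrier (G_quot k). f h) = 0 \<Longrightarrow>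
      (\<Sum>h\<in>carrier (G_quot k). (f h)\<^sup>2) \<le> K * gen_energy k f"
    using uniform_gap by blast
  have "\<mu> \<le> 6 - 1 / K" if k: "2 \<le> k" and \<mu>: "\<mu> \<in> adj_spectrum (X_graph k)" "\<mu> \<noteq> 6" for k \<mu>
  proof -
    interpret triangle_group "G_quot k" "proj k (gen 0)" "proj k (gen 1)" "proj k (gen 3)"
      by (rule triangle_group_G_quot[OF k])
    obtain f where f: "f \<in> eigenspace \<Gamma> \<mu>" "f \<noteq> (\<lambda>_. 0)"
      using \<mu>(1) by (auto simp: adj_spectrum_def X_graph_eq)
    have pos: "0 < (\<Sum>h\<in>carrier (G_quot k). (f h)\<^sup>2)"
      using eigenfunction_norm_pos[of \<Gamma> f] f finite_Q
      by (simp add: verts_\<Gamma> eigenspace_def del: One_nat_def)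
    have "(\<Sum>h\<in>carrier (G_quot k). (f h)\<^sup>2) \<le> K * gen_energy k f"
      using eigenfunction_sum_0[OF f(1) \<mu>(2)] by (rule K(2))
    also have "gen_energy k f = (6 - \<mu>) * (\<Sum>h\<in>carrier (G_quot k). (f h)\<^sup>2)"
      using energy_eigenfunction[OF f(1)] by (simp add: gen_energy_def displacement_def energy_def del: One_nat_def)
    finally have "1 \<le> K * (6 - \<mu>)"
      using pos by (simp add: mult.assoc[symmetric])
    then show ?thesis using K(1) by (simp add: field_simps)
  qed
  moreover have "0 < 6 - 1 / K" "6 - 1 / K < 6" using K(1) by (simp_all add: field_simps)
  ultimately show ?thesis by blast
qed

theorem theorem1p1:
  shows "(\<forall>k \<ge> 2. \<forall>\<theta> \<in> adj_spectrum (T_graph k).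
            \<theta> \<in> {-3..3} \<and> \<theta>\<^sup>2 - 3 \<in> {-3..6} \<and> \<theta>\<^sup>2 - 3 \<in> adj_spectrum (X_graph k)) \<and>
         (\<exists>C :: real. 0 < C \<and> C < 6 \<and>
            (expander_family 6 {2..} X_graph \<and>
             (\<forall>k \<ge> 2. adj_spectrum (X_graph k) \<subseteq> {-3..C} \<union> {6})) \<and>
            ((\<forall>k \<ge> 2. bipartite (T_graph k)) \<and>
             expander_family 3 {2..} T_graph \<and>
             (\<forall>k \<ge> 2. adj_spectrum (T_graph k) \<subseteq> {- sqrt (C + 3)..sqrt (C + 3)} \<union> {3, -3})))"
proof -
  obtain C where C: "0 < C" "C < 6" "\<And>k \<mu>. 2 \<le> k \<Longrightarrow> \<mu> \<in> adj_spectrum (X_graph k) \<Longrightarrow> \<mu> \<le> C \<or> \<mu> = 6"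
    using uniform_spectral_bound by blast
  have tg: "triangle_group (G_quot k) (proj k (gen 0)) (proj k (gen 1)) (proj k (gen 3))" if "2 \<le> k" for k
    by (rule triangle_group_G_quot[OF that])
  note X = X_graph_eq[symmetric] and T = T_graph_def[symmetric]
  note facts = triangle_group.finite_simple_\<Gamma> triangle_group.regular_\<Gamma> triangle_group.finite_simple_T
    triangle_group.regular_T triangle_group.bipartite_T
  have "sqrt (C + 3) < sqrt (3\<^sup>2)" using C(2) by (subst real_sqrt_less_iff) simp
  then have sqrt: "sqrt (C + 3) < 3" by simp
  have spec: "second_eigenvalue (X_graph k) \<le> C" "adj_spectrum (X_graph k) \<subseteq> {-3..C} \<union> {6}"
    "second_eigenvalue (T_graph k) \<le> sqrt (C + 3)"
    "adj_spectrum (T_graph k) \<subseteq> {- sqrt (C + 3)..sqrt (C + 3)} \<union> {3, -3}" if k: "2 \<le> k" for k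
    using triangle_group.spectral_consequences[OF tg[OF k], of C "- 2"] C(1,2) C(3)[OF k] minus_2_in_spectrum[OF k]
    unfolding X T by simp_all
  have "expander_family 6 {2..} X_graph"
    unfolding expander_family_def
  proof (intro conjI ballI exI[of _ "6 - C"])
    fix k :: nat assume "k \<in> {2..}"
    then have k: "2 \<le> k" by simp
    show "finite_simple (X_graph k)" "regular 6 (X_graph k)"
      using facts(1,2)[OF tg[OF k]] unfolding X by simp_all
    show "second_eigenvalue (X_graph k) \<le> real 6 - (6 - C)"
      using spec(1)[OF k] by simp
  qed (use C in simp)
  moreover have "expander_family 3 {2..} T_graph"
    unfolding expander_family_def
  proof (intro conjI ballI exI[of _ "3 - sqrt (C + 3)"])
    fix k :: nat assume "k \<in> {2..}"
    then have k: "2 \<le> k" by simp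
    show "finite_simple (T_graph k)" "regular 3 (T_graph k)"
      using facts(3,4)[OF tg[OF k]] unfolding X T by simp_all
    show "second_eigenvalue (T_graph k) \<le> real 3 - (3 - sqrt (C + 3))"
      using spec(3)[OF k] by simp
  qed (use sqrt in simp)
  moreover have "bipartite (T_graph k)" if "2 \<le> k" for k
    using facts(5)[OF tg[OF that]] unfolding X T .
  moreover have "\<theta> \<in> {-3..3} \<and> \<theta>\<^sup>2 - 3 \<in> {-3..6} \<and> \<theta>\<^sup>2 - 3 \<in> adj_spectrum (X_graph k)"
    if "2 \<le> k" "\<theta> \<in> adj_spectrum (T_graph k)" for k \<theta>
    using triangle_group.spectrum_T[OF tg[OF that(1)]] triangle_group.spectrum_T_bounds[OF tg[OF that(1)]] that(2)
    unfolding X T by blast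
  ultimately show ?thesis using C(1,2) spec by blast
qed

end
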